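(* Let $\phi$ be an LTL formula over $P=I\uplus O$ with a weight function $w:\mathrm{Lit}(P)\to\mathbb{Z}$. Then one can construct a (finite, turn-based) safety game in which Player 1 has a winning strategy if and only if $\phi$ is E-realizable.
   Context: $P$ is a finite set of atomic propositions partitioned into inputs $I$ (Player $I$) and outputs $O$ (Player $O$); $\Sigma_P=2^P$, $\Sigma_I=2^I$, $\Sigma_O=2^O$. Game: Player $O$ chooses $o_0\in\Sigma_O$, Player $I$ responds $i_0\in\Sigma_I$, then $o_1$, $i_1$, ...; the outcome is $(o_0\cup i_0)(o_1\cup i_1)\cdots$. Strategies: $\lambda_O:(\Sigma_O\Sigma_I)^*\to\Sigma_O$, $\lambda_I:(\Sigma_O\Sigma_I)^*\Sigma_O\to\Sigma_I$. $w$ extends to $\Sigma_I$ by $w(i)=\sum_{p\in i}w(p)+\sum_{p\in I\setminus i}w(\neg p)$, similarly to $\Sigma_O$, and $w(o\cup i)=w(o)+w(i)$; $\mathsf{EL}(u(n))=\sum_{k<n}w(\sigma_k)$ for $u=\sigma_0\sigma_1\cdots$. $\phi$ is E-realizable if there exist $\lambda_O$ and $c_0\in\mathbb{N}$ such that for all $\lambda_I$, $u=\mathsf{Outcome}(\lambda_O,\lambda_I)\models\phi$ and $c_0+\mathsf{EL}(u(n))\ge0$ for all $n\ge0$. A safety game consists of a finite game graph $(S=S_1\uplus S_2,s_0,E)$ (every state has a successor; Player 1 chooses the successor from states of $S_1$, Player 2 from states of $S_2$) and a set $\alpha\subseteq S$; a strategy of Player 1 is winning if every play from $s_0$ consistent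 with it stays in $\alpha$ forever. *)

theory Defs
  imports Main "HOL-Library.FuncSet" "HOL-Library.Nat_Bijection"
begin

section \<open>LTL over infinite words\<close>

datatype (atoms: 'p) ltl =
    LTrue
  | LAtom 'p
  | LNot "'p ltl"
  | LOr "'p ltl" "'p ltl"
  | LNext "'p ltl"
  | LUntil "'p ltl" "'p ltl"

text \<open>\<open>holds_at u i \<phi>\<close>: the suffix of \<open>u\<close> starting at position \<open>i\<close> satisfies \<open>\<phi>\<close>.\<close>

fun holds_at :: "(nat \<Rightarrow> 'p set) \<Rightarrow> nat \<Rightarrow> 'p ltl \<Rightarrow> bool" where
  "holds_at u i LTrue \<longleftrightarrow> True"
| "holds_at u i (LAtom p) \<longleftrightarrow> p \<in> u i"
| "holds_at u i (LNot \<phi>) \<longleftrightarrow> \<not> holds_at u i \<phi>"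
| "holds_at u i (LOr \<phi> \<psi>) \<longleftrightarrow> holds_at u i \<phi> \<or> holds_at u i \<psi>"
| "holds_at u i (LNext \<phi>) \<longleftrightarrow> holds_at u (Suc i) \<phi>"
| "holds_at u i (LUntil \<phi> \<psi>) \<longleftrightarrow>
     (\<exists>j\<ge>i. holds_at u j \<psi> \<and> (\<forall>k. i \<le> k \<and> k < j \<longrightarrow> holds_at u k \<phi>))"

definition models :: "(nat \<Rightarrow> 'p set) \<Rightarrow> 'p ltl \<Rightarrow> bool" where
  "models u \<phi> \<longleftrightarrow> holds_at u 0 \<phi>"


section \<open>The realizability game and energy levels\<close>

datatype 'p literal = Pos 'p | Neg 'p

definition letter_weight :: "('p literal \<Rightarrow> int) \<Rightarrow> 'p set \<Rightarrow> 'p set \<Rightarrow> int" where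
  "letter_weight w X x = (\<Sum>p\<in>x. w (Pos p)) + (\<Sum>p\<in>X - x. w (Neg p))"

definition energy_level ::
  "'p set \<Rightarrow> 'p set \<Rightarrow> ('p literal \<Rightarrow> int) \<Rightarrow> (nat \<Rightarrow> 'p set) \<Rightarrow> nat \<Rightarrow> int" where
  "energy_level inputs outputs w u n =
     (\<Sum>k<n. letter_weight w outputs (u k \<inter> outputs) + letter_weight w inputs (u k \<inter> inputs))"

text \<open>A word in \<open>(\<Sigma>\<^sub>O \<Sigma>\<^sub>I)\<^sup>*\<close> is a list of pairs (output letter, input letter).\<close>

type_synonym 'p history = "('p set \<times> 'p set) list"

definition histories :: "'p set \<Rightarrow> 'p set \<Rightarrow> 'p history set" where
  "histories inputs outputs = lists (Pow outputs \<times> Pow inputs)"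

definition strategies_O :: "'p set \<Rightarrow> 'p set \<Rightarrow> ('p history \<Rightarrow> 'p set) set" where
  "strategies_O inputs outputs = histories inputs outputs \<rightarrow> Pow outputs"

definition strategies_I :: "'p set \<Rightarrow> 'p set \<Rightarrow> ('p history \<times> 'p set \<Rightarrow> 'p set) set" where
  "strategies_I inputs outputs = histories inputs outputs \<times> Pow outputs \<rightarrow> Pow inputs"

fun history_after ::
  "('p history \<Rightarrow> 'p set) \<Rightarrow> ('p history \<times> 'p set \<Rightarrow> 'p set) \<Rightarrow> nat \<Rightarrow> 'p history" where
  "history_after lO lI 0 = []"
| "history_after lO lI (Suc n) =
     (let h = history_after lO lI n in h @ [(lO h, lI (h, lO h))])"

definition outcome ::
  "('p history \<Rightarrow> 'p set) \<Rightarrow> ('p history \<times> 'p set \<Rightarrow> 'p set) \<Rightarrow> nat \<Rightarrow> 'p set" where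
  "outcome lO lI n = (let h = history_after lO lI n in lO h \<union> lI (h, lO h))"

definition E_realizable ::
  "'p set \<Rightarrow> 'p set \<Rightarrow> ('p literal \<Rightarrow> int) \<Rightarrow> 'p ltl \<Rightarrow> bool" where
  "E_realizable inputs outputs w \<phi> \<longleftrightarrow>
     (\<exists>lO\<in>strategies_O inputs outputs. \<exists>c0::nat. \<forall>lI\<in>strategies_I inputs outputs.
        models (outcome lO lI) \<phi> \<and>
        (\<forall>n. int c0 + energy_level inputs outputs w (outcome lO lI) n \<ge> 0))"


section \<open>Finite turn-based safety games\<close>

record 's safety_game =
  states1 :: "'s set"
  states2 :: "'s set"
  init :: 's
  edges :: "('s \<times> 's) set"
  safe :: "'s set"

definition states :: "'s safety_game \<Rightarrow> 's set" where
  "states G = states1 G \<union> states2 G"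

definition is_safety_game :: "'s safety_game \<Rightarrow> bool" where
  "is_safety_game G \<longleftrightarrow>
     finite (states G) \<and> states1 G \<inter> states2 G = {} \<and> init G \<in> states G \<and>
     edges G \<subseteq> states G \<times> states G \<and> (\<forall>s\<in>states G. \<exists>t. (s, t) \<in> edges G) \<and>
     safe G \<subseteq> states G"

definition strategies1 :: "'s safety_game \<Rightarrow> ('s list \<Rightarrow> 's) set" where
  "strategies1 G =
     {\<tau>. \<forall>h\<in>lists (states G). \<forall>s\<in>states1 G. (s, \<tau> (h @ [s])) \<in> edges G}"

definition plays :: "'s safety_game \<Rightarrow> (nat \<Rightarrow> 's) set" where
  "plays G = {\<rho>. \<rho> 0 = init G \<and> (\<forall>n. (\<rho> n, \<rho> (Suc n)) \<in> edges G)}"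

definition consistent1 :: "'s safety_game \<Rightarrow> ('s list \<Rightarrow> 's) \<Rightarrow> (nat \<Rightarrow> 's) \<Rightarrow> bool" where
  "consistent1 G \<tau> \<rho> \<longleftrightarrow> (\<forall>n. \<rho> n \<in> states1 G \<longrightarrow> \<rho> (Suc n) = \<tau> (map \<rho> [0..<Suc n]))"

definition winning1 :: "'s safety_game \<Rightarrow> ('s list \<Rightarrow> 's) \<Rightarrow> bool" where
  "winning1 G \<tau> \<longleftrightarrow> (\<forall>\<rho>\<in>plays G. consistent1 G \<tau> \<rho> \<longrightarrow> (\<forall>n. \<rho> n \<in> safe G))"

definition player1_wins :: "'s safety_game \<Rightarrow> bool" where
  "player1_wins G \<longleftrightarrow> (\<exists>\<tau>\<in>strategies1 G. winning1 G \<tau>)"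


section \<open>Computable functions\<close>

text \<open>
  \<open>recursive n f\<close>: \<open>f\<close> is a total recursive function of \<open>n\<close> arguments, in Kleene's
  presentation in which minimisation is applied only to functions that have a zero for every
  choice of the parameters. Only the values of \<open>f\<close> on lists of length \<open>n\<close> are meaningful.
\<close>

inductive recursive :: "nat \<Rightarrow> (nat list \<Rightarrow> nat) \<Rightarrow> bool" where
  zero: "recursive n (\<lambda>_. 0)"
| succ: "recursive 1 (\<lambda>xs. Suc (hd xs))"
| proj: "i < n \<Longrightarrow> recursive n (\<lambda>xs. xs ! i)"
| comp: "recursive (length fs) g \<Longrightarrow> \<forall>f\<in>set fs. recursive n f \<Longrightarrow>
     recursive n (\<lambda>xs. g (map (\<lambda>f. f xs) fs))"
| prim_rec: "recursive n g \<Longrightarrow> recursive (Suc (Suc n)) h \<Longrightarrow>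
     recursive (Suc n) (\<lambda>xs. rec_nat (g (tl xs)) (\<lambda>k r. h (k # r # tl xs)) (hd xs))"
| minimise: "recursive (Suc n) g \<Longrightarrow> \<forall>xs. length xs = n \<longrightarrow> (\<exists>k. g (k # xs) = 0) \<Longrightarrow>
     recursive n (\<lambda>xs. LEAST k. g (k # xs) = 0)"

definition computable :: "(nat \<Rightarrow> nat) \<Rightarrow> bool" where
  "computable f \<longleftrightarrow> (\<exists>g. recursive 1 g \<and> (\<forall>x. f x = g [x]))"

text \<open>
  Atomic propositions and game states are natural numbers, so that specifications and games are
  finite objects with a numerical code. Of the weight function, the code lists just the weights of
  the literals over the propositions at hand.
\<close>

fun encode_ltl :: "nat ltl \<Rightarrow> nat" where
  "encode_ltl LTrue = prod_encode (0, 0)"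
| "encode_ltl (LAtom p) = prod_encode (1, p)"
| "encode_ltl (LNot \<phi>) = prod_encode (2, encode_ltl \<phi>)"
| "encode_ltl (LOr \<phi> \<psi>) = prod_encode (3, prod_encode (encode_ltl \<phi>, encode_ltl \<psi>))"
| "encode_ltl (LNext \<phi>) = prod_encode (4, encode_ltl \<phi>)"
| "encode_ltl (LUntil \<phi> \<psi>) = prod_encode (5, prod_encode (encode_ltl \<phi>, encode_ltl \<psi>))"

definition encode_weights :: "nat set \<Rightarrow> (nat literal \<Rightarrow> int) \<Rightarrow> nat" where
  "encode_weights P w =
     list_encode (map (\<lambda>p. prod_encode (int_encode (w (Pos p)), int_encode (w (Neg p))))
       (sorted_list_of_set P))"

definition encode_spec ::
  "nat set \<Rightarrow> nat set \<Rightarrow> (nat literal \<Rightarrow> int) \<Rightarrow> nat ltl \<Rightarrow> nat" where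
  "encode_spec inputs outputs w \<phi> =
     list_encode [set_encode inputs, set_encode outputs,
       encode_weights (inputs \<union> outputs) w, encode_ltl \<phi>]"

definition encode_game :: "nat safety_game \<Rightarrow> nat" where
  "encode_game G =
     list_encode [set_encode (states1 G), set_encode (states2 G), init G,
       set_encode (prod_encode ` edges G), set_encode (safe G)]"

lemma encode_ltl_inject: "encode_ltl \<phi> = encode_ltl \<psi> \<longleftrightarrow> \<phi> = \<psi>"
proof (induction \<phi> arbitrary: \<psi>)
  case LTrue then show ?case by (cases \<psi>) auto
next
  case (LAtom p) then show ?case by (cases \<psi>) auto
next
  case (LNot \<phi>) then show ?case by (cases \<psi>) auto
next
  case (LOr \<phi>1 \<phi>2) then show ?case by (cases \<psi>) auto
next
  case (LNext \<phi>) then show ?case by (cases \<psi>) auto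
next
  case (LUntil \<phi>1 \<phi>2) then show ?case by (cases \<psi>) auto
qed

lemma encode_game_inject:
  fixes G H :: "nat safety_game"
  assumes "is_safety_game G" and "is_safety_game H"
  shows "encode_game G = encode_game H \<longleftrightarrow> G = H"
proof -
  have fin: "finite (states1 K)" "finite (states2 K)" "finite (edges K)" "finite (safe K)"
    if "is_safety_game K" for K :: "nat safety_game"
    using that finite_subset[of "edges K" "states K \<times> states K"]
      finite_subset[of "safe K" "states K"]
    by (auto simp: is_safety_game_def states_def)
  show ?thesis
    using fin[OF assms(1)] fin[OF assms(2)]
    by (auto simp: encode_game_def set_encode_eq inj_image_eq_iff[OF inj_prod_encode])
qed

lemma encode_spec_inject:
  assumes "finite inputs" "finite outputs" "finite inputs'" "finite outputs'"
  shows "encode_spec inputs outputs w \<phi> = encode_spec inputs' outputs' w' \<phi>' \<longleftrightarrow>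
    inputs = inputs' \<and> outputs = outputs' \<and> \<phi> = \<phi>' \<and>
    (\<forall>p\<in>inputs \<union> outputs. w (Pos p) = w' (Pos p) \<and> w (Neg p) = w' (Neg p))"
  using assms
  by (auto simp: encode_spec_def encode_weights_def set_encode_eq encode_ltl_inject
      list_encode_eq int_encode_eq)

end

theory Submission imports Defs begin

text \<open>
  Since the game only has to have the right winner, it suffices to decide E-realizability, and for
  that it suffices to give finite certificates, checkable by a recursive predicate, for
  E-realizability and for its negation, such that one of the two always exists: an unbounded search
  then terminates.

  A certificate is a finite-state machine for one of the players whose product with the tableau
  automaton of the formula carries a progress measure. Soundness is immediate. For existence, the
  formula is turned into a deterministic parity automaton, which together with the weights gives a
  finite game in which the output player wants the least priority seen infinitely often to be even
  and the energy to be bounded below. The set of plays with this property is closed under shuffles,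
  so by induction on the number of edges either the output player wins with finite memory or the
  input player has a positional strategy that beats every initial credit.
\<close>

section \<open>Walks and progress measures in finite graphs\<close>

text \<open>Determinisation and determinacy serve only to prove that a certificate exists. Neither
  is ever executed, so both may rest on nonconstructive definitions, and no size bound for
  certificates has to be computed. The recursive predicate sees the certificate alone, and for it
  the nondeterministic tableau is good enough because it is unambiguous: the only fair run over a
  word is the one that lists the true formulas. Hence one local check serves both players. A
  positive certificate shows that no fair run starts from a guess in which the formula is false, and
  separately gives each machine state a sufficient credit. A negative one shows that along every
  fair run starting from a guess in which the formula is true the energy is unbounded below, so no
  finite credit helps. The obstacle to determinacy is that the output player may need memory, for
  instance to alternate between gaining energy and visiting a good priority. Strategies of that
  player are therefore merged by shuffling, while those of the input player stay positional.\<close>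

inductive walk :: "('v \<times> 'v) set \<Rightarrow> 'v \<Rightarrow> 'v list \<Rightarrow> 'v \<Rightarrow> bool" for E where
  walk_Nil: "walk E x [] x"
| walk_Cons: "(x, y) \<in> E \<Longrightarrow> walk E y xs z \<Longrightarrow> walk E x (x # xs) z"

lemma walk_Nil_iff [simp]: "walk E x [] y \<longleftrightarrow> x = y"
  by (auto elim: walk.cases intro: walk.intros)

lemma walk_Cons_iff [simp]: "walk E x (a # xs) z \<longleftrightarrow> a = x \<and> (\<exists>y. (x, y) \<in> E \<and> walk E y xs z)"
  by (auto elim: walk.cases intro: walk.intros)

text \<open>The list of a walk omits the endpoint. So walks concatenate as lists, and the list of a
  closed walk counts each visit exactly once, which makes vertex weights additive over
  cycles.\<close>

lemma walk_append [simp]: "walk E x (xs @ ys) z \<longleftrightarrow> (\<exists>y. walk E x xs y \<and> walk E y ys z)"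
  by (induction xs arbitrary: x) auto

lemma walk_rtrancl: "walk E x xs y \<Longrightarrow> (x, y) \<in> E\<^sup>*"
  by (induction rule: walk.induct) auto

lemma rtrancl_walk: "(x, y) \<in> E\<^sup>* \<Longrightarrow> \<exists>xs. walk E x xs y"
proof (induction rule: converse_rtrancl_induct)
  case base show ?case by (rule exI[of _ "[]"]) simp
next
  case (step a b)
  then obtain xs where "walk E b xs y" by blast
  then have "walk E a (a # xs) y" using step.hyps(1) by auto
  then show ?case by blast
qed

lemma trancl_walk:
  assumes "(x, y) \<in> E\<^sup>+"
  obtains xs where "walk E x xs y" "xs \<noteq> []"
proof -
  obtain z where z: "(x, z) \<in> E" "(z, y) \<in> E\<^sup>*" using assms by (meson tranclD)
  then obtain xs where "walk E z xs y" using rtrancl_walk by metis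
  then have "walk E x (x # xs) y" using z by auto
  then show ?thesis using that by blast
qed

lemma walk_mono: "walk E x xs y \<Longrightarrow> E \<subseteq> E' \<Longrightarrow> walk E' x xs y"
  by (induction rule: walk.induct) auto

lemma walk_sources: "walk E x xs y \<Longrightarrow> set xs \<subseteq> Domain E"
  by (induction rule: walk.induct) auto

lemma walk_replicate: "walk E x xs x \<Longrightarrow> walk E x (concat (replicate k xs)) x"
  by (induction k) auto

lemma walk_rotate: "walk E x (as @ b # bs) x \<Longrightarrow> walk E b (b # bs @ as) b"
  by auto

lemma walk_between:
  assumes "\<And>n. (\<rho> n, \<rho> (Suc n)) \<in> E"
  shows "walk E (\<rho> i) (map \<rho> [i..<i + d]) (\<rho> (i + d))"
  using assms by (induction d) auto

text \<open>Repeating a closed walk forever gives an infinite path, and \<open>stem_path\<close>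
  puts a stem in front of it. In this way facts about infinite words are applied to finite
  cycles.\<close>

lemma cycle_path:
  assumes "walk E x xs x" "xs \<noteq> []"
  shows "(xs ! (n mod length xs), xs ! (Suc n mod length xs)) \<in> E"
proof -
  have *: "(ys ! k, (ys @ [z]) ! Suc k) \<in> E" if "walk E y ys z" "k < length ys" for y ys z k
    using that
  proof (induction arbitrary: k rule: walk.induct)
    case (walk_Cons x y xs z)
    have "xs @ [z] \<noteq> [] \<and> hd (xs @ [z]) = y"
      using walk_Cons.hyps(2) by (cases xs) auto
    then have "(xs @ [z]) ! 0 = y" by (metis hd_conv_nth)
    then show ?case using walk_Cons by (cases k) auto
  qed simp
  have hd: "xs ! 0 = x" using assms by (cases xs) auto
  let ?k = "n mod length xs"
  have k: "?k < length xs" using assms by simp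
  have "(xs @ [x]) ! Suc ?k = xs ! (Suc n mod length xs)"
    using k hd by (auto simp: nth_append mod_Suc)
  then show ?thesis using *[OF assms(1) k] by simp
qed

lemma stem_path:
  assumes "walk E s ss x" "\<And>n. (\<rho> n, \<rho> (Suc n)) \<in> E" "\<rho> 0 = x"
  obtains \<rho>' k where "\<rho>' 0 = s" "\<And>n. (\<rho>' n, \<rho>' (Suc n)) \<in> E" "\<And>n. \<rho>' (k + n) = \<rho> n"
proof -
  have "\<exists>\<rho>' k. \<rho>' 0 = s \<and> (\<forall>n. (\<rho>' n, \<rho>' (Suc n)) \<in> E) \<and> (\<forall>n. \<rho>' (k + n) = \<rho> n)"
    using assms
  proof (induction rule: walk.induct)
    case (walk_Nil x)
    then show ?case by (intro exI[of _ \<rho>] exI[of _ 0]) auto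
  next
    case (walk_Cons x y xs z)
    then obtain \<rho>' k where *: "\<rho>' 0 = y" "\<forall>n. (\<rho>' n, \<rho>' (Suc n)) \<in> E" "\<forall>n. \<rho>' (k + n) = \<rho> n"
      by blast
    show ?case
      using * walk_Cons.hyps(1)
      by (intro exI[of _ "case_nat x \<rho>'"] exI[of _ "Suc k"]) (auto split: nat.split)
  qed
  then show ?thesis using that by blast
qed

text \<open>The potential of \<open>x\<close> is the supremum of the weights of walks from
  \<open>x\<close>. It is finite because cutting nonpositive cycles out of a long walk shortens it
  without lowering its weight. Only cycles of length at most \<open>card V\<close> are assumed
  nonpositive, since accepting visits will be counted on such short cycles only.\<close>

lemma potential_exists:
  fixes \<omega> :: "'v \<Rightarrow> int"
  assumes fin: "finite V" and EV: "E \<subseteq> V \<times> V"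
    and cyc: "\<And>x xs. walk E x xs x \<Longrightarrow> xs \<noteq> [] \<Longrightarrow> length xs \<le> card V \<Longrightarrow> sum_list (map \<omega> xs) \<le> 0"
  obtains \<pi> :: "'v \<Rightarrow> int" where "\<And>x y. (x, y) \<in> E \<Longrightarrow> \<pi> y + \<omega> x \<le> \<pi> x"
proof -
  define W where "W = Max (insert 0 (\<omega> ` V))"
  have W0: "0 \<le> W" and W: "x \<in> V \<Longrightarrow> \<omega> x \<le> W" for x using fin by (auto simp: W_def)
  have bound: "sum_list (map \<omega> xs) \<le> int (card V) * W" if "walk E x xs y" for x xs y
    using that
  proof (induction "length xs" arbitrary: xs rule: less_induct)
    case less
    have sub: "set xs \<subseteq> V" using walk_sources[OF less.prems] EV by auto
    show ?case
    proof (cases "length xs \<le> card V")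
      case True
      have "sum_list (map \<omega> xs) \<le> int (length xs) * W"
        using sub by (induction xs) (auto simp: algebra_simps intro!: add_mono W)
      also have "\<dots> \<le> int (card V) * W" using True W0 by (simp add: mult_right_mono)
      finally show ?thesis .
    next
      case False
      \<comment> \<open>Among the first \<open>card V + 1\<close> vertices one repeats, so the cycle
        \<open>z # b\<close> that is cut out is short enough for \<open>cyc\<close>.\<close>
      let ?ys = "take (Suc (card V)) xs"
      have len: "length ?ys = Suc (card V)" using False by simp
      have "set ?ys \<subseteq> V" using sub set_take_subset by fast
      then have "card (set ?ys) \<le> card V" using fin by (simp add: card_mono)
      then have "\<not> distinct ?ys" using len distinct_card by fastforce
      then obtain as b z cs where d: "?ys = as @ [z] @ b @ [z] @ cs"
        using not_distinct_decomp by blast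
      define ds where "ds = cs @ drop (Suc (card V)) xs"
      have xs: "xs = as @ (z # b) @ z # ds"
        using d append_take_drop_id[of "Suc (card V)" xs] by (simp add: ds_def)
      have "length as + length b + 2 \<le> Suc (card V)"
        using arg_cong[OF d, of length] len by simp
      then have lb: "length (z # b) \<le> card V" by simp
      have c: "walk E z (z # b) z" and r: "walk E x (as @ z # ds) y" using less.prems xs by auto
      have "sum_list (map \<omega> (z # b)) \<le> 0" using cyc[OF c _ lb] by simp
      moreover have "sum_list (map \<omega> (as @ z # ds)) \<le> int (card V) * W"
        by (rule less.hyps[OF _ r]) (simp add: xs)
      ultimately show ?thesis by (simp add: xs)
    qed
  qed
  define S where "S x = {sum_list (map \<omega> xs) |xs. \<exists>y. walk E x xs y}" for x
  have bdd: "bdd_above (S x)" for x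
    by (rule bdd_aboveI[of _ "int (card V) * W"]) (auto simp: S_def dest: bound)
  have "0 \<in> S x" for x unfolding S_def
    by (rule CollectI, rule exI[of _ "[]"]) (simp, blast intro: walk_Nil)
  then have ne: "S x \<noteq> {}" for x by blast
  show ?thesis
  proof (rule that[of "\<lambda>x. Sup (S x)"])
    fix x y assume e: "(x, y) \<in> E"
    have "Sup (S y) \<le> Sup (S x) - \<omega> x"
    proof (rule cSup_least[OF ne])
      fix t assume "t \<in> S y"
      then obtain xs z where "t = sum_list (map \<omega> xs)" "walk E y xs z" by (auto simp: S_def)
      then have "walk E x (x # xs) z" "\<omega> x + t = sum_list (map \<omega> (x # xs))" using e by auto
      then have "\<omega> x + t \<in> S x" unfolding S_def by blast
      then show "t \<le> Sup (S x) - \<omega> x" using cSup_upper[OF _ bdd] by fastforce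
    qed
    then show "Sup (S y) + \<omega> x \<le> Sup (S x)" by simp
  qed
qed

text \<open>The measure \<open>\<kappa>\<close> descends along the strongly connected components. It is odd on those that
  contain an accepting cycle, and there the potential \<open>\<pi>\<close> has to pay for every accepting visit.\<close>

lemma progress_measure_exists:
  fixes \<omega> :: "'v \<Rightarrow> int" and accepting :: "'v \<Rightarrow> bool"
  assumes fin: "finite V" and EV: "E \<subseteq> V \<times> V"
    and neg: "\<And>x xs. walk E x xs x \<Longrightarrow> \<exists>z\<in>set xs. accepting z \<Longrightarrow> sum_list (map \<omega> xs) < 0"
  obtains \<kappa> :: "'v \<Rightarrow> nat" and \<pi> :: "'v \<Rightarrow> int" and C :: nat where "0 < C"
    "\<And>x y. (x, y) \<in> E \<Longrightarrow> \<kappa> y < \<kappa> x \<or> \<kappa> y = \<kappa> x \<and>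
       (if even (\<kappa> x) then \<not> accepting x else \<pi> y + int C * \<omega> x + of_bool (accepting x) \<le> \<pi> x)"
proof -
  define accs where "accs x \<longleftrightarrow> (\<exists>z. accepting z \<and> (x, z) \<in> E\<^sup>* \<and> (z, x) \<in> E\<^sup>+)" for x
  define E' where "E' = {(x, y) \<in> E. (y, x) \<in> E\<^sup>* \<and> accs x}"
  \<comment> \<open>An accepting cycle has weight at most \<open>-1\<close>. Scaling by
    \<open>card V + 1\<close> makes this outweigh the at most \<open>card V\<close> accepting visits
    on a short cycle.\<close>
  define C where "C = Suc (card V)"
  define \<omega>' where "\<omega>' x = int C * \<omega> x + of_bool (accepting x)" for x
  have E'V: "E' \<subseteq> V \<times> V" using EV by (auto simp: E'_def)
  have sum': "sum_list (map \<omega>' xs) =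
      int C * sum_list (map \<omega> xs) + int (length (filter accepting xs))" for xs
    by (induction xs) (auto simp: \<omega>'_def algebra_simps)
  have "sum_list (map \<omega>' xs) \<le> 0"
    if w': "walk E' x xs x" and xs: "xs \<noteq> []" "length xs \<le> card V" for x xs
  proof -
    have w: "walk E x xs x" using w' by (rule walk_mono) (auto simp: E'_def)
    have "accs x" using w' xs by (cases xs) (auto simp: E'_def)
    then obtain z ys1 ys2 where z: "accepting z" "walk E x ys1 z" "walk E z ys2 x" "ys2 \<noteq> []"
      unfolding accs_def by (meson rtrancl_walk trancl_walk)
    let ?ys = "ys1 @ ys2"
    have "z \<in> set ?ys" using z(3,4) by (cases ys2) auto
    then have yz: "walk E x ?ys x" "\<exists>z\<in>set ?ys. accepting z" using z by auto
    \<comment> \<open>A positive cycle in the component could be pumped until, followed by the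
      accepting closed walk \<open>?ys\<close>, it gave an accepting closed walk of nonnegative
      weight.\<close>
    have le: "sum_list (map \<omega> xs) \<le> 0"
    proof (rule ccontr)
      assume "\<not> ?thesis"
      then have pos: "1 \<le> sum_list (map \<omega> xs)" by simp
      define k where "k = nat (- sum_list (map \<omega> ?ys))"
      let ?zs = "concat (replicate k xs) @ ?ys"
      have "sum_list (map \<omega> (concat (replicate k xs))) = int k * sum_list (map \<omega> xs)"
        by (induction k) (auto simp: algebra_simps)
      moreover have "int k \<le> int k * sum_list (map \<omega> xs)"
        using mult_left_mono[OF pos, of "int k"] by simp
      moreover have "- sum_list (map \<omega> ?ys) \<le> int k" by (simp add: k_def)
      ultimately have "0 \<le> sum_list (map \<omega> ?zs)" by simp
      moreover have "walk E x ?zs x" using walk_replicate[OF w] yz(1) unfolding walk_append by blast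
      ultimately show False using neg[of x ?zs] yz(2) by fastforce
    qed
    show ?thesis
    proof (cases "\<exists>z\<in>set xs. accepting z")
      case True
      then have "sum_list (map \<omega> xs) \<le> -1" using neg[OF w] by simp
      then have "int C * sum_list (map \<omega> xs) \<le> int C * -1" by (intro mult_left_mono) auto
      moreover have "length (filter accepting xs) \<le> card V" using xs(2) length_filter_le le_trans
        by blast
      ultimately show ?thesis unfolding sum' C_def by simp
    next
      case False
      then have "filter accepting xs = []" by (auto simp: filter_empty_conv)
      then show ?thesis unfolding sum' using le by (simp add: mult_nonneg_nonpos)
    qed
  qed
  then obtain \<pi> :: "'v \<Rightarrow> int" where \<pi>: "\<And>x y. (x, y) \<in> E' \<Longrightarrow> \<pi> y + \<omega>' x \<le> \<pi> x"
    using potential_exists[OF fin E'V, of \<omega>'] by metis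
  define R where "R x = E\<^sup>* `` {x}" for x
  \<comment> \<open>The reachable set shrinks strictly when a component is left and is constant
    inside one. Doubling its size frees the parity bit for \<open>accs\<close>.\<close>
  define \<kappa> where "\<kappa> x = 2 * card (R x) + of_bool (accs x)" for x
  have finR: "finite (R x)" for x
  proof (rule finite_subset)
    show "R x \<subseteq> insert x V" unfolding R_def using EV
      by (auto elim: rtranclE)
  qed (use fin in auto)
  have "\<kappa> y < \<kappa> x \<or> \<kappa> y = \<kappa> x \<and>
       (if even (\<kappa> x) then \<not> accepting x else \<pi> y + int C * \<omega> x + of_bool (accepting x) \<le> \<pi> x)"
    if e: "(x, y) \<in> E" for x y
  proof -
    have sub: "R y \<subseteq> R x" using e by (auto simp: R_def intro: converse_rtrancl_into_rtrancl)
    show ?thesis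
    proof (cases "R y = R x")
      case False
      then have "card (R y) < card (R x)" using sub finR by (simp add: psubset_card_mono psubsetI)
      then show ?thesis by (auto simp: \<kappa>_def)
    next
      case True
      then have yx: "(y, x) \<in> E\<^sup>*" by (auto simp: R_def)
      have "(a, z) \<in> E\<^sup>*" if "(b, z) \<in> E\<^sup>*" "(a, b) \<in> E\<^sup>*" for a b z using that by simp
      then have same: "accs x \<longleftrightarrow> accs y"
        unfolding accs_def using e yx
        by (meson r_into_rtrancl trancl_rtrancl_trancl)
      then have \<kappa>: "\<kappa> y = \<kappa> x" by (simp add: \<kappa>_def True)
      show ?thesis
      proof (cases "accs x")
        case T: True
        then have "(x, y) \<in> E'" using e yx by (simp add: E'_def)
        from \<pi>[OF this] show ?thesis using \<kappa> T by (simp add: \<omega>'_def \<kappa>_def)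
      next
        case F: False
        have "(x, x) \<in> E\<^sup>+" using e yx by simp
        then have "\<not> accepting x" using F by (auto simp: accs_def)
        then show ?thesis using \<kappa> F by (simp add: \<kappa>_def)
      qed
    qed
  qed
  then show ?thesis using that[of C \<kappa> \<pi>] by (simp add: C_def)
qed

section \<open>Finite-memory determinacy of energy parity games\<close>

definition good :: "('v \<Rightarrow> int) \<Rightarrow> ('v \<Rightarrow> nat) \<Rightarrow> 'v list \<Rightarrow> bool" where
  "good wt pr xs \<longleftrightarrow> 0 \<le> sum_list (map wt xs) \<and> even (Min (pr ` set xs))"

text \<open>A finite-memory strategy unfolded: the elements of \<open>X\<close> are memory states,
  \<open>vt\<close> gives their positions, and every move of the opponent is answered by a
  successor. Closed walks suffice to express winning: in a finite graph the energy stays bounded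
  below when no closed walk is negative, and the priorities seen infinitely often are those of some
  closed walk. Memory states are numbers so that \<open>win1\<close> can quantify over all
  strategies.\<close>

definition strategy_graph ::
  "'v set \<Rightarrow> ('v \<Rightarrow> int) \<Rightarrow> ('v \<Rightarrow> nat) \<Rightarrow> ('v \<times> 'v) set \<Rightarrow>
   nat set \<Rightarrow> (nat \<times> nat) set \<Rightarrow> (nat \<Rightarrow> 'v) \<Rightarrow> bool" where
  "strategy_graph V2 wt pr E X F vt \<longleftrightarrow> finite X \<and> F \<subseteq> X \<times> X \<and>
     (\<forall>x y. (x, y) \<in> F \<longrightarrow> (vt x, vt y) \<in> E) \<and>
     (\<forall>x\<in>X. \<exists>y. (x, y) \<in> F) \<and>
     (\<forall>x\<in>X. vt x \<in> V2 \<longrightarrow> (\<forall>v. (vt x, v) \<in> E \<longrightarrow> (\<exists>y. (x, y) \<in> F \<and> vt y = v))) \<and>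
     (\<forall>x xs. xs \<noteq> [] \<longrightarrow> walk F x xs x \<longrightarrow> good wt pr (map vt xs))"

definition win1 ::
  "'v set \<Rightarrow> ('v \<Rightarrow> int) \<Rightarrow> ('v \<Rightarrow> nat) \<Rightarrow> ('v \<times> 'v) set \<Rightarrow> 'v \<Rightarrow> bool" where
  "win1 V2 wt pr E s \<longleftrightarrow>
     (\<exists>X F vt x0. strategy_graph V2 wt pr E X F vt \<and> x0 \<in> X \<and> vt x0 = s)"

text \<open>A positional strategy of the opponent, given as the subgraph of permitted moves;
  vertices outside \<open>V2\<close> keep all their edges. Several permitted moves at a vertex do no
  harm, since every closed walk reachable from \<open>s\<close> is bad: it has negative weight or
  odd least priority.\<close>

definition spoiler_graph ::
  "'v set \<Rightarrow> ('v \<Rightarrow> int) \<Rightarrow> ('v \<Rightarrow> nat) \<Rightarrow> 'v set \<Rightarrow> ('v \<times> 'v) set \<Rightarrow> 'v \<Rightarrow> ('v \<times> 'v) set \<Rightarrow> bool"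
  where
  "spoiler_graph V2 wt pr V E s E' \<longleftrightarrow> E' \<subseteq> E \<and>
     (\<forall>(u, v)\<in>E. u \<notin> V2 \<longrightarrow> (u, v) \<in> E') \<and> (\<forall>u\<in>V. \<exists>v. (u, v) \<in> E') \<and>
     (\<forall>x xs. (s, x) \<in> E'\<^sup>* \<longrightarrow> xs \<noteq> [] \<longrightarrow> walk E' x xs x \<longrightarrow> \<not> good wt pr xs)"

definition win2 ::
  "'v set \<Rightarrow> ('v \<Rightarrow> int) \<Rightarrow> ('v \<Rightarrow> nat) \<Rightarrow> 'v set \<Rightarrow> ('v \<times> 'v) set \<Rightarrow> 'v \<Rightarrow> bool" where
  "win2 V2 wt pr V E s \<longleftrightarrow> (\<exists>E'. spoiler_graph V2 wt pr V E s E')"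

lemma finite_cycle:
  assumes fin: "finite X" and tot: "\<And>x. x \<in> X \<Longrightarrow> \<exists>y\<in>X. (x, y) \<in> F" and x: "x \<in> X"
  obtains y xs where "(x, y) \<in> F\<^sup>*" "walk F y xs y" "xs \<noteq> []"
proof -
  obtain f where f: "\<And>x. x \<in> X \<Longrightarrow> f x \<in> X \<and> (x, f x) \<in> F" using tot by metis
  define \<rho> where "\<rho> n = (f ^^ n) x" for n
  have X: "\<rho> n \<in> X" for n by (induction n) (auto simp: \<rho>_def x f)
  have e: "(\<rho> n, \<rho> (Suc n)) \<in> F" for n using f[OF X[of n]] by (simp add: \<rho>_def)
  have "\<not> inj \<rho>" using X fin by (meson finite_subset image_subsetI infinite_UNIV_nat finite_imageD)
  then obtain i j where ij: "i < j" "\<rho> i = \<rho> j" unfolding inj_def by (metis linorder_neqE_nat)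
  have "walk F (\<rho> i) (map \<rho> [i..<i + (j - i)]) (\<rho> (i + (j - i)))" by (rule walk_between) (rule e)
  then have c: "walk F (\<rho> i) (map \<rho> [i..<j]) (\<rho> i)" using ij by simp
  have "walk F (\<rho> 0) (map \<rho> [0..<0 + i]) (\<rho> (0 + i))" by (rule walk_between) (rule e)
  then have "(x, \<rho> i) \<in> F\<^sup>*" using walk_rtrancl by (fastforce simp: \<rho>_def)
  then show ?thesis using that[OF _ c] ij by auto
qed

lemma walk_image:
  assumes "walk F x xs y" "\<And>x y. (x, y) \<in> F \<Longrightarrow> (f x, f y) \<in> E"
  shows "walk E (f x) (map f xs) (f y)"
  using assms(1)
proof (induction rule: walk.induct)
  case (walk_Cons x y xs z)
  then show ?case using assms(2)[OF walk_Cons.hyps(1)] by auto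
qed simp

text \<open>Each step of the combined graph advances one component and leaves the other alone, so a
  walk is an interleaving of two walks. Total weight and set of labels do not depend on the
  interleaving, and \<open>good\<close> looks at nothing else.\<close>

lemma walk_async_split:
  assumes "walk F p xs q"
    and F: "\<And>p q. (p, q) \<in> F \<Longrightarrow>
      (f1 p, f1 q) \<in> F1 \<and> f2 p = f2 q \<and> vt p = vt1 (f1 p) \<or>
      (f2 p, f2 q) \<in> F2 \<and> f1 p = f1 q \<and> vt p = vt2 (f2 p)"
  shows "\<exists>xs1 xs2. walk F1 (f1 p) xs1 (f1 q) \<and> walk F2 (f2 p) xs2 (f2 q) \<and>
    length xs = length xs1 + length xs2 \<and>
    sum_list (map wt (map vt xs)) =
      sum_list (map wt (map vt1 xs1)) + (sum_list (map wt (map vt2 xs2)) :: int) \<and>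
    vt ` set xs = vt1 ` set xs1 \<union> vt2 ` set xs2"
  using assms(1)
proof (induction rule: walk.induct)
  case (walk_Nil x)
  show ?case by (rule exI[of _ "[]"], rule exI[of _ "[]"]) simp
next
  case (walk_Cons x y xs z)
  then obtain xs1 xs2 where IH: "walk F1 (f1 y) xs1 (f1 z)" "walk F2 (f2 y) xs2 (f2 z)"
    "length xs = length xs1 + length xs2"
    "sum_list (map wt (map vt xs)) =
      sum_list (map wt (map vt1 xs1)) + sum_list (map wt (map vt2 xs2))"
    "vt ` set xs = vt1 ` set xs1 \<union> vt2 ` set xs2" by blast
  from F[OF walk_Cons.hyps(1)] show ?case
  proof
    assume "(f1 x, f1 y) \<in> F1 \<and> f2 x = f2 y \<and> vt x = vt1 (f1 x)"
    then show ?thesis using IH by (intro exI[of _ "f1 x # xs1"] exI[of _ xs2]) auto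
  next
    assume "(f2 x, f2 y) \<in> F2 \<and> f1 x = f1 y \<and> vt x = vt2 (f2 x)"
    then show ?thesis using IH by (intro exI[of _ xs1] exI[of _ "f2 x # xs2"]) auto
  qed
qed

lemma even_Min_Un:
  fixes A B :: "nat set"
  assumes "finite A" "finite B" "A \<noteq> {} \<or> B \<noteq> {}"
    "A \<noteq> {} \<Longrightarrow> even (Min A)" "B \<noteq> {} \<Longrightarrow> even (Min B)"
  shows "even (Min (A \<union> B))"
proof (cases "A = {} \<or> B = {}")
  case True then show ?thesis using assms by (metis sup_bot_left sup_bot_right)
next
  case False then show ?thesis using assms by (simp add: Min_Un min_def)
qed

text \<open>The two strategies are played alternately, each remembering where it was interrupted: whenever
  the opponent moves at \<open>v\<close>, the chosen edge tells which of them continues. A closed walk of the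
  combination is a shuffle of closed walks of the two, hence good.\<close>

lemma win1_shuffle:
  assumes v: "v \<in> V2" and a: "(v, a) \<in> E"
    and w1: "win1 V2 wt pr (E - {(v, a)}) s"
    and w2: "win1 V2 wt pr {(u, z) \<in> E. u = v \<longrightarrow> z = a} v"
  shows "win1 V2 wt pr E s"
proof -
  obtain X1 F1 vt1 x1 where S1: "strategy_graph V2 wt pr (E - {(v, a)}) X1 F1 vt1"
    and x1: "x1 \<in> X1" "vt1 x1 = s" using w1 unfolding win1_def by blast
  obtain X2 F2 vt2 x2 where
    S2: "strategy_graph V2 wt pr {(u, z) \<in> E. u = v \<longrightarrow> z = a} X2 F2 vt2"
    and x2: "x2 \<in> X2" "vt2 x2 = v" using w2 unfolding win1_def by blast
  have X1: "finite X1" "F1 \<subseteq> X1 \<times> X1"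
    and E1: "\<And>x y. (x, y) \<in> F1 \<Longrightarrow> (vt1 x, vt1 y) \<in> E"
    and T1: "\<And>x. x \<in> X1 \<Longrightarrow> \<exists>y. (x, y) \<in> F1"
    and C1: "\<And>x u. x \<in> X1 \<Longrightarrow> vt1 x \<in> V2 \<Longrightarrow> (vt1 x, u) \<in> E \<Longrightarrow> (vt1 x, u) \<noteq> (v, a) \<Longrightarrow>
      \<exists>y. (x, y) \<in> F1 \<and> vt1 y = u"
    and G1: "\<And>x xs. xs \<noteq> [] \<Longrightarrow> walk F1 x xs x \<Longrightarrow> good wt pr (map vt1 xs)"
    using S1 unfolding strategy_graph_def by simp_all
  have X2: "finite X2" "F2 \<subseteq> X2 \<times> X2"
    and E2: "\<And>x y. (x, y) \<in> F2 \<Longrightarrow> (vt2 x, vt2 y) \<in> E"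
    and T2: "\<And>x. x \<in> X2 \<Longrightarrow> \<exists>y. (x, y) \<in> F2"
    and C2: "\<And>x u. x \<in> X2 \<Longrightarrow> vt2 x \<in> V2 \<Longrightarrow> (vt2 x, u) \<in> E \<Longrightarrow> (vt2 x = v \<Longrightarrow> u = a) \<Longrightarrow>
      \<exists>y. (x, y) \<in> F2 \<and> vt2 y = u"
    and G2: "\<And>x xs. xs \<noteq> [] \<Longrightarrow> walk F2 x xs x \<Longrightarrow> good wt pr (map vt2 xs)"
    using S2 unfolding strategy_graph_def by simp_all
  define f1 where "f1 p = fst (prod_decode p)" for p
  define f2 where "f2 p = snd (prod_decode p)" for p
  have ff [simp]: "f1 (prod_encode (x, y)) = x" "f2 (prod_encode (x, y)) = y" for x y
    by (simp_all add: f1_def f2_def)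
  define X where "X = {p \<in> prod_encode ` (X1 \<times> X2). vt1 (f1 p) = v \<or> vt2 (f2 p) = v}"
  \<comment> \<open>One component always waits at \<open>v\<close>, and the game is at the position
    of the other. When both are at \<open>v\<close> the two readings agree.\<close>
  define vt where "vt p = (if vt2 (f2 p) = v then vt1 (f1 p) else vt2 (f2 p))" for p
  define F where "F = {(p, q). p \<in> X \<and> q \<in> X \<and>
      ((f1 p, f1 q) \<in> F1 \<and> f2 p = f2 q \<and> vt2 (f2 p) = v \<or>
       (f2 p, f2 q) \<in> F2 \<and> f1 p = f1 q \<and> vt1 (f1 p) = v)}"
  have XI: "prod_encode (x, y) \<in> X" if "x \<in> X1" "y \<in> X2" "vt1 x = v \<or> vt2 y = v" for x y
    using that by (auto simp: X_def)
  have XD: "f1 p \<in> X1" "f2 p \<in> X2" "vt1 (f1 p) = v \<or> vt2 (f2 p) = v" if "p \<in> X" for p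
    using that by (auto simp: X_def)
  have s1: "\<exists>q. (p, q) \<in> F \<and> vt q = vt1 y" if "p \<in> X" "vt2 (f2 p) = v" "(f1 p, y) \<in> F1" for p y
  proof -
    have "prod_encode (y, f2 p) \<in> X" using XD that X1(2) by (intro XI) auto
    then show ?thesis using that
      by (intro exI[of _ "prod_encode (y, f2 p)"]) (auto simp: F_def vt_def)
  qed
  have s2: "\<exists>q. (p, q) \<in> F \<and> vt q = vt2 y" if "p \<in> X" "vt1 (f1 p) = v" "(f2 p, y) \<in> F2" for p y
  proof -
    have "prod_encode (f1 p, y) \<in> X" using XD that X2(2) by (intro XI) auto
    then show ?thesis using that
      by (intro exI[of _ "prod_encode (f1 p, y)"]) (auto simp: F_def vt_def)
  qed
  have spl: "(f1 p, f1 q) \<in> F1 \<and> f2 p = f2 q \<and> vt p = vt1 (f1 p) \<or>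
      (f2 p, f2 q) \<in> F2 \<and> f1 p = f1 q \<and> vt p = vt2 (f2 p)" if "(p, q) \<in> F" for p q
    using that by (auto simp: F_def vt_def)
  have "strategy_graph V2 wt pr E X F vt" unfolding strategy_graph_def
  proof (intro conjI allI ballI impI)
    show "finite X" using X1 X2 by (auto simp: X_def)
    show "F \<subseteq> X \<times> X" by (auto simp: F_def)
    show "(vt p, vt q) \<in> E" if "(p, q) \<in> F" for p q
    proof -
      have "(f1 p, f1 q) \<in> F1 \<and> vt p = vt1 (f1 p) \<and> vt q = vt1 (f1 q) \<or>
         (f2 p, f2 q) \<in> F2 \<and> vt p = vt2 (f2 p) \<and> vt q = vt2 (f2 q)"
        using that by (auto simp: F_def vt_def)
      then show ?thesis using E1 E2 by auto
    qed
    show "\<exists>q. (p, q) \<in> F" if p: "p \<in> X" for p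
    proof (cases "vt2 (f2 p) = v")
      case True
      obtain y where "(f1 p, y) \<in> F1" using T1 XD(1)[OF p] by blast
      then show ?thesis using s1[OF p True] by blast
    next
      case False
      then have "vt1 (f1 p) = v" using XD(3)[OF p] by simp
      moreover obtain y where "(f2 p, y) \<in> F2" using T2 XD(2)[OF p] by blast
      ultimately show ?thesis using s2[OF p] by blast
    qed
    show "\<exists>q. (p, q) \<in> F \<and> vt q = u" if p: "p \<in> X" "vt p \<in> V2" "(vt p, u) \<in> E" for p u
    proof (cases "vt2 (f2 p) = v")
      case True
      then have vp: "vt p = vt1 (f1 p)" by (simp add: vt_def)
      show ?thesis
      \<comment> \<open>When both components stand at \<open>v\<close>, the edge to \<open>a\<close>
        exists only in the second game and every other edge only in the first. At any other position
        the first game simply continues.\<close>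
      proof (cases "(vt p, u) = (v, a)")
        case T: True
        have "\<exists>y. (f2 p, y) \<in> F2 \<and> vt2 y = u" using T True v a XD[OF p(1)] by (intro C2) auto
        then show ?thesis using s2[OF p(1)] T vp by auto
      next
        case False
        have "\<exists>y. (f1 p, y) \<in> F1 \<and> vt1 y = u" using False p vp XD[OF p(1)] by (intro C1) auto
        then show ?thesis using s1[OF p(1) True] by auto
      qed
    next
      case False
      then have "vt1 (f1 p) = v" "vt p = vt2 (f2 p)" using XD[OF p(1)] by (auto simp: vt_def)
      moreover have "\<exists>y. (f2 p, y) \<in> F2 \<and> vt2 y = u"
        using False p calculation XD[OF p(1)] by (intro C2) auto
      ultimately show ?thesis using s2[OF p(1)] by auto
    qed
    show "good wt pr (map vt xs)" if xs: "xs \<noteq> []" "walk F p xs p" for p xs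
    proof -
      obtain xs1 xs2 where *: "walk F1 (f1 p) xs1 (f1 p)" "walk F2 (f2 p) xs2 (f2 p)"
        "length xs = length xs1 + length xs2"
        "sum_list (map wt (map vt xs)) =
          sum_list (map wt (map vt1 xs1)) + sum_list (map wt (map vt2 xs2))"
        "vt ` set xs = vt1 ` set xs1 \<union> vt2 ` set xs2"
        using walk_async_split[where vt = vt and wt = wt and ?f1.0 = f1 and ?f2.0 = f2 and
            ?F1.0 = F1 and ?F2.0 = F2 and ?vt1.0 = vt1 and ?vt2.0 = vt2, OF xs(2) spl] by blast
      have g1: "xs1 \<noteq> [] \<Longrightarrow> good wt pr (map vt1 xs1)" and g2: "xs2 \<noteq> [] \<Longrightarrow> good wt pr (map vt2 xs2)"
        using G1 G2 * by blast+
      have "0 \<le> sum_list (map wt (map vt xs))"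
        unfolding *(4) using g1 g2 by (cases "xs1 = []"; cases "xs2 = []") (auto simp: good_def)
      moreover have "even (Min (pr ` vt1 ` set xs1 \<union> pr ` vt2 ` set xs2))"
        using g1 g2 *(3) xs(1) by (intro even_Min_Un) (auto simp: good_def)
      ultimately show ?thesis unfolding good_def by (simp add: *(5) image_Un)
    qed
  qed
  moreover have "prod_encode (x1, x2) \<in> X" using x1 x2 by (intro XI) auto
  moreover have "vt (prod_encode (x1, x2)) = s" using x1 x2 by (simp add: vt_def)
  ultimately show ?thesis unfolding win1_def by blast
qed

text \<open>Playing both strategies against each other leaves the strategy graph total, since the
  spoiler always has a permitted move and the graph contains an answer to it. Being finite it then
  has a cycle, which would be good by one strategy and bad by the other.\<close>

lemma win1_no_reach_win2:
  assumes S: "strategy_graph V2 wt pr E X F vt" and EV: "E \<subseteq> V \<times> V"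
    and w2: "win2 V2 wt pr V E v" and x: "x \<in> X" "vt x = v"
  shows False
proof -
  have fin: "finite X" and F: "F \<subseteq> X \<times> X"
    and FE: "\<And>x y. (x, y) \<in> F \<Longrightarrow> (vt x, vt y) \<in> E"
    and tot: "\<And>x. x \<in> X \<Longrightarrow> \<exists>y. (x, y) \<in> F"
    and cov: "\<And>x u. x \<in> X \<Longrightarrow> vt x \<in> V2 \<Longrightarrow> (vt x, u) \<in> E \<Longrightarrow> \<exists>y. (x, y) \<in> F \<and> vt y = u"
    and G: "\<And>x xs. xs \<noteq> [] \<Longrightarrow> walk F x xs x \<Longrightarrow> good wt pr (map vt xs)"
    using S unfolding strategy_graph_def by simp_all
  obtain E' where "spoiler_graph V2 wt pr V E v E'" using w2 unfolding win2_def by blast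
  then have E': "E' \<subseteq> E" "\<forall>(u, v)\<in>E. u \<notin> V2 \<longrightarrow> (u, v) \<in> E'" "\<forall>u\<in>V. \<exists>v. (u, v) \<in> E'"
    and bad: "\<And>x xs. (v, x) \<in> E'\<^sup>* \<Longrightarrow> xs \<noteq> [] \<Longrightarrow> walk E' x xs x \<Longrightarrow> \<not> good wt pr xs"
    unfolding spoiler_graph_def by simp_all
  define F' where "F' = {(x, y) \<in> F. (vt x, vt y) \<in> E'}"
  have tot': "\<exists>y\<in>X. (x, y) \<in> F'" if x: "x \<in> X" for x
  proof -
    obtain y where y: "(x, y) \<in> F" using tot x by blast
    then have xy: "(vt x, vt y) \<in> E" by (rule FE)
    show ?thesis
    proof (cases "vt x \<in> V2")
      case False
      then show ?thesis using y xy E'(2) F by (auto simp: F'_def)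
    next
      case True
      obtain u where u: "(vt x, u) \<in> E'" using E'(3) xy EV by blast
      then obtain z where "(x, z) \<in> F" "vt z = u" using cov[OF x True] E'(1) by blast
      then show ?thesis using u F by (auto simp: F'_def)
    qed
  qed
  obtain y xs where c: "(x, y) \<in> F'\<^sup>*" "walk F' y xs y" "xs \<noteq> []"
    using finite_cycle[OF fin tot' x(1)] by blast
  have "walk F y xs y" using c(2) by (rule walk_mono) (auto simp: F'_def)
  then have g: "good wt pr (map vt xs)" using G c by blast
  obtain ys where "walk F' x ys y" using c(1) rtrancl_walk by metis
  then have "walk E' (vt x) (map vt ys) (vt y)" by (rule walk_image) (auto simp: F'_def)
  then have r: "(v, vt y) \<in> E'\<^sup>*" using walk_rtrancl x by metis
  have "walk E' (vt y) (map vt xs) (vt y)" using c(2) by (rule walk_image) (auto simp: F'_def)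
  then show False using bad[OF r] g c by auto
qed

text \<open>When the opponent has no choices, one good closed walk suffices. It may revisit vertices
  and contain bad subcycles, so the memory states are positions in the list rather than
  vertices.\<close>

lemma win1_lasso:
  assumes det: "\<And>u a b. u \<in> V2 \<Longrightarrow> (u, a) \<in> E \<Longrightarrow> (u, b) \<in> E \<Longrightarrow> a = b"
    and r: "(s, x) \<in> E\<^sup>*" and c: "walk E x cs x" "cs \<noteq> []" and g: "good wt pr cs"
  shows "win1 V2 wt pr E s"
proof -
  have "Min (pr ` set cs) \<in> pr ` set cs" using c by (intro Min_in) auto
  \<comment> \<open>The loop is rotated to begin at a vertex of least priority. It is then enough to
    show that every closed walk passes through index \<open>k\<close>.\<close>
  then obtain z where z: "z \<in> set cs" "pr z = Min (pr ` set cs)" by auto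
  then obtain as bs where cs: "cs = as @ z # bs" by (meson split_list)
  obtain ss where ss: "walk E s ss x" using r rtrancl_walk by metis
  define ds where "ds = z # bs @ as"
  define st where "st = ss @ as"
  have st: "walk E s st z" using ss c by (auto simp: cs st_def)
  have ds: "walk E z ds z" using walk_rotate c(1) unfolding cs ds_def by metis
  have eq: "set ds = set cs" "sum_list (map wt ds) = sum_list (map wt cs)"
    by (auto simp: ds_def cs)
  define L where "L = st @ ds"
  define k where "k = length st"
  define n where "n = length L"
  have kn: "k < n" and Lk: "L ! k = z" by (auto simp: k_def n_def L_def ds_def)
  define nx where "nx i = (if Suc i < n then Suc i else k)" for i
  have nth: "(ys ! i, (ys @ [t]) ! Suc i) \<in> E" if "walk E y ys t" "i < length ys" for y ys t i
    using that
  proof (induction arbitrary: i rule: walk.induct)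
    case (walk_Cons x y xs t)
    have "(xs @ [t]) ! 0 = y" using walk_Cons.hyps(2) by (cases xs) auto
    then show ?case using walk_Cons by (cases i) auto
  qed simp
  have wL: "walk E s L z" using st ds by (auto simp: L_def)
  have eE: "(L ! i, L ! nx i) \<in> E" if "i < n" for i
    using nth[OF wL, of i] that Lk by (auto simp: nx_def n_def nth_append split: if_splits)
  define F where "F = {(i, nx i) |i. i < n}"
  \<comment> \<open>Prefix weights act as a potential: a forward step adds exactly the weight of its
    vertex, and the edge back to \<open>k\<close> in addition drops by the weight of the whole loop,
    which is nonnegative.\<close>
  define h where "h i = sum_list (map wt (map ((!) L) [0..<i]))" for i
  have hn: "h n = h k + sum_list (map wt ds)"
  proof -
    have "map ((!) L) [0..<n] = L" unfolding n_def by (rule map_nth)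
    moreover have "map ((!) L) [0..<k] = st"
      unfolding k_def L_def by (rule nth_equalityI) (auto simp: nth_append)
    ultimately show ?thesis unfolding h_def by (simp add: L_def)
  qed
  have hle: "h (nx i) \<le> h i + wt (L ! i)" if "i < n" for i
  proof (cases "Suc i < n")
    case True then show ?thesis by (simp add: nx_def h_def)
  next
    case False
    then have "Suc i = n" using that by simp
    then have "h n = h i + wt (L ! i)" by (auto simp: h_def)
    moreover have "0 \<le> sum_list (map wt ds)" using g eq by (simp add: good_def)
    ultimately show ?thesis using hn False by (simp add: nx_def)
  qed
  have tele: "h j \<le> h i + sum_list (map wt (map ((!) L) xs))" if "walk F i xs j" for i xs j
    using that
  proof (induction rule: walk.induct)
    case (walk_Cons x y xs z)
    then show ?case using hle[of x] by (auto simp: F_def)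
  qed simp
  have mono: "i \<le> j" if "walk F i xs j" "k \<notin> set xs" "j \<noteq> k" for i xs j
    using that
  proof (induction rule: walk.induct)
    case (walk_Cons x y xs z)
    have "y \<noteq> k" using walk_Cons by (cases xs) auto
    then show ?case using walk_Cons by (auto simp: F_def nx_def split: if_splits)
  qed simp
  have incr: "i < j" if "walk F i xs j" "k \<notin> set xs" "j \<noteq> k" "xs \<noteq> []" for i xs j
  proof (cases xs)
    case (Cons a ys)
    note inc = that
    from inc(1) Cons obtain y where y: "(i, y) \<in> F" "walk F y ys j" by auto
    then have "y \<noteq> k" using inc Cons by (cases ys) auto
    then have "i < y" using y by (auto simp: F_def nx_def split: if_splits)
    then show ?thesis using mono[OF y(2)] inc Cons by auto
  qed (use that in simp)
  have ge: "set xs \<subseteq> {k..<n}" if "walk F i xs j" "k \<le> i" for i xs j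
    using that
  proof (induction rule: walk.induct)
    case (walk_Cons x y xs z)
    then have "k \<le> y" "x < n" using kn by (auto simp: F_def nx_def split: if_splits)
    then show ?case using walk_Cons by auto
  qed simp
  have "strategy_graph V2 wt pr E {..<n} F ((!) L)" unfolding strategy_graph_def
  proof (intro conjI allI ballI impI)
    show "finite {..<n}" by simp
    show "F \<subseteq> {..<n} \<times> {..<n}" using kn by (auto simp: F_def nx_def)
    show "(L ! i, L ! j) \<in> E" if "(i, j) \<in> F" for i j using that eE by (auto simp: F_def)
    show "\<exists>j. (i, j) \<in> F" if "i \<in> {..<n}" for i using that by (auto simp: F_def)
    show "\<exists>j. (i, j) \<in> F \<and> L ! j = v" if "i \<in> {..<n}" "L ! i \<in> V2" "(L ! i, v) \<in> E" for i v
      using that det eE by (intro exI[of _ "nx i"]) (auto simp: F_def)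
    show "good wt pr (map ((!) L) xs)" if xs: "xs \<noteq> []" "walk F i xs i" for i xs
    proof -
      have s: "0 \<le> sum_list (map wt (map ((!) L) xs))" using tele[OF xs(2)] by simp
      have kin: "k \<in> set xs"
      proof (rule ccontr)
        assume k: "k \<notin> set xs"
        then have "i \<noteq> k" using xs by (cases xs) auto
        then show False using incr[OF xs(2) k _ xs(1)] by simp
      qed
      then obtain as bs where "xs = as @ k # bs" by (meson split_list)
      then have seteq: "set xs = set (k # bs @ as)" and "walk F i (as @ k # bs) i" using xs by auto
      then have "walk F k (k # bs @ as) k" using walk_rotate by metis
      then have sub: "set xs \<subseteq> {k..<n}" unfolding seteq by (rule ge) simp
      have "L ! j \<in> set cs" if "j \<in> set xs" for j
      proof -
        have "k \<le> j" "j < n" using sub that by auto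
        then have "L ! j = ds ! (j - k)" "j - k < length ds"
          by (auto simp: L_def k_def n_def nth_append)
        then show ?thesis using eq(1) nth_mem by metis
      qed
      then have "pr ` set (map ((!) L) xs) \<subseteq> pr ` set cs" by auto
      moreover have "pr z \<in> pr ` set (map ((!) L) xs)" using kin Lk by force
      moreover have "pr z \<le> p" if "p \<in> pr ` set cs" for p unfolding z(2) using that by simp
      ultimately have m: "Min (pr ` set (map ((!) L) xs)) = pr z"
        by (intro Min_eqI) blast+
      have "even (pr z)" using g z(2) by (simp add: good_def)
      then show ?thesis unfolding good_def m using s by blast
    qed
  qed
  moreover have "0 \<in> {..<n}" using kn by simp
  moreover have "L ! 0 = s" using wL kn by (cases L) (auto simp: n_def)
  ultimately show ?thesis unfolding win1_def by blast
qed

text \<open>If the opponent never has a choice, either a good closed walk is reachable or the whole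
  graph is a spoiler. Otherwise the edges at a branching vertex \<open>v\<close> are split into the
  one to \<open>a\<close> and the rest. A win of the opponent from \<open>s\<close> in either
  subgame carries over. If the output player wins both from \<open>s\<close>, and the game
  \<open>E2\<close> also from \<open>v\<close>, shuffling applies. If \<open>E2\<close> is lost from
  \<open>v\<close>, the winning strategy from \<open>s\<close> in \<open>E2\<close> never visits
  \<open>v\<close>, so the edges deleted at \<open>v\<close> make no difference to it.\<close>

theorem win1_or_win2:
  assumes "finite V" "E \<subseteq> V \<times> V" "\<And>u. u \<in> V \<Longrightarrow> \<exists>v. (u, v) \<in> E" "s \<in> V"
  shows "win1 V2 wt pr E s \<or> win2 V2 wt pr V E s"
  using assms
proof (induction "card E" arbitrary: E s rule: less_induct)
  case less
  have finE: "finite E" using less.prems finite_subset by fastforce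
  show ?case
  proof (cases "\<exists>v\<in>V2. \<exists>a b. (v, a) \<in> E \<and> (v, b) \<in> E \<and> a \<noteq> b")
    case False
    then have det: "\<And>u a b. u \<in> V2 \<Longrightarrow> (u, a) \<in> E \<Longrightarrow> (u, b) \<in> E \<Longrightarrow> a = b" by blast
    show ?thesis
    proof (cases "\<exists>x xs. (s, x) \<in> E\<^sup>* \<and> xs \<noteq> [] \<and> walk E x xs x \<and> good wt pr xs")
      case True
      then obtain x xs where "(s, x) \<in> E\<^sup>*" "xs \<noteq> []" "walk E x xs x" "good wt pr xs" by blast
      then have "win1 V2 wt pr E s" by (intro win1_lasso[of V2 E s x xs]) (use det in auto)
      then show ?thesis ..
    next
      case False
      then have "spoiler_graph V2 wt pr V E s E" unfolding spoiler_graph_def using less.prems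
        by auto
      then show ?thesis unfolding win2_def by blast
    qed
  next
    case True
    then obtain v a b where v: "v \<in> V2" "(v, a) \<in> E" "(v, b) \<in> E" "a \<noteq> b" by blast
    define E1 where "E1 = E - {(v, a)}"
    define E2 where "E2 = {(u, z) \<in> E. u = v \<longrightarrow> z = a}"
    have c1: "card E1 < card E" using finE v by (intro psubset_card_mono) (auto simp: E1_def)
    have c2: "card E2 < card E" using finE v by (intro psubset_card_mono) (auto simp: E2_def)
    have sub: "E1 \<subseteq> E" "E2 \<subseteq> E" by (auto simp: E1_def E2_def)
    have sv: "E1 \<subseteq> V \<times> V" "E2 \<subseteq> V \<times> V" using sub less.prems by blast+
    have t1: "\<exists>z. (u, z) \<in> E1" if "u \<in> V" for u
      using less.prems(3)[OF that] v by (cases "u = v") (auto simp: E1_def)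
    have t2: "\<exists>z. (u, z) \<in> E2" if "u \<in> V" for u
      using less.prems(3)[OF that] v by (cases "u = v") (auto simp: E2_def)
    have D1: "win1 V2 wt pr E1 u \<or> win2 V2 wt pr V E1 u"
      and D2: "win1 V2 wt pr E2 u \<or> win2 V2 wt pr V E2 u" if "u \<in> V" for u
      using less.hyps[OF c1 _ sv(1) t1 that] less.hyps[OF c2 _ sv(2) t2 that] less.prems(1) by auto
    have up: "win2 V2 wt pr V E s"
      if K: "win2 V2 wt pr V K s" "K \<subseteq> E" "\<forall>(u, v)\<in>E. u \<notin> V2 \<longrightarrow> (u, v) \<in> K" for K
    proof -
      obtain E' where E': "spoiler_graph V2 wt pr V K s E'" using K(1) unfolding win2_def by blast
      have "E' \<subseteq> E" using E' K(2) unfolding spoiler_graph_def by blast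
      moreover have "\<forall>(u, v)\<in>E. u \<notin> V2 \<longrightarrow> (u, v) \<in> E'"
        using E' K(3) unfolding spoiler_graph_def by fast
      ultimately have "spoiler_graph V2 wt pr V E s E'"
        using E' unfolding spoiler_graph_def by simp
      then show ?thesis unfolding win2_def by blast
    qed
    have k: "\<forall>(u, z)\<in>E. u \<notin> V2 \<longrightarrow> (u, z) \<in> E1" "\<forall>(u, z)\<in>E. u \<notin> V2 \<longrightarrow> (u, z) \<in> E2"
      using v by (auto simp: E1_def E2_def)
    have vV: "v \<in> V" using v less.prems by blast
    show ?thesis
    proof (cases "win2 V2 wt pr V E1 s \<or> win2 V2 wt pr V E2 s")
      case True then show ?thesis using up sub k by blast
    next
      case False
      then have w: "win1 V2 wt pr E1 s" "win1 V2 wt pr E2 s" using D1 D2 less.prems by blast+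
      show ?thesis
      proof (cases "win1 V2 wt pr E2 v")
        case True
        then show ?thesis using win1_shuffle[OF v(1,2)] w unfolding E1_def E2_def by blast
      next
        case F: False
        then have w2: "win2 V2 wt pr V E2 v" using D2 vV by blast
        obtain X F vt x0 where S: "strategy_graph V2 wt pr E2 X F vt"
          and x0: "x0 \<in> X" "vt x0 = s" using w(2) unfolding win1_def by blast
        have nv: "vt x \<noteq> v" if "x \<in> X" for x
          using win1_no_reach_win2[OF S sv(2) w2 that] by blast
        have eq: "(vt x, u) \<in> E2 \<longleftrightarrow> (vt x, u) \<in> E" if "x \<in> X" for x u
          using nv[OF that] by (auto simp: E2_def)
        have "strategy_graph V2 wt pr E X F vt" using S sub(2) unfolding strategy_graph_def
          by (simp add: eq) blast
        then have "win1 V2 wt pr E s" using x0 unfolding win1_def by blast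
        then show ?thesis ..
      qed
    qed
  qed
qed

section \<open>Tableaux for LTL\<close>

definition tag :: "nat \<Rightarrow> nat" where "tag n = fst (prod_decode n)"
definition arg :: "nat \<Rightarrow> nat" where "arg n = snd (prod_decode n)"
definition lft :: "nat \<Rightarrow> nat" where "lft n = fst (prod_decode (arg n))"
definition rgt :: "nat \<Rightarrow> nat" where "rgt n = snd (prod_decode (arg n))"

lemma le_triangle: "n \<le> triangle n"
  by (induction n) auto

text \<open>Codes of subformulas are smaller than the code, so one number \<open>N\<close> bounds
  all formulas that the tableau for \<open>N\<close> has to consider, and induction on codes
  replaces induction on formulas. Tag \<open>0\<close> is excluded because
  \<open>prod_encode (0, 0) = 0\<close> is its own component.\<close>

lemma arg_less: "tag n \<noteq> 0 \<Longrightarrow> arg n < n"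
proof -
  assume "tag n \<noteq> 0"
  moreover have "n = triangle (tag n + arg n) + tag n"
    using prod_decode_inverse[of n] unfolding tag_def arg_def
    by (cases "prod_decode n") (simp add: prod_encode_def)
  moreover have "tag n + arg n \<le> triangle (tag n + arg n)" by (rule le_triangle)
  ultimately show ?thesis by linarith
qed

lemma lft_less: "tag n \<noteq> 0 \<Longrightarrow> lft n < n" and rgt_less: "tag n \<noteq> 0 \<Longrightarrow> rgt n < n"
proof -
  assume "tag n \<noteq> 0"
  then have "arg n < n" by (rule arg_less)
  moreover have "lft n \<le> arg n" "rgt n \<le> arg n"
    unfolding lft_def rgt_def
    by (metis le_prod_encode_1 prod.collapse prod_decode_inverse,
        metis le_prod_encode_2 prod.collapse prod_decode_inverse)
  ultimately show "lft n < n" "rgt n < n" by simp_all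
qed

function dec_ltl :: "nat \<Rightarrow> nat ltl" where
  "dec_ltl n =
    (if tag n = 1 then LAtom (arg n)
     else if tag n = 2 then LNot (dec_ltl (arg n))
     else if tag n = 3 then LOr (dec_ltl (lft n)) (dec_ltl (rgt n))
     else if tag n = 4 then LNext (dec_ltl (arg n))
     else if tag n = 5 then LUntil (dec_ltl (lft n)) (dec_ltl (rgt n))
     else LTrue)"
  by auto
termination
  by (relation "measure id") (auto intro: arg_less lft_less rgt_less)

declare dec_ltl.simps [simp del]

lemma dec_ltl_encode: "dec_ltl (encode_ltl \<phi>) = \<phi>"
  by (induction \<phi>) (subst dec_ltl.simps, simp add: tag_def arg_def lft_def rgt_def)+

definition truth :: "(nat \<Rightarrow> nat set) \<Rightarrow> nat \<Rightarrow> nat \<Rightarrow> bool" where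
  "truth u i n = holds_at u i (dec_ltl n)"

text \<open>The set \<open>A\<close> guesses which formula codes hold at a position with letter \<open>x\<close>, and \<open>A'\<close> does so
  for the next position. Codes that denote no formula behave like \<open>LTrue\<close>.\<close>

definition local_cond :: "nat \<Rightarrow> nat set \<Rightarrow> nat set \<Rightarrow> nat set \<Rightarrow> bool" where
  "local_cond n A x A' \<longleftrightarrow>
    (if tag n = 1 then arg n \<in> x
     else if tag n = 2 then arg n \<notin> A
     else if tag n = 3 then lft n \<in> A \<or> rgt n \<in> A
     else if tag n = 4 then arg n \<in> A'
     else if tag n = 5 then rgt n \<in> A \<or> lft n \<in> A \<and> n \<in> A'
     else True)"

definition tableau_step :: "nat \<Rightarrow> nat set \<Rightarrow> nat set \<Rightarrow> nat set \<Rightarrow> bool" where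
  "tableau_step N A x A' \<longleftrightarrow> (\<forall>n\<le>N. n \<in> A \<longleftrightarrow> local_cond n A x A')"

text \<open>The generalised Buechi conditions of the tableau, one per code: an eventuality is absent
  or is met now. Codes of any other shape are always fulfilled, so all codes up to \<open>N\<close>
  can be treated alike.\<close>

definition fulfilled :: "nat \<Rightarrow> nat set \<Rightarrow> nat set" where
  "fulfilled N A = {n. n \<le> N \<and> (tag n = 5 \<longrightarrow> n \<notin> A \<or> rgt n \<in> A)}"

lemma until_unfold:
  "(\<exists>j\<ge>i. Q j \<and> (\<forall>k. i \<le> k \<and> k < j \<longrightarrow> P k)) \<longleftrightarrow>
   Q i \<or> P i \<and> (\<exists>j\<ge>Suc i. Q j \<and> (\<forall>k. Suc i \<le> k \<and> k < j \<longrightarrow> P k))" (is "?L \<longleftrightarrow> ?R")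
proof
  assume ?L
  then obtain j where j: "j \<ge> i" "Q j" "\<forall>k. i \<le> k \<and> k < j \<longrightarrow> P k" by blast
  show ?R
  proof (cases "j = i")
    case False
    then have "Suc i \<le> j" "P i" using j by auto
    then show ?thesis using j by auto
  qed (use j in simp)
next
  assume ?R
  then show ?L
  proof
    assume "P i \<and> (\<exists>j\<ge>Suc i. Q j \<and> (\<forall>k. Suc i \<le> k \<and> k < j \<longrightarrow> P k))"
    then obtain j where j: "P i" "j \<ge> Suc i" "Q j" "\<forall>k. Suc i \<le> k \<and> k < j \<longrightarrow> P k" by blast
    have "P k" if "i \<le> k" "k < j" for k using j that by (cases "k = i") auto
    then show ?L using j by (intro exI[of _ j]) auto
  qed auto
qed

lemma truth_local_cond: "n \<le> N \<Longrightarrow>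
    truth u i n \<longleftrightarrow> local_cond n {m. m \<le> N \<and> truth u i m} (u i) {m. m \<le> N \<and> truth u (Suc i) m}"
proof -
  assume n: "n \<le> N"
  have le: "tag n \<noteq> 0 \<Longrightarrow> arg n \<le> N \<and> lft n \<le> N \<and> rgt n \<le> N"
    using n arg_less lft_less rgt_less by (meson less_imp_le order_trans)
  consider "tag n = 1" | "tag n = 2" | "tag n = 3" | "tag n = 4" | "tag n = 5"
    | "tag n \<notin> {1, 2, 3, 4, 5}" by blast
  then show ?thesis
  proof cases
    case 5
    then have d: "dec_ltl n = LUntil (dec_ltl (lft n)) (dec_ltl (rgt n))"
      by (subst dec_ltl.simps) simp
    have "truth u i n \<longleftrightarrow> truth u i (rgt n) \<or> truth u i (lft n) \<and> truth u (Suc i) n"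
      unfolding truth_def d holds_at.simps by (rule until_unfold)
    then show ?thesis using 5 le n by (simp add: local_cond_def)
  qed (simp_all add: truth_def dec_ltl.simps[of n] local_cond_def le n)
qed

lemma truth_tableau_step: "tableau_step N {m. m \<le> N \<and> truth u i m} (u i) {m. m \<le> N \<and>
    truth u (Suc i) m}"
  unfolding tableau_step_def
proof (intro allI impI)
  fix n assume n: "n \<le> N"
  from truth_local_cond[OF this, of u i] this
  show "n \<in> {m. m \<le> N \<and> truth u i m} \<longleftrightarrow>
    local_cond n {m. m \<le> N \<and> truth u i m} (u i) {m. m \<le> N \<and> truth u (Suc i) m}"
    unfolding mem_Collect_eq by argo
qed

lemma truth_fair:
  assumes "n \<le> N"
  shows "\<exists>j\<ge>i. n \<in> fulfilled N {m. m \<le> N \<and> truth u j m}"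
proof (cases "tag n = 5 \<and> truth u i n")
  case True
  then have "dec_ltl n = LUntil (dec_ltl (lft n)) (dec_ltl (rgt n))"
    by (subst dec_ltl.simps) simp
  then obtain j where "j \<ge> i" "truth u j (rgt n)" using True by (auto simp: truth_def)
  moreover have "rgt n \<le> N" using True rgt_less[of n] assms by simp
  ultimately show ?thesis using assms by (intro exI[of _ j]) (auto simp: fulfilled_def)
next
  case False
  then show ?thesis using assms by (intro exI[of _ i]) (auto simp: fulfilled_def)
qed

text \<open>This is the unambiguity of the tableau. By induction on the code the local conditions
  determine membership, except that for until they also admit postponing an eventuality forever;
  fairness rules this out.\<close>

lemma tableau_truth:
  assumes c: "\<And>i. tableau_step N (A i) (u i) (A (Suc i))"
    and fair: "\<And>n i. n \<le> N \<Longrightarrow> \<exists>j\<ge>i. n \<in> fulfilled N (A j)"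
    and "n \<le> N"
  shows "n \<in> A i \<longleftrightarrow> truth u i n"
  using assms(3)
proof (induction n arbitrary: i rule: less_induct)
  case (less n)
  have le: "tag n \<noteq> 0 \<Longrightarrow> arg n \<le> N \<and> lft n \<le> N \<and> rgt n \<le> N"
    using less.prems arg_less lft_less rgt_less by (meson less_imp_le order_trans)
  have A: "n \<in> A i \<longleftrightarrow> local_cond n (A i) (u i) (A (Suc i))" for i
    using c less.prems by (simp add: tableau_step_def)
  have IH: "m \<in> A i \<longleftrightarrow> truth u i m" if "m < n" for m i using less that by simp
  consider "tag n = 1" | "tag n = 2" | "tag n = 3" | "tag n = 4" | "tag n = 5"
    | "tag n \<notin> {1, 2, 3, 4, 5}" by blast
  then show ?case
  proof cases
    case 5
    then have d: "dec_ltl n = LUntil (dec_ltl (lft n)) (dec_ltl (rgt n))"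
      by (subst dec_ltl.simps) simp
    have IH': "lft n \<in> A i \<longleftrightarrow> truth u i (lft n)" "rgt n \<in> A i \<longleftrightarrow> truth u i (rgt n)" for i
      using IH lft_less rgt_less 5 by simp_all
    have A': "n \<in> A i \<longleftrightarrow> rgt n \<in> A i \<or> lft n \<in> A i \<and> n \<in> A (Suc i)" for i
      using A[of i] 5 by (simp add: local_cond_def)
    have T: "truth u i n \<longleftrightarrow> (\<exists>j\<ge>i. rgt n \<in> A j \<and> (\<forall>k. i \<le> k \<and> k < j \<longrightarrow> lft n \<in> A k))"
      unfolding IH' unfolding truth_def d by simp
    show ?thesis
    proof
      assume ni: "n \<in> A i"
      obtain j0 where j0: "j0 \<ge> i" "n \<in> fulfilled N (A j0)" using fair less.prems by blast
      \<comment> \<open>Before the first fulfilment the until formula is handed on and its left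
        argument holds; at the first fulfilment its right argument holds.\<close>
      define d where "d = (LEAST d. n \<in> fulfilled N (A (i + d)))"
      have fd: "n \<in> fulfilled N (A (i + d))" unfolding d_def
        by (rule LeastI[of _ "j0 - i"]) (use j0 in simp)
      have nf: "n \<notin> fulfilled N (A (i + e))" if "e < d" for e
        using that not_less_Least unfolding d_def by blast
      have *: "n \<in> A (i + e)" if "e \<le> d" for e using that
      proof (induction e)
        case (Suc e)
        then have "rgt n \<notin> A (i + e)" using nf[of e] less.prems 5 by (simp add: fulfilled_def)
        then show ?case using Suc A'[of "i + e"] by simp
      qed (use ni in simp)
      have "lft n \<in> A (i + e)" if "e < d" for e
        using that nf[of e] less.prems 5 *[of e] A'[of "i + e"] by (simp add: fulfilled_def)
      then have "lft n \<in> A k" if "i \<le> k" "k < i + d" for k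
        using that by (metis add_diff_inverse_nat add_less_cancel_left not_less)
      moreover have "rgt n \<in> A (i + d)" using fd *[of d] 5 by (simp add: fulfilled_def)
      ultimately show "truth u i n" unfolding T by (intro exI[of _ "i + d"]) simp
    next
      assume "truth u i n"
      then obtain j where j: "j \<ge> i" "rgt n \<in> A j" "\<forall>k. i \<le> k \<and> k < j \<longrightarrow> lft n \<in> A k"
        unfolding T by blast
      from j(1) show "n \<in> A i"
      proof (induction rule: inc_induct)
        case base then show ?case using A' j by blast
      next
        case (step m) then show ?case using A' j by blast
      qed
    qed
  qed (use A[of i] IH arg_less lft_less rgt_less in \<open>simp_all add: truth_def dec_ltl.simps[of n]
      local_cond_def\<close>)
qed

text \<open>The round-robin counter that turns the conditions \<open>0, ..., N\<close> into a single
  Buechi condition: it waits for condition \<open>j\<close>, then moves on, and the wrap-around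
  counts as accepting.\<close>

definition next_index :: "nat \<Rightarrow> nat set \<Rightarrow> nat \<Rightarrow> nat" where
  "next_index N A j = (if j \<in> fulfilled N A then (if j < N then Suc j else 0) else j)"

definition accepting :: "nat \<Rightarrow> nat set \<Rightarrow> nat \<Rightarrow> bool" where
  "accepting N A j \<longleftrightarrow> j = N \<and> N \<in> fulfilled N A"

text \<open>After a wrap-around the counter is at \<open>0\<close> and cannot pass \<open>n\<close>
  while condition \<open>n\<close> fails. If it failed forever there would be no second
  wrap-around.\<close>

lemma accepting_imp_fair:
  assumes j: "\<And>i. j (Suc i) = next_index N (A i) (j i)"
    and inf: "\<And>i. \<exists>k\<ge>i. accepting N (A k) (j k)" and n: "n \<le> N"
  shows "\<exists>k\<ge>i. n \<in> fulfilled N (A k)"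
proof (rule ccontr)
  assume no: "\<not> ?thesis"
  obtain k where k: "k \<ge> i" "accepting N (A k) (j k)" using inf by blast
  have le: "j (Suc k + d) \<le> n" for d
  proof (induction d)
    case 0 then show ?case using k by (simp add: j next_index_def accepting_def)
  next
    case (Suc d)
    have "n \<notin> fulfilled N (A (Suc k + d))" using no k by simp
    moreover have "j (Suc k + Suc d) = next_index N (A (Suc k + d)) (j (Suc k + d))"
      using j[of "Suc k + d"] by simp
    ultimately show ?case using Suc n
      by (cases "j (Suc k + d) = n") (auto simp: next_index_def)
  qed
  obtain l where l: "l \<ge> Suc k" "accepting N (A l) (j l)" using inf by blast
  then have "j l \<le> n" using le[of "l - Suc k"] by simp
  then have "n = N" using l n by (simp add: accepting_def)
  then show False using no l k unfolding accepting_def by (metis Suc_leD order_trans)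
qed

text \<open>Without acceptance the counter never decreases, and fairness makes it grow again and
  again, eventually beyond \<open>N\<close>.\<close>

lemma fair_imp_accepting:
  assumes j: "\<And>i. j (Suc i) = next_index N (A i) (j i)" and j0: "j 0 \<le> N"
    and fair: "\<And>n i. n \<le> N \<Longrightarrow> \<exists>k\<ge>i. n \<in> fulfilled N (A k)"
  shows "\<exists>k\<ge>i. accepting N (A k) (j k)"
proof (rule ccontr)
  assume no: "\<not> ?thesis"
  have jN: "j k \<le> N" for k by (induction k) (auto simp: j0 j next_index_def)
  have le: "j k \<le> j (Suc k)" if "i \<le> k" for k
    using no that jN[of k] by (auto simp: j next_index_def accepting_def)
  have mono: "j k \<le> j l" if "i \<le> k" "k \<le> l" for k l
    using that(2,1) by (induction rule: dec_induct) (auto intro: order_trans le)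
  have ex: "\<exists>l\<ge>i. j k < j l" if k: "i \<le> k" for k
  proof (rule ccontr)
    assume c: "\<not> ?thesis"
    obtain l where l: "l \<ge> k" "j k \<in> fulfilled N (A l)" using fair jN by blast
    have eq: "j l = j k" "j (Suc l) = j k"
      using c mono[of k l] mono[of k "Suc l"] k l by (auto simp: not_less intro: antisym)
    then have "accepting N (A l) (j l)" using l jN[of k] j[of l]
      by (auto simp: next_index_def accepting_def split: if_splits)
    then show False using no l k by auto
  qed
  have "\<exists>l\<ge>i. d \<le> j l" for d
  proof (induction d)
    case (Suc d)
    then obtain l where "l \<ge> i" "d \<le> j l" by blast
    then show ?case using ex[of l] by (meson Suc_leI le_less_trans)
  qed auto
  then obtain l where "Suc N \<le> j l" by blast
  then show False using jN[of l] by simp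
qed

section \<open>Transition profiles of finite words and saturation\<close>

definition step_profile ::
  "nat \<Rightarrow> (nat set \<times> nat set \<times> nat set) set \<Rightarrow> nat set \<Rightarrow> (nat set \<times> nat set \<times> nat set) set" where
  "step_profile N S a =
    {(A, B', F \<union> fulfilled N B) |A B B' F. (A, B, F) \<in> S \<and> tableau_step N B a B' \<and> B' \<subseteq> {..N}}"

text \<open>Buechi's congruence: a triple records the two ends of a run over the word and the
  conditions fulfilled on the way. The last set contributes only when the next letter is read, so
  consecutive blocks cover every position exactly once.\<close>

definition profile :: "nat \<Rightarrow> nat set list \<Rightarrow> (nat set \<times> nat set \<times> nat set) set" where
  "profile N = foldl (step_profile N) {(A, A, {}) |A. A \<subseteq> {..N}}"

lemma profile_snoc: "profile N (x @ [a]) = step_profile N (profile N x) a"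
  by (simp add: profile_def)

lemma profile_range: "profile N x \<subseteq> Pow {..N} \<times> Pow {..N} \<times> Pow {..N}"
proof (induction x rule: rev_induct)
  case (snoc a x)
  have "fulfilled N B \<subseteq> {..N}" for B by (auto simp: fulfilled_def)
  then show ?case using snoc unfolding profile_snoc step_profile_def by blast
qed (auto simp: profile_def)

lemma profile_iff:
  "(A, B, F) \<in> profile N x \<longleftrightarrow> (\<exists>R. R 0 = A \<and> R (length x) = B \<and> (\<forall>i\<le>length x. R i \<subseteq> {..N}) \<and>
     (\<forall>i<length x. tableau_step N (R i) (x ! i) (R (Suc i))) \<and>
         F = (\<Union>i<length x. fulfilled N (R i)))"
proof (induction x arbitrary: B F rule: rev_induct)
  case Nil
  show ?case by (auto simp: profile_def intro!: exI[of _ "\<lambda>_. A"])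
next
  case (snoc a x)
  show ?case
  proof
    assume "(A, B, F) \<in> profile N (x @ [a])"
    then obtain B0 F0 where B0: "(A, B0, F0) \<in> profile N x" "F = F0 \<union> fulfilled N B0"
      "tableau_step N B0 a B" "B \<subseteq> {..N}"
      unfolding profile_snoc step_profile_def by blast
    from B0(1)[unfolded snoc]
    obtain R where R: "R 0 = A" "R (length x) = B0" "\<forall>i\<le>length x. R i \<subseteq> {..N}"
      "\<forall>i<length x. tableau_step N (R i) (x ! i) (R (Suc i))"
        "F0 = (\<Union>i<length x. fulfilled N (R i))"
      by blast
    let ?R = "R(Suc (length x) := B)"
    have "F = (\<Union>i<Suc (length x). fulfilled N (?R i))"
      using B0(2) R(2,5) by (auto simp: lessThan_Suc)
    then show "\<exists>R. R 0 = A \<and> R (length (x @ [a])) = B \<and> (\<forall>i\<le>length (x @ [a]). R i \<subseteq> {..N}) \<and>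
      (\<forall>i<length (x @ [a]). tableau_step N (R i) ((x @ [a]) ! i) (R (Suc i))) \<and>
      F = (\<Union>i<length (x @ [a]). fulfilled N (R i))"
      using R B0 by (intro exI[of _ ?R]) (auto simp: nth_append less_Suc_eq le_Suc_eq)
  next
    assume "\<exists>R. R 0 = A \<and> R (length (x @ [a])) = B \<and> (\<forall>i\<le>length (x @ [a]). R i \<subseteq> {..N}) \<and>
      (\<forall>i<length (x @ [a]). tableau_step N (R i) ((x @ [a]) ! i) (R (Suc i))) \<and>
      F = (\<Union>i<length (x @ [a]). fulfilled N (R i))"
    then obtain R where R: "R 0 = A" "R (Suc (length x)) = B" "\<forall>i\<le>Suc (length x). R i \<subseteq> {..N}"
      "\<forall>i<Suc (length x). tableau_step N (R i) ((x @ [a]) ! i) (R (Suc i))"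
      "F = (\<Union>i<Suc (length x). fulfilled N (R i))" by auto
    have "\<forall>i<length x. tableau_step N (R i) (x ! i) (R (Suc i))"
      using R(4) by (metis less_Suc_eq nth_append)
    then have "(A, R (length x), \<Union>i<length x. fulfilled N (R i)) \<in> profile N x"
      unfolding snoc using R(1,3) by (intro exI[of _ R]) auto
    moreover have "tableau_step N (R (length x)) a B" 
      using R(4)[rule_format, of "length x"] unfolding R(2) by simp
    moreover have "F = (\<Union>i<length x. fulfilled N (R i)) \<union> fulfilled N (R (length x))"
      using R(5) by (auto simp: lessThan_Suc)
    moreover have "B \<subseteq> {..N}" using R(3)[rule_format, of "Suc (length x)"] unfolding R(2) by simp
    ultimately show "(A, B, F) \<in> profile N (x @ [a])"
      unfolding profile_snoc step_profile_def by blast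
  qed
qed

definition segment :: "(nat \<Rightarrow> 'a) \<Rightarrow> nat \<Rightarrow> nat \<Rightarrow> 'a list" where
  "segment u i j = map u [i..<j]"

text \<open>Each block of the true run over \<open>u\<close> is exchanged for a run over the
  corresponding block of \<open>u'\<close> with the same ends and the same fulfilled conditions. The
  glued run is fair, hence is the true run over \<open>u'\<close>, and it starts with the same
  guess.\<close>

lemma profile_saturates:
  assumes t: "t 0 = 0" "\<And>k. t k \<le> t (Suc k)" "\<And>k. t (Suc k) < t (Suc (Suc k))"
    and t': "t' 0 = 0" "\<And>k. t' k \<le> t' (Suc k)" "\<And>k. t' (Suc k) < t' (Suc (Suc k))"
    and eq: "\<And>k. profile N (segment u (t k) (t (Suc k))) =
        profile N (segment u' (t' k) (t' (Suc k)))"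
    and tru: "truth u 0 N"
  shows "truth u' 0 N"
proof -
  define T where "T i = {m. m \<le> N \<and> truth u i m}" for i
  define L where "L k = t (Suc k) - t k" for k
  define L' where "L' k = t' (Suc k) - t' k" for k
  define F where "F k = (\<Union>i<L k. fulfilled N (T (t k + i)))" for k
  have P: "(T (t k), T (t (Suc k)), F k) \<in> profile N (segment u (t k) (t (Suc k)))" for k
    unfolding profile_iff using t(2)[of k] truth_tableau_step
    by (intro exI[of _ "\<lambda>i. T (t k + i)"]) (auto simp: segment_def F_def L_def T_def)
  have "\<exists>R. R 0 = T (t k) \<and> R (L' k) = T (t (Suc k)) \<and>
     (\<forall>i<L' k. tableau_step N (R i) (u' (t' k + i)) (R (Suc i))) \<and>
         F k = (\<Union>i<L' k. fulfilled N (R i))" for k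
  proof -
    from P[of k, unfolded eq profile_iff] obtain R where
      "R 0 = T (t k)" "R (L' k) = T (t (Suc k))"
      "\<forall>i<L' k. tableau_step N (R i) (segment u' (t' k) (t' (Suc k)) ! i) (R (Suc i))"
      "F k = (\<Union>i<L' k. fulfilled N (R i))" by (auto simp: segment_def L'_def)
    then show ?thesis by (intro exI[of _ R]) (auto simp: segment_def L'_def)
  qed
  then obtain R where R: "\<And>k. R k 0 = T (t k)" "\<And>k. R k (L' k) = T (t (Suc k))"
    "\<And>k i. i < L' k \<Longrightarrow> tableau_step N (R k i) (u' (t' k + i)) (R k (Suc i))"
    "\<And>k. F k = (\<Union>i<L' k. fulfilled N (R k i))" by metis
  \<comment> \<open>The index of the block of \<open>u'\<close> that contains position
    \<open>p\<close>.\<close>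
  define \<kappa> where "\<kappa> p = (LEAST k. p < t' (Suc k))" for p
  define A where "A p = R (\<kappa> p) (p - t' (\<kappa> p))" for p
  have ge: "k \<le> t (Suc k) \<and> k \<le> t' (Suc k)" for k
  proof (induction k)
    case (Suc k) then show ?case using t(3)[of k] t'(3)[of k] by linarith
  qed simp
  have mono': "t' k \<le> t' l" if "k \<le> l" for k l using lift_Suc_mono_le[of t'] t'(2) that by simp
  have mono: "t k \<le> t l" if "k \<le> l" for k l using lift_Suc_mono_le[of t] t(2) that by simp
  have \<kappa>eq: "\<kappa> p = k" if "t' k \<le> p" "p < t' (Suc k)" for p k
    unfolding \<kappa>_def
  proof (rule Least_equality)
    fix l assume "p < t' (Suc l)"
    then have "\<not> Suc l \<le> k" using that mono'[of "Suc l" k] by linarith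
    then show "k \<le> l" by simp
  qed (rule that)
  have \<kappa>: "t' (\<kappa> p) \<le> p" "p < t' (Suc (\<kappa> p))" for p
  proof -
    show "p < t' (Suc (\<kappa> p))" unfolding \<kappa>_def
      by (rule LeastI[of _ "Suc p"]) (use ge[of "Suc p"] in simp)
    show "t' (\<kappa> p) \<le> p"
    proof (cases "\<kappa> p")
      case (Suc l)
      then have "\<not> p < t' (Suc l)" unfolding \<kappa>_def using not_less_Least by (metis lessI)
      then show ?thesis using Suc by simp
    qed (simp add: t')
  qed
  have seg: "A (t' k + i) = R k i" if "i < L' k" for k i
    using \<kappa>eq[of k "t' k + i"] that by (simp add: A_def L'_def)
  have c: "tableau_step N (A p) (u' p) (A (Suc p))" for p
  proof -
    define k i where "k = \<kappa> p" and "i = p - t' k"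
    have p: "p = t' k + i" "i < L' k" using \<kappa>[of p] by (auto simp: k_def i_def L'_def)
    have "A (Suc p) = R k (Suc i)"
    proof (cases "Suc i < L' k")
      case True then show ?thesis using seg[OF True] p by simp
    next
      case False
      then have S: "Suc i = L' k" "Suc p = t' (Suc k)" using p t'(2)[of k] by (auto simp: L'_def)
      have "A (t' (Suc k) + 0) = R (Suc k) 0" by (rule seg) (use t'(3)[of k] in \<open>simp add: L'_def\<close>)
      then show ?thesis using S R by simp
    qed
    then show ?thesis using R(3)[OF p(2)] seg[OF p(2)] p by simp
  qed
  have fair: "\<exists>q\<ge>p. n \<in> fulfilled N (A q)" if n: "n \<le> N" for n p
  proof -
    \<comment> \<open>A witness after block \<open>p\<close> of \<open>u\<close> lies in a block
      \<open>k > p\<close>, and block \<open>k\<close> of \<open>u'\<close> does not begin before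
      \<open>p\<close>.\<close>
    obtain i where i: "i \<ge> t (Suc p)" "n \<in> fulfilled N (T i)" using truth_fair[OF n] unfolding T_def
      by blast
    define k where "k = (LEAST k. i < t (Suc k))"
    have k1: "i < t (Suc k)" unfolding k_def
      by (rule LeastI[of _ "Suc i"]) (use ge[of "Suc i"] in simp)
    have k2: "t k \<le> i"
    proof (cases k)
      case (Suc l)
      then have "\<not> i < t (Suc l)" unfolding k_def using not_less_Least by (metis lessI)
      then show ?thesis using Suc by simp
    qed (simp add: t)
    have kp: "Suc p \<le> k"
    proof (rule ccontr)
      assume "\<not> ?thesis"
      then show False using mono[of "Suc k" "Suc p"] k1 i by simp
    qed
    have "n \<in> F k" unfolding F_def using i k1 k2
      by (intro UN_I[of "i - t k"]) (auto simp: L_def)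
    then obtain l where l: "l < L' k" "n \<in> fulfilled N (R k l)" using R(4) by blast
    have "p \<le> t' k" using ge[of p] mono'[OF kp] by simp
    then show ?thesis using l seg[OF l(1)] by (intro exI[of _ "t' k + l"]) auto
  qed
  have "A 0 = T 0"
  \<comment> \<open>Only block \<open>0\<close> may be empty. If it is empty in \<open>u'\<close>,
    equality of the profiles forces the true run over \<open>u\<close> to have the same set at both
    ends of its own block \<open>0\<close>.\<close>
  proof (cases "t' 1 = 0")
    case False
    then show ?thesis using seg[of 0 0] R(1)[of 0] t t' by (simp add: L'_def)
  next
    case True
    then have "\<kappa> 0 = 1" using \<kappa>eq[of 1 0] t'(3)[of 0] by simp
    then have "A 0 = T (t 1)" using R(1)[of 1] by (simp add: A_def)
    moreover have "T (t 1) = T (t 0)" using R(1)[of 0] R(2)[of 0] True by (simp add: L'_def t')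
    ultimately show ?thesis using t by simp
  qed
  moreover have "N \<in> T 0" using tru by (simp add: T_def)
  ultimately show ?thesis using tableau_truth[of N A u' N 0, OF c fair] by simp
qed

section \<open>Determinisation\<close>

definition inf_often :: "(nat \<Rightarrow> bool) \<Rightarrow> bool" where
  "inf_often P \<longleftrightarrow> (\<forall>i. \<exists>n\<ge>i. P n)"

lemma inf_often_mono: "inf_often P \<Longrightarrow> (\<And>n. P n \<Longrightarrow> Q n) \<Longrightarrow> inf_often Q"
  unfolding inf_often_def by meson

lemma inf_often_ge: "inf_often P \<Longrightarrow> inf_often (\<lambda>n. P n \<and> i \<le> n)"
  unfolding inf_often_def by (meson nat_le_linear order_trans)

lemma inf_often_finite:
  assumes "finite S" "inf_often (\<lambda>n. \<exists>s\<in>S. P s n)"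
  obtains s where "s \<in> S" "inf_often (P s)"
proof -
  have "\<exists>s\<in>S. inf_often (P s)"
  proof (rule ccontr)
    assume "\<not> ?thesis"
    then have "\<forall>s\<in>S. \<exists>i. \<forall>n\<ge>i. \<not> P s n" unfolding inf_often_def by blast
    then obtain f where f: "\<And>s n. s \<in> S \<Longrightarrow> f s \<le> n \<Longrightarrow> \<not> P s n" by metis
    obtain n s where n: "n \<ge> Max (insert 0 (f ` S))" "s \<in> S" "P s n"
      using assms(2) unfolding inf_often_def by blast
    then have "f s \<le> n" using assms(1) by simp
    then show False using f n by blast
  qed
  then show ?thesis using that by blast
qed

definition even_liminf :: "(nat \<Rightarrow> nat) \<Rightarrow> bool" where
  "even_liminf c \<longleftrightarrow> (\<exists>p. even p \<and> inf_often (\<lambda>n. c n = p) \<and> (\<forall>q<p. \<not> inf_often (\<lambda>n. c n = q)))"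

lemma even_liminf_iff:
  assumes "inf_often (\<lambda>n. c n = p)" "\<And>n. i \<le> n \<Longrightarrow> p \<le> c n"
  shows "even_liminf c \<longleftrightarrow> even p"
proof -
  have no: "\<not> inf_often (\<lambda>n. c n = q)" if "q < p" for q
    unfolding inf_often_def using assms(2) that by (metis leD)
  show ?thesis
  proof
    assume "even_liminf c"
    then obtain r where r: "even r" "inf_often (\<lambda>n. c n = r)" "\<forall>q<r. \<not> inf_often (\<lambda>n. c n = q)"
      unfolding even_liminf_def by blast
    then have "r = p" using no assms(1) by (meson linorder_neqE_nat)
    then show "even p" using r by simp
  next
    assume "even p" then show "even_liminf c" unfolding even_liminf_def using no assms(1) by blast
  qed
qed

lemma segment_Suc: "p \<le> n \<Longrightarrow> segment u p (Suc n) = segment u p n @ [u n]"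
  by (simp add: segment_def)

lemma segment_eq_Nil: "segment u p n = [] \<longleftrightarrow> n \<le> p"
  by (auto simp: segment_def)

text \<open>Two positions of a word merge once the words read since then are congruent. Merging is
  permanent, so at each time there are finitely many representatives, namely the least positions of
  the merging classes. The oldest representative into which others merge infinitely often gives a
  factorisation \<open>a s s s \<dots>\<close> of the word up to congruence.\<close>

locale right_congruence =
  fixes h :: "'a list \<Rightarrow> 'c" and stp :: "'c \<Rightarrow> 'a \<Rightarrow> 'c"
  assumes h_snoc: "h (x @ [a]) = stp (h x) a"
    and h_Nil: "h x = h [] \<Longrightarrow> x = []"
    and fin: "finite (range h)"
begin

section \<open>Representatives of merged positions\<close>

definition cl :: "(nat \<Rightarrow> 'a) \<Rightarrow> nat \<Rightarrow> nat \<Rightarrow> 'c" where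
  "cl u p n = h (segment u p n)"

definition rep :: "(nat \<Rightarrow> 'a) \<Rightarrow> nat \<Rightarrow> nat \<Rightarrow> bool" where
  "rep u n p \<longleftrightarrow> p \<le> n \<and> (\<forall>q<p. cl u q n \<noteq> cl u p n)"

lemma cl_Suc: "p \<le> n \<Longrightarrow> cl u p (Suc n) = stp (cl u p n) (u n)"
  by (simp add: cl_def segment_Suc h_snoc)

lemma cl_self: "n \<le> p \<Longrightarrow> cl u p n = h []"
  by (simp add: cl_def segment_eq_Nil[THEN iffD2])

lemma cl_eq_Nil: "cl u p n = h [] \<Longrightarrow> n \<le> p"
  using h_Nil segment_eq_Nil unfolding cl_def by blast

lemma cl_in: "cl u p n \<in> range h"
  by (simp add: cl_def)

lemma merged:
  assumes "cl u p m = cl u q m" "p \<le> m" "q \<le> m" "m \<le> n"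
  shows "cl u p n = cl u q n"
  using assms(4,1-3) by (induction rule: dec_induct) (auto simp: cl_Suc)

lemma rep_inj: "rep u n p \<Longrightarrow> rep u n q \<Longrightarrow> cl u p n = cl u q n \<Longrightarrow> p = q"
  unfolding rep_def by (metis linorder_neqE_nat)

lemma finite_rep: "finite {p. rep u n p}"
  by (rule finite_subset[of _ "{..n}"]) (auto simp: rep_def)

lemma card_rep: "card {p. rep u n p} \<le> card (range h)"
  by (rule card_inj_on_le[of "\<lambda>p. cl u p n"])
    (auto simp: inj_on_def cl_in fin intro: rep_inj)

lemma rep_exists:
  assumes "p \<le> n" obtains q where "rep u n q" "q \<le> p" "cl u q n = cl u p n"
proof -
  define q where "q = (LEAST q. cl u q n = cl u p n)"
  have q: "cl u q n = cl u p n" unfolding q_def by (rule LeastI) simp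
  have le: "q \<le> p" unfolding q_def by (rule Least_le) simp
  have "cl u r n \<noteq> cl u q n" if "r < q" for r
    using that not_less_Least unfolding q unfolding q_def by blast
  then have "rep u n q" using le assms by (simp add: rep_def)
  then show ?thesis using that q le by blast
qed

lemma rep_mono: "rep u n p \<Longrightarrow> p \<le> m \<Longrightarrow> m \<le> n \<Longrightarrow> rep u m p"
  unfolding rep_def by (meson merged le_trans less_imp_le)

text \<open>The position just created has the class of the empty word, which \<open>h_Nil\<close>
  keeps apart from the classes of all older positions. So every step adds a representative.\<close>

lemma rep_Suc_new: "rep u (Suc n) (Suc n)"
  unfolding rep_def using cl_eq_Nil cl_self by (metis not_less order_refl)

text \<open>A representative disappears only by merging into an older one, namely the oldest
  position that now has its class.\<close>

lemma dropped:
  assumes "rep u n p" "\<not> rep u (Suc n) p"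
  obtains q where "rep u n q" "rep u (Suc n) q" "q < p" "cl u q (Suc n) = cl u p (Suc n)"
proof -
  have p: "p \<le> n" using assms by (simp add: rep_def)
  obtain q where q: "rep u (Suc n) q" "q \<le> p" "cl u q (Suc n) = cl u p (Suc n)"
    using rep_exists[of p "Suc n" u] p by auto
  moreover have "q \<noteq> p" using q assms by blast
  moreover have "rep u n q" using rep_mono[OF q(1)] q p by simp
  ultimately show ?thesis using that by simp
qed

text \<open>No position is stored. A representative is identified by the class of the word read
  since it, which is injective on representatives by \<open>rep_inj\<close>; this is what makes the
  state finite. The second entry is the class of the prefix before it.\<close>

definition stA :: "(nat \<Rightarrow> 'a) \<Rightarrow> nat \<Rightarrow> ('c \<times> 'c) set" where
  "stA u n = {(cl u p n, cl u 0 p) |p. rep u n p}"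

text \<open>The first two entries name two representatives in order of age. The third, the class of
  the word between them, is a candidate for the repeated factor \<open>s\<close>.\<close>

definition stO :: "(nat \<Rightarrow> 'a) \<Rightarrow> nat \<Rightarrow> ('c \<times> 'c \<times> 'c) set" where
  "stO u n = {(cl u p n, cl u q n, cl u p q) |p q. rep u n p \<and> rep u n q \<and> p < q}"

definition lead :: "('c \<times> 'c \<times> 'c) set \<Rightarrow> 'a \<Rightarrow> 'c \<Rightarrow> bool" where
  "lead O' a c \<longleftrightarrow> \<not> (\<exists>c2 d. (c2, c, d) \<in> O' \<and> stp c2 a = stp c a)"

text \<open>The new representative has class \<open>h []\<close>. The class of its prefix is the
  updated first component, and the class of the word between an older representative and the new one
  is the updated class of the older one.\<close>

definition \<delta> :: "'c \<times> ('c \<times> 'c) set \<times> ('c \<times> 'c \<times> 'c) set \<Rightarrow> 'a \<Rightarrow>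
    'c \<times> ('c \<times> 'c) set \<times> ('c \<times> 'c \<times> 'c) set" where
  "\<delta> s a = (case s of (c, A, O') \<Rightarrow>
     (stp c a,
      insert (h [], stp c a) {(stp c' a, b) |c' b. (c', b) \<in> A \<and> lead O' a c'},
      {(stp c1 a, stp c2 a, d) |c1 c2 d. (c1, c2, d) \<in> O' \<and> lead O' a c1 \<and> lead O' a c2} \<union>
      {(stp c1 a, h [], stp c1 a) |c1 b. (c1, b) \<in> A \<and> lead O' a c1}))"

definition st :: "(nat \<Rightarrow> 'a) \<Rightarrow> nat \<Rightarrow> 'c \<times> ('c \<times> 'c) set \<times> ('c \<times> 'c \<times> 'c) set" where
  "st u n = (cl u 0 n, stA u n, stO u n)"

definition q0 :: "'c \<times> ('c \<times> 'c) set \<times> ('c \<times> 'c \<times> 'c) set" where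
  "q0 = (h [], {(h [], h [])}, {})"

definition Q :: "('c \<times> ('c \<times> 'c) set \<times> ('c \<times> 'c \<times> 'c) set) set" where
  "Q = range h \<times> Pow (range h \<times> range h) \<times> Pow (range h \<times> range h \<times> range h)"

lemma finite_Q: "finite Q"
  using fin by (simp add: Q_def)

lemma q0_in: "q0 \<in> Q"
  by (auto simp: q0_def Q_def)

lemma stp_in: "c \<in> range h \<Longrightarrow> stp c a \<in> range h"
  using h_snoc by (metis rangeE rangeI)

lemma \<delta>_in: "s \<in> Q \<Longrightarrow> \<delta> s a \<in> Q"
  by (cases s) (auto simp: \<delta>_def Q_def intro: stp_in)

lemma st_0: "st u 0 = q0"
  by (auto simp: st_def q0_def stA_def stO_def rep_def cl_self)

text \<open>Survival of a representative can be read off the state alone: it is lost iff some older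
  class moves to the same successor.\<close>

lemma lead_iff:
  assumes "rep u n p"
  shows "lead (stO u n) (u n) (cl u p n) \<longleftrightarrow> rep u (Suc n) p"
proof
  assume l: "lead (stO u n) (u n) (cl u p n)"
  show "rep u (Suc n) p"
  proof (rule ccontr)
    assume "\<not> ?thesis"
    then obtain q where q: "rep u n q" "q < p" "cl u q (Suc n) = cl u p (Suc n)"
      using dropped[OF assms] by blast
    then have "(cl u q n, cl u p n, cl u q p) \<in> stO u n" using assms by (auto simp: stO_def)
    moreover have "stp (cl u q n) (u n) = stp (cl u p n) (u n)"
      using q assms by (simp add: cl_Suc[symmetric] rep_def)
    ultimately show False using l by (auto simp: lead_def)
  qed
next
  assume r: "rep u (Suc n) p"
  show "lead (stO u n) (u n) (cl u p n)" unfolding lead_def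
  proof
    assume "\<exists>c2 d. (c2, cl u p n, d) \<in> stO u n \<and> stp c2 (u n) = stp (cl u p n) (u n)"
    then obtain q p' where q: "rep u n q" "rep u n p'" "q < p'" "cl u p' n = cl u p n"
      "stp (cl u q n) (u n) = stp (cl u p n) (u n)" by (auto simp: stO_def)
    then have "p' = p" using rep_inj assms by blast
    then have "q < p" "cl u q (Suc n) = cl u p (Suc n)" using q by (auto simp: cl_Suc rep_def)
    then show False using r by (auto simp: rep_def)
  qed
qed

lemma rep_Suc_cases: "rep u (Suc n) p \<Longrightarrow> p = Suc n \<or> rep u n p"
  using rep_mono[of u "Suc n" p n] by (auto simp: rep_def[of u "Suc n" p] le_Suc_eq)

lemma rep_cl_Suc: "rep u n p \<Longrightarrow> stp (cl u p n) (u n) = cl u p (Suc n)"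
  by (simp add: rep_def cl_Suc)

lemma stA_Suc: "stA u (Suc n) = insert (h [], stp (cl u 0 n) (u n))
    {(stp c (u n), b) |c b. (c, b) \<in> stA u n \<and> lead (stO u n) (u n) c}" (is "?L = insert ?z ?R")
proof
  show "?L \<subseteq> insert ?z ?R"
  proof
    fix z assume "z \<in> ?L"
    then obtain p where p: "rep u (Suc n) p" "z = (cl u p (Suc n), cl u 0 p)"
      by (auto simp: stA_def)
    show "z \<in> insert ?z ?R"
    proof (cases "p = Suc n")
      case True then show ?thesis using p cl_self[of "Suc n" "Suc n" u] by (simp add: cl_Suc)
    next
      case False
      then have r: "rep u n p" using rep_Suc_cases p by blast
      then have "(cl u p n, cl u 0 p) \<in> stA u n" "lead (stO u n) (u n) (cl u p n)"
        using p lead_iff by (auto simp: stA_def)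
      then show ?thesis unfolding p(2) rep_cl_Suc[OF r, symmetric] by blast
    qed
  qed
  show "insert ?z ?R \<subseteq> ?L"
  proof
    fix z assume "z \<in> insert ?z ?R"
    then consider "z = ?z" | c b where "z = (stp c (u n), b)" "(c, b) \<in> stA u n"
        "lead (stO u n) (u n) c"
      by blast
    then show "z \<in> ?L"
    proof cases
      case 1
      then have "z = (cl u (Suc n) (Suc n), cl u 0 (Suc n))" by (simp add: cl_self cl_Suc)
      then show ?thesis using rep_Suc_new by (auto simp: stA_def)
    next
      case 2
      then obtain p where "c = cl u p n" "b = cl u 0 p" "rep u n p" by (auto simp: stA_def)
      then show ?thesis using 2 lead_iff rep_cl_Suc by (auto simp: stA_def)
    qed
  qed
qed

lemma stO_Suc: "stO u (Suc n) =
    {(stp c1 (u n), stp c2 (u n), d) |c1 c2 d. (c1, c2, d) \<in> stO u n \<and>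
       lead (stO u n) (u n) c1 \<and> lead (stO u n) (u n) c2} \<union>
    {(stp c1 (u n), h [], stp c1 (u n)) |c1 b. (c1, b) \<in> stA u n \<and> lead (stO u n) (u n) c1}"
  (is "?L = ?R1 \<union> ?R2")
proof
  show "?L \<subseteq> ?R1 \<union> ?R2"
  proof
    fix z assume "z \<in> ?L"
    then obtain p q where p: "rep u (Suc n) p" "rep u (Suc n) q" "p < q"
      "z = (cl u p (Suc n), cl u q (Suc n), cl u p q)" by (auto simp: stO_def)
    have "p \<noteq> Suc n" using p by (auto simp: rep_def)
    then have r: "rep u n p" "lead (stO u n) (u n) (cl u p n)" using rep_Suc_cases p lead_iff
      by blast+
    show "z \<in> ?R1 \<union> ?R2"
    proof (cases "q = Suc n")
      case True
      then have "z = (stp (cl u p n) (u n), h [], stp (cl u p n) (u n))"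
        unfolding p(4) rep_cl_Suc[OF r(1)] using cl_self by simp
      moreover have "(cl u p n, cl u 0 p) \<in> stA u n" using r by (auto simp: stA_def)
      ultimately show ?thesis using r by blast
    next
      case False
      then have r': "rep u n q" "lead (stO u n) (u n) (cl u q n)" using rep_Suc_cases p lead_iff
        by blast+
      then have "(cl u p n, cl u q n, cl u p q) \<in> stO u n" using r p by (auto simp: stO_def)
      then show ?thesis
        unfolding p(4) rep_cl_Suc[OF r(1), symmetric] rep_cl_Suc[OF r'(1), symmetric]
        using r r' by blast
    qed
  qed
  show "?R1 \<union> ?R2 \<subseteq> ?L"
  proof
    fix z assume "z \<in> ?R1 \<union> ?R2"
    then consider c1 c2 d where "z = (stp c1 (u n), stp c2 (u n), d)" "(c1, c2, d) \<in> stO u n"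
        "lead (stO u n) (u n) c1" "lead (stO u n) (u n) c2"
      | c1 b where "z = (stp c1 (u n), h [], stp c1 (u n))" "(c1, b) \<in> stA u n"
          "lead (stO u n) (u n) c1"
      by blast
    then show "z \<in> ?L"
    proof cases
      case 1
      then obtain p q where "c1 = cl u p n" "c2 = cl u q n" "d = cl u p q" "rep u n p" "rep u n q"
        "p < q"
        by (auto simp: stO_def)
      then show ?thesis using 1 lead_iff rep_cl_Suc unfolding stO_def[of u "Suc n"] by auto
    next
      case 2
      then obtain p where p: "c1 = cl u p n" "rep u n p" by (auto simp: stA_def)
      then have "z = (cl u p (Suc n), cl u (Suc n) (Suc n), cl u p (Suc n))"
        using 2 rep_cl_Suc by (simp add: cl_self)
      moreover have "rep u (Suc n) p" "p < Suc n" using 2 p lead_iff by (auto simp: rep_def[of u n])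
      ultimately show ?thesis using rep_Suc_new by (auto simp: stO_def)
    qed
  qed
qed

lemma st_Suc: "st u (Suc n) = \<delta> (st u n) (u n)"
  by (simp add: st_def \<delta>_def stA_Suc stO_Suc cl_Suc)

section \<open>Priorities read off from merges\<close>

definition slot :: "('c \<times> 'c \<times> 'c) set \<Rightarrow> 'c \<Rightarrow> nat" where
  "slot O' c = card {c2. \<exists>d. (c2, c, d) \<in> O'}"

definition mrg :: "('c \<times> ('c \<times> 'c) set \<times> ('c \<times> 'c \<times> 'c) set) \<Rightarrow> 'a \<Rightarrow> ('c \<times> 'c) set \<Rightarrow> nat \<Rightarrow> bool"
    where
  "mrg s a X k \<longleftrightarrow> (case s of (_, A, O') \<Rightarrow>
     \<exists>c c2 d b. (c, c2, d) \<in> O' \<and> stp c a = stp c2 a \<and> lead O' a c \<and> slot O' c = k \<and>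
       (c, b) \<in> A \<and> (b, d) \<in> X)"

text \<open>The rank of a representative is the number of older ones, so older representatives get
  smaller, dominant priorities. The least rank with a merge decides, and its parity tells whether
  the merge yields a pair in \<open>X\<close>. A step without merges gets an odd value above all
  others, which cannot decide because merges occur infinitely often.\<close>

definition prio :: "('c \<times> 'c) set \<Rightarrow> 'c \<times> ('c \<times> 'c) set \<times> ('c \<times> 'c \<times> 'c) set \<Rightarrow> 'a \<Rightarrow> nat" where
  "prio X s a =
    (if \<exists>k\<le>card (range h). mrg s a UNIV k
     then let k = (LEAST k. mrg s a UNIV k) in if mrg s a X k then 2 * k else Suc (2 * k)
     else Suc (2 * Suc (card (range h))))"

lemma prio_le: "prio X s a \<le> Suc (2 * Suc (card (range h)))"
proof (cases "\<exists>k\<le>card (range h). mrg s a UNIV k")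
  case True
  then have "(LEAST k. mrg s a UNIV k) \<le> card (range h)" by (meson Least_le order_trans)
  then show ?thesis using True by (simp add: prio_def Let_def)
next
  case False
  then show ?thesis unfolding prio_def by (simp only: if_False order_refl)
qed

definition slt :: "(nat \<Rightarrow> 'a) \<Rightarrow> nat \<Rightarrow> nat \<Rightarrow> nat" where
  "slt u n p = card {q. rep u n q \<and> q < p}"

lemma slt_le: "slt u n p \<le> card (range h)"
  unfolding slt_def by (rule order_trans[OF card_mono card_rep]) (auto intro: finite_rep)

lemma slt_less: "rep u n p \<Longrightarrow> p < q \<Longrightarrow> slt u n p < slt u n q"
  unfolding slt_def using finite_rep
  by (intro psubset_card_mono) (auto intro: finite_subset[OF _ finite_rep])

lemma slt_inj: "rep u n p \<Longrightarrow> rep u n q \<Longrightarrow> slt u n p = slt u n q \<Longrightarrow> p = q"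
  using slt_less by (metis less_irrefl linorder_neqE_nat)

lemma slot_eq:
  assumes "rep u n p" shows "slot (stO u n) (cl u p n) = slt u n p"
proof -
  have "{c2. \<exists>d. (c2, cl u p n, d) \<in> stO u n} = (\<lambda>q. cl u q n) ` {q. rep u n q \<and> q < p}"
    using assms by (auto simp: stO_def dest: rep_inj)
  moreover have "inj_on (\<lambda>q. cl u q n) {q. rep u n q \<and> q < p}"
    by (auto simp: inj_on_def intro: rep_inj)
  ultimately show ?thesis by (simp add: slot_def slt_def card_image)
qed

definition mg :: "(nat \<Rightarrow> 'a) \<Rightarrow> nat \<Rightarrow> nat \<Rightarrow> nat \<Rightarrow> bool" where
  "mg u n p q \<longleftrightarrow> rep u n p \<and> rep u n q \<and> p < q \<and> cl u p (Suc n) = cl u q (Suc n) \<and> rep u (Suc n) p"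

lemma mrg_iff:
  "mrg (st u n) (u n) X k \<longleftrightarrow> (\<exists>p q. mg u n p q \<and> slt u n p = k \<and> (cl u 0 p, cl u p q) \<in> X)"
proof
  assume "mrg (st u n) (u n) X k"
  then obtain c c2 d b where *: "(c, c2, d) \<in> stO u n" "stp c (u n) = stp c2 (u n)"
    "lead (stO u n) (u n) c" "slot (stO u n) c = k" "(c, b) \<in> stA u n" "(b, d) \<in> X"
    by (auto simp: mrg_def st_def)
  from *(1) obtain p q where p: "c = cl u p n" "c2 = cl u q n" "d = cl u p q" "rep u n p"
    "rep u n q" "p < q"
    by (auto simp: stO_def)
  have "b = cl u 0 p" using *(5) p by (auto simp: stA_def dest: rep_inj)
  moreover have "mg u n p q" unfolding mg_def using p *
    by (auto simp: lead_iff cl_Suc rep_def[of u n])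
  ultimately show "\<exists>p q. mg u n p q \<and> slt u n p = k \<and> (cl u 0 p, cl u p q) \<in> X"
    using p(1,3,4) *(4,6) slot_eq[OF p(4)] by auto
next
  assume "\<exists>p q. mg u n p q \<and> slt u n p = k \<and> (cl u 0 p, cl u p q) \<in> X"
  then obtain p q where *: "mg u n p q" "slt u n p = k" "(cl u 0 p, cl u p q) \<in> X" by blast
  have r: "rep u n p" "rep u n q" "p < q" "p \<le> n" "q \<le> n" "rep u (Suc n) p"
    using *(1) by (auto simp: mg_def rep_def)
  have "(cl u p n, cl u q n, cl u p q) \<in> stO u n" "(cl u p n, cl u 0 p) \<in> stA u n"
    using r by (auto simp: stO_def stA_def)
  moreover have "stp (cl u p n) (u n) = stp (cl u q n) (u n)"
    using *(1) r by (simp add: mg_def cl_Suc)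
  moreover have "lead (stO u n) (u n) (cl u p n)" using r lead_iff by blast
  moreover have "slot (stO u n) (cl u p n) = k" using slot_eq r * by blast
  ultimately show "mrg (st u n) (u n) X k" unfolding mrg_def st_def using *(3) by auto
qed

text \<open>Without merges no representative is lost while every step adds one, against the bound by
  the number of classes.\<close>

lemma inf_often_mg: "inf_often (\<lambda>n. \<exists>p q. mg u n p q)"
proof (rule ccontr)
  assume "\<not> ?thesis"
  then obtain i where i: "\<And>n p q. i \<le> n \<Longrightarrow> \<not> mg u n p q" unfolding inf_often_def by blast
  have keep: "rep u (Suc n) p" if "rep u n p" "i \<le> n" for n p
  proof (rule ccontr)
    assume "\<not> ?thesis"
    from dropped[OF that(1) this]
    obtain q where "rep u n q" "rep u (Suc n) q" "q < p" "cl u q (Suc n) = cl u p (Suc n)" .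
    then have "mg u n q p" using that by (simp add: mg_def)
    then show False using i that by blast
  qed
  have "{i<..i + d} \<subseteq> {p. rep u (i + d) p}" for d
  proof (induction d)
    case (Suc d)
    have "p \<in> {p. rep u (i + Suc d) p}" if "p \<in> {i<..i + Suc d}" for p
    proof (cases "p = Suc (i + d)")
      case True then show ?thesis using rep_Suc_new by simp
    next
      case False
      then have "p \<in> {i<..i + d}" using that by auto
      then have "rep u (i + d) p" using Suc by blast
      then show ?thesis using keep[of "i + d" p] by simp
    qed
    then show ?case by blast
  qed simp
  then have "card {i<..i + d} \<le> card (range h)" for d
    by (meson card_mono card_rep finite_rep order_trans)
  from this[of "Suc (card (range h))"] show False by simp
qed

text \<open>By finiteness one class \<open>s\<close> occurs infinitely often between
  \<open>p\<close> and a position absorbed into it. Cutting at suitable absorbed positions gives the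
  factorisation; pigeonhole and merging take the place of Ramsey's theorem.\<close>

lemma cut_sequence:
  assumes inf: "inf_often (\<lambda>n. \<exists>q. mg u n p q \<and> (cl u 0 p, cl u p q) \<in> X)"
  obtains s t where "(cl u 0 p, s) \<in> X" "t 0 = (0::nat)" "t 1 = p"
    "\<And>k. t (Suc k) < t (Suc (Suc k))" "\<And>k. cl u (t (Suc k)) (t (Suc (Suc k))) = s"
proof -
  have S: "inf_often (\<lambda>n. \<exists>s\<in>range h. \<exists>q. mg u n p q \<and> (cl u 0 p, s) \<in> X \<and> cl u p q = s)"
    using inf by (rule inf_often_mono) (use cl_in in blast)
  obtain s where s: "inf_often (\<lambda>n. \<exists>q. mg u n p q \<and> (cl u 0 p, s) \<in> X \<and> cl u p q = s)"
    by (rule inf_often_finite[OF fin S])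
  have sX: "(cl u 0 p, s) \<in> X" using s unfolding inf_often_def by blast
  define Y where "Y = {q. p < q \<and> cl u p q = s \<and> (\<exists>m\<ge>q. cl u q m = cl u p m)}"
  \<comment> \<open>If these positions were bounded, a single \<open>q\<close> would be absorbed
    twice, but an absorbed position is no longer a representative.\<close>
  have unb: "\<exists>q\<in>Y. b < q" for b
  proof (rule ccontr)
    assume no: "\<not> ?thesis"
    have B: "inf_often (\<lambda>n. \<exists>q\<in>{..b}. mg u n p q)"
      using s
    proof (rule inf_often_mono)
      fix n assume "\<exists>q. mg u n p q \<and> (cl u 0 p, s) \<in> X \<and> cl u p q = s"
      then obtain q where q: "mg u n p q" "cl u p q = s" by blast
      then have "q \<le> n" "p < q" "cl u q (Suc n) = cl u p (Suc n)" by (auto simp: mg_def rep_def)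
      then have "q \<in> Y" using q unfolding Y_def by (auto intro!: exI[of _ "Suc n"])
      then show "\<exists>q\<in>{..b}. mg u n p q" using no q by (auto simp: not_less)
    qed
    obtain q where q: "inf_often (\<lambda>n. mg u n p q)" by (rule inf_often_finite[OF finite_atMost B])
    then obtain n where n: "mg u n p q" unfolding inf_often_def by blast
    obtain m where m: "m \<ge> Suc n" "mg u m p q" using q unfolding inf_often_def by blast
    have "rep u (Suc n) q" using m n by (auto simp: mg_def rep_def[of u n] intro: rep_mono[of u m])
    then show False using n by (auto simp: mg_def rep_def)
  qed
  have "\<exists>q'. q' \<in> Y \<and> q < q' \<and> cl u q q' = s" if qY: "q \<in> Y" for q
  proof -
    obtain m where m: "m \<ge> q" "cl u q m = cl u p m" using qY unfolding Y_def by blast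
    obtain q' where q': "q' \<in> Y" "m < q'" using unb by blast
    have "p \<le> m" using qY m by (simp add: Y_def)
    \<comment> \<open>From \<open>m\<close> on the positions \<open>q\<close> and \<open>p\<close>
      are merged, so the class from \<open>q\<close> to \<open>q'\<close> is the one from
      \<open>p\<close> to \<open>q'\<close>, namely \<open>s\<close>.\<close>
    then have "cl u q q' = cl u p q'" using merged[OF m(2) m(1)] q' by simp
    then show ?thesis using q' m by (auto simp: Y_def)
  qed
  then obtain g where g: "\<And>q. q \<in> Y \<Longrightarrow> g q \<in> Y \<and> q < g q \<and> cl u q (g q) = s" by metis
  obtain y0 where y0: "y0 \<in> Y" "p < y0" using unb by blast
  have Y: "(g ^^ k) y0 \<in> Y" for k by (induction k) (use y0 g in auto)
  define t where "t k = (if k = 0 then 0 else if k = 1 then p else (g ^^ (k - 2)) y0)" for k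
  have tS: "t (Suc (Suc k)) = (g ^^ k) y0" for k by (simp add: t_def)
  show ?thesis
  proof (rule that[of s t])
    show "t (Suc k) < t (Suc (Suc k))" for k
      using y0 g[OF Y] by (cases k) (auto simp: tS, simp add: t_def)
    show "cl u (t (Suc k)) (t (Suc (Suc k))) = s" for k
      using y0 g[OF Y] by (cases k) (auto simp: tS, simp add: t_def Y_def)
  qed (auto simp: t_def sX)
qed

text \<open>The hypothesis is saturation: any factorisation \<open>a s s s ...\<close> decides
  \<open>M\<close>. Let \<open>k\<close> be the least rank with infinitely many merges; from some
  time on a fixed position \<open>p\<close> holds it. If infinitely many merges into
  \<open>p\<close> give pairs in \<open>X\<close>, these provide a factorisation with its pair in
  \<open>X\<close>. Otherwise almost all give pairs outside \<open>X\<close>, and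
  \<open>cut_sequence\<close> is applied to the complement.\<close>

theorem parity_prio:
  assumes sat: "\<And>t s. t 0 = 0 \<Longrightarrow> (\<And>k. t (Suc k) < t (Suc (Suc k))) \<Longrightarrow>
      (\<And>k. cl u (t (Suc k)) (t (Suc (Suc k))) = s) \<Longrightarrow> M \<longleftrightarrow> (cl u 0 (t 1), s) \<in> X"
  shows "M \<longleftrightarrow> even_liminf (\<lambda>n. prio X (st u n) (u n))"
proof -
  define K where "K k n \<longleftrightarrow> mrg (st u n) (u n) UNIV k" for k n
  have K: "K k n \<longleftrightarrow> (\<exists>p q. mg u n p q \<and> slt u n p = k)" for k n by (simp add: K_def mrg_iff)
  have "inf_often (\<lambda>n. \<exists>k\<in>{..card (range h)}. K k n)"
    using inf_often_mg[of u] by (rule inf_often_mono) (use slt_le K in fastforce)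
  then obtain k' where "inf_often (K k')" using inf_often_finite[of "{..card (range h)}"] by blast
  define k where "k = (LEAST k. inf_often (K k))"
  have k: "inf_often (K k)" unfolding k_def using \<open>inf_often (K k')\<close> by (rule LeastI)
  have "\<exists>i. \<forall>j<k. \<forall>n\<ge>i. \<not> K j n"
  proof -
    have "\<forall>j<k. \<exists>i. \<forall>n\<ge>i. \<not> K j n"
      using not_less_Least[of _ "\<lambda>k. inf_often (K k)"] unfolding k_def inf_often_def by blast
    then obtain f where f: "\<And>j n. j < k \<Longrightarrow> f j \<le> n \<Longrightarrow> \<not> K j n" by metis
    have "f j \<le> Max (insert 0 (f ` {..<k}))" if "j < k" for j using that by simp
    then show ?thesis using f by (meson order_trans)
  qed
  then obtain i where i: "\<And>j n. j < k \<Longrightarrow> i \<le> n \<Longrightarrow> \<not> K j n" by blast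
  obtain n0 where n0: "n0 \<ge> i" "K k n0" using k unfolding inf_often_def by blast
  then obtain p where p0: "rep u n0 p" "slt u n0 p = k" by (auto simp: K mg_def)
  \<comment> \<open>Losing \<open>p\<close> or anything older would be a merge at a rank below
    \<open>k\<close>, and from \<open>i\<close> on there is none.\<close>
  have p: "rep u n p \<and> slt u n p = k" if "n0 \<le> n" for n
    using that
  proof (induction rule: dec_induct)
    case (step n)
    have kp: "rep u (Suc n) r" if r: "rep u n r" "r \<le> p" for r
    proof (rule ccontr)
      assume "\<not> ?thesis"
      from dropped[OF r(1) this]
      obtain q where q: "rep u n q" "rep u (Suc n) q" "q < r" "cl u q (Suc n) = cl u r (Suc n)" .
      then have "mg u n q r" using r by (simp add: mg_def)
      then have "K (slt u n q) n" using K by blast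
      moreover have "slt u n q < k" using slt_less[OF q(1), of p] q r step by simp
      ultimately show False using i step n0 by (meson order_trans)
    qed
    have "{r. rep u (Suc n) r \<and> r < p} = {r. rep u n r \<and> r < p}"
    proof -
      have "rep u n r" if "rep u (Suc n) r" "r < p" for r
        using rep_Suc_cases[OF that(1)] that(2) step by (auto simp: rep_def[of u n p])
      then show ?thesis using kp by auto
    qed
    then show ?case using step kp[of p] by (simp add: slt_def)
  qed (use p0 in simp)
  have mgp: "q' = p" if "n0 \<le> n" "mg u n q' q" "slt u n q' = k" for n q' q
    using p[OF that(1)] slt_inj that by (auto simp: mg_def)
  have mrgp: "mrg (st u n) (u n) Z k \<longleftrightarrow>
    (\<exists>q. mg u n p q \<and> (cl u 0 p, cl u p q) \<in> Z)" if "n0 \<le> n" for n Z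
    unfolding mrg_iff using mgp[OF that] p[OF that] by blast
  have prk: "prio X (st u n) (u n) = (if mrg (st u n) (u n) X k then 2 * k else Suc (2 * k))"
    if "n0 \<le> n" "K k n" for n
  proof -
    have "(LEAST k. mrg (st u n) (u n) UNIV k) = k"
    proof (rule Least_equality)
      show "mrg (st u n) (u n) UNIV k" using that by (simp add: K_def)
      show "k \<le> j" if "mrg (st u n) (u n) UNIV j" for j
        using i[of j n] that \<open>n0 \<le> n\<close> n0 by (force simp: K_def not_less)
    qed
    moreover have "k \<le> card (range h)" using p0 slt_le by metis
    ultimately show ?thesis using that by (auto simp: prio_def K_def Let_def)
  qed
  have ge: "2 * k \<le> prio X (st u n) (u n)" if "n0 \<le> n" for n
  proof (cases "\<exists>k\<le>card (range h). K k n")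
    case True
    define l where "l = (LEAST k. K k n)"
    have "K l n" unfolding l_def using True by (meson LeastI)
    then have "k \<le> l" using i[of l n] that n0 by (force simp: not_less)
    then show ?thesis using True by (simp add: prio_def K_def l_def Let_def)
  next
    case False
    then have "prio X (st u n) (u n) = Suc (2 * Suc (card (range h)))"
      unfolding prio_def K_def by (simp only: if_False)
    moreover have "k \<le> card (range h)" using p0 slt_le by metis
    ultimately show ?thesis by simp
  qed
  let ?good = "\<lambda>n. \<exists>q. mg u n p q \<and> (cl u 0 p, cl u p q) \<in> X"
  let ?bad = "\<lambda>n. \<exists>q. mg u n p q \<and> (cl u 0 p, cl u p q) \<in> - X"
  show ?thesis
  proof (cases "inf_often ?good")
    case True
    obtain s t where t: "(cl u 0 p, s) \<in> X" "t 0 = (0::nat)" "t 1 = p"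
      "\<And>k. t (Suc k) < t (Suc (Suc k))" "\<And>k. cl u (t (Suc k)) (t (Suc (Suc k))) = s"
      by (rule cut_sequence[OF True]) blast
    then have M using sat[of t s] by simp
    have "inf_often (\<lambda>n. prio X (st u n) (u n) = 2 * k)"
      using inf_often_ge[OF True, of n0]
    proof (rule inf_often_mono)
      fix n assume n: "?good n \<and> n0 \<le> n"
      then have "mrg (st u n) (u n) X k" using mrgp by blast
      moreover have "K k n" using n p[of n] K by blast
      ultimately show "prio X (st u n) (u n) = 2 * k" using prk n by simp
    qed
    then have "even_liminf (\<lambda>n. prio X (st u n) (u n)) \<longleftrightarrow> even (2 * k)"
      using ge by (rule even_liminf_iff)
    then show ?thesis using \<open>M\<close> by simp
  next
    case False
    then obtain i1 where i1: "\<And>n. i1 \<le> n \<Longrightarrow> \<not> ?good n" unfolding inf_often_def by blast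
    have kinf: "inf_often (\<lambda>n. K k n \<and> max i1 n0 \<le> n)" by (rule inf_often_ge[OF k])
    have "inf_often ?bad"
      using kinf
    proof (rule inf_often_mono)
      fix n assume n: "K k n \<and> max i1 n0 \<le> n"
      then have "\<exists>q. mg u n p q" using mrgp[of n UNIV] by (auto simp: K_def)
      then show "?bad n" using i1[of n] n by auto
    qed
    then obtain s t where t: "(cl u 0 p, s) \<in> - X" "t 0 = (0::nat)" "t 1 = p"
      "\<And>k. t (Suc k) < t (Suc (Suc k))" "\<And>k. cl u (t (Suc k)) (t (Suc (Suc k))) = s"
      by (rule cut_sequence) blast
    then have nM: "\<not> M" using sat[of t s] by simp
    have "inf_often (\<lambda>n. prio X (st u n) (u n) = Suc (2 * k))"
      using kinf
    proof (rule inf_often_mono)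
      fix n assume n: "K k n \<and> max i1 n0 \<le> n"
      then have "\<not> mrg (st u n) (u n) X k" using mrgp[of n X] i1[of n] by simp
      then show "prio X (st u n) (u n) = Suc (2 * k)" using prk n by simp
    qed
    moreover have "Suc (2 * k) \<le> prio X (st u n) (u n)" if n: "max i1 n0 \<le> n" for n
    proof -
      have "prio X (st u n) (u n) \<noteq> 2 * k"
      proof
        assume e: "prio X (st u n) (u n) = 2 * k"
        show False
        proof (cases "\<exists>k\<le>card (range h). mrg (st u n) (u n) UNIV k")
          case True
          define l where "l = (LEAST k. mrg (st u n) (u n) UNIV k)"
          have "mrg (st u n) (u n) UNIV l" unfolding l_def using True by (meson LeastI)
          moreover have "mrg (st u n) (u n) X l \<and> l = k"
            using e True by (simp add: prio_def l_def[symmetric] Let_def split: if_splits)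
                presburger
          ultimately show False using mrgp[of n X] i1[of n] n by auto
        next
          case False
          then have "prio X (st u n) (u n) = Suc (2 * Suc (card (range h)))"
            unfolding prio_def by (simp only: if_False)
          then show False using e by presburger
        qed
      qed
      then show ?thesis using ge[of n] n by simp
    qed
    ultimately have "even_liminf (\<lambda>n. prio X (st u n) (u n)) \<longleftrightarrow> even (Suc (2 * k))"
      by (rule even_liminf_iff)
    then show ?thesis using nM by simp
  qed
qed

end

section \<open>Certificates\<close>

text \<open>The first component puts the empty word in a class of its own.\<close>

definition class_of :: "nat \<Rightarrow> nat set list \<Rightarrow> bool \<times> (nat set \<times> nat set \<times> nat set) set" where
  "class_of N x = (x = [], profile N x)"

definition class_step :: "nat \<Rightarrow> bool \<times> (nat set \<times> nat set \<times> nat set) set \<Rightarrow> nat set \<Rightarrow>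
    bool \<times> (nat set \<times> nat set \<times> nat set) set" where
  "class_step N c a = (False, step_profile N (snd c) a)"

interpretation rc: right_congruence "class_of N" "class_step N" for N
proof
  show "class_of N (x @ [a]) = class_step N (class_of N x) a" for x a
    by (simp add: class_of_def class_step_def profile_snoc)
  show "x = []" if "class_of N x = class_of N []" for x using that by (simp add: class_of_def)
  have "class_of N x \<in> UNIV \<times> Pow (Pow {..N} \<times> Pow {..N} \<times> Pow {..N})" for x
    using profile_range[of N x] by (simp add: class_of_def)
  then have "range (class_of N) \<subseteq> UNIV \<times> Pow (Pow {..N} \<times> Pow {..N} \<times> Pow {..N})" by blast
  then show "finite (range (class_of N))" by (rule finite_subset) simp
qed

text \<open>A pair is accepting when some satisfying word factors accordingly; saturation makes this
  independent of the word. No procedure for membership is given, as the set enters only an existence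
  proof.\<close>

definition accepting_pairs :: "nat \<Rightarrow> ((bool \<times> (nat set \<times> nat set \<times> nat set) set) \<times>
    (bool \<times> (nat set \<times> nat set \<times> nat set) set)) set" where
  "accepting_pairs N = {(a, s). \<exists>u t. t 0 = (0::nat) \<and> (\<forall>k. t (Suc k) < t (Suc (Suc k))) \<and>
     rc.cl N u 0 (t 1) = a \<and> (\<forall>k. rc.cl N u (t (Suc k)) (t (Suc (Suc k))) = s) \<and> truth u 0 N}"

abbreviation "prioN N \<equiv> rc.prio N (accepting_pairs N)"

lemma truth_parity: "truth u 0 N \<longleftrightarrow> even_liminf (\<lambda>n. prioN N (rc.st N u n) (u n))"
proof (rule rc.parity_prio)
  fix t :: "nat \<Rightarrow> nat" and s
  assume t: "t 0 = 0" "\<And>k. t (Suc k) < t (Suc (Suc k))"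
    "\<And>k. rc.cl N u (t (Suc k)) (t (Suc (Suc k))) = s"
  show "truth u 0 N \<longleftrightarrow> (rc.cl N u 0 (t 1), s) \<in> accepting_pairs N"
  proof
    assume "truth u 0 N"
    then show "(rc.cl N u 0 (t 1), s) \<in> accepting_pairs N"
      unfolding accepting_pairs_def using t by blast
  next
    assume "(rc.cl N u 0 (t 1), s) \<in> accepting_pairs N"
    then obtain u' t' where t': "t' 0 = (0::nat)" "\<And>k. t' (Suc k) < t' (Suc (Suc k))"
      "rc.cl N u' 0 (t' 1) = rc.cl N u 0 (t 1)"
      "\<And>k. rc.cl N u' (t' (Suc k)) (t' (Suc (Suc k))) = s" "truth u' 0 N"
      unfolding accepting_pairs_def by blast
    have eq: "profile N (segment u' (t' k) (t' (Suc k))) = profile N (segment u (t k) (t (Suc k)))"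
      for k
    proof -
      have "rc.cl N u' (t' k) (t' (Suc k)) = rc.cl N u (t k) (t (Suc k))"
        using t t' by (cases k) auto
      then show ?thesis by (simp add: rc.cl_def class_of_def)
    qed
    have le: "t k \<le> t (Suc k)" "t' k \<le> t' (Suc k)" for k
      using t(1) t(2)[of "k - 1"] t'(1) t'(2)[of "k - 1"] by (cases k; simp)+
    show "truth u 0 N"
      by (rule profile_saturates[of t' t N u' u]) (use t t' eq le in auto)
  qed
qed

section \<open>Lassos and measures in the product with the tableau\<close>

lemma cycle_inf_often:
  assumes c: "\<And>n. \<rho> (k + n) = xs ! (n mod length xs)" and x: "x \<in> set xs"
  shows "inf_often (\<lambda>n. \<rho> (Suc n) = x)"
  unfolding inf_often_def
proof
  fix i
  obtain m where m: "m < length xs" "xs ! m = x" using x by (auto simp: in_set_conv_nth)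
  let ?n = "k + (Suc i * length xs + m)"
  have "(Suc i * length xs + m) mod length xs = m" using m by (simp only: mod_mult_self3 mod_less)
  then have "\<rho> ?n = x" unfolding c using m by simp
  have "Suc i * 1 \<le> Suc i * length xs" using m by (intro mult_le_mono2) simp
  then have "Suc i \<le> Suc i * length xs" by (simp only: mult_1_right)
  then have "Suc i \<le> ?n" by (intro trans_le_add2 trans_le_add1)
  then obtain n where "?n = Suc n" "i \<le> n" by (metis Suc_le_D Suc_le_mono)
  with \<open>\<rho> ?n = x\<close> show "\<exists>n\<ge>i. \<rho> (Suc n) = x" by metis
qed

text \<open>A label consists of an automaton state, the letter read on entering, and a priority. So
  the letter of a step is taken from its target \<open>z\<close>, while the guess \<open>A\<close>
  and the counter \<open>j\<close> belong to the source.\<close>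

definition tableau_product :: "nat \<Rightarrow> ('m \<times> 'm) set \<Rightarrow> ('m \<Rightarrow> 'q \<times> nat set \<times> nat) \<Rightarrow>
    (('m \<times> nat set \<times> nat) \<times> ('m \<times> nat set \<times> nat)) set" where
  "tableau_product N H lab = {((x, A, j), (z, A', j')) |x A j z A' j'. (x, z) \<in> H \<and> A \<subseteq> {..N} \<and>
    A' \<subseteq> {..N} \<and>
     j \<le> N \<and> j' = next_index N A j \<and> tableau_step N A (fst (snd (lab z))) A'}"

text \<open>The local form of the progress measure. The value \<open>0\<close> of \<kappa> marks
  product states about which nothing is claimed. Along a run \<kappa> cannot rise; if it settles on
  an even value acceptance has ceased, and on an odd one each accepting visit must be paid for by
  \<pi> or by negative weight.\<close>

definition measure_step :: "nat \<Rightarrow> ('m \<Rightarrow> nat set \<Rightarrow> nat \<Rightarrow> nat) \<Rightarrow> ('m \<Rightarrow> nat set \<Rightarrow> nat \<Rightarrow> nat) \<Rightarrow> nat \<Rightarrow>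
    int \<Rightarrow> 'm \<Rightarrow> 'm \<Rightarrow> nat set \<Rightarrow> bool" where
  "measure_step N \<kappa> \<pi> C wl m m' x \<longleftrightarrow> (\<forall>A A' j. A \<subseteq> {..N} \<longrightarrow> A' \<subseteq> {..N} \<longrightarrow> j \<le> N \<longrightarrow>
     tableau_step N A x A' \<longrightarrow> 0 < \<kappa> m A j \<longrightarrow> 0 < \<kappa> m' A' (next_index N A j) \<and>
     (\<kappa> m' A' (next_index N A j) < \<kappa> m A j \<or> \<kappa> m' A' (next_index N A j) = \<kappa> m A j \<and>
      (if even (\<kappa> m A j) then \<not> accepting N A j
       else int (\<pi> m' A' (next_index N A j)) + int C * wl + of_bool (accepting N A j) \<le> int
           (\<pi> m A j))))"

lemma finite_nonneg_shift:
  fixes f :: "'v \<Rightarrow> int"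
  assumes "finite V" obtains D where "\<And>v. v \<in> V \<Longrightarrow> 0 \<le> f v + D"
proof (rule that)
  fix v assume "v \<in> V"
  then have "- f v \<le> Max ((\<lambda>v. - f v) ` V)" using assms by (intro Max_ge) auto
  then show "0 \<le> f v + Max ((\<lambda>v. - f v) ` V)" by simp
qed

text \<open>Only cycles reachable from initial guesses satisfying \<open>P\<close> are assumed
  negative, so the product is cut down to the reachable part \<open>R\<close> before a progress
  measure is taken.\<close>

lemma measure_step_exists:
  assumes fin: "finite S" and HS: "H \<subseteq> S \<times> S" and x0: "x0 \<in> S"
    and neg: "\<And>A0 ss v cs. A0 \<subseteq> {..N} \<Longrightarrow> P A0 \<Longrightarrow> walk (tableau_product N H lab) (x0, A0, 0) ss v \<Longrightarrow>
      walk (tableau_product N H lab) v cs v \<Longrightarrow> \<exists>(x, A, j)\<in>set cs. accepting N A j \<Longrightarrow>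
      (\<Sum>(x, _)\<leftarrow>cs. \<omega> x) < (0::int)"
  obtains \<kappa> \<pi> :: "'m \<Rightarrow> nat set \<Rightarrow> nat \<Rightarrow> nat" and C where "0 < C"
    "\<And>A. A \<subseteq> {..N} \<Longrightarrow> P A \<Longrightarrow> 0 < \<kappa> x0 A 0"
    "\<And>m m'. (m, m') \<in> H \<Longrightarrow> measure_step N \<kappa> \<pi> C (\<omega> m') m m' (fst (snd (lab m')))"
proof -
  define T where "T = tableau_product N H lab"
  define R where "R = T\<^sup>* `` {(x0, A, 0) |A. A \<subseteq> {..N} \<and> P A}"
  define T' where "T' = {(a, b) \<in> T. a \<in> R}"
  define V where "V = S \<times> Pow {..N} \<times> {..N}"
  have finV: "finite V" using fin by (simp add: V_def)
  have nx: "next_index N A j \<le> N" if "j \<le> N" for A j using that by (auto simp: next_index_def)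
  have TV: "T \<subseteq> V \<times> V" using HS nx by (auto simp: T_def tableau_product_def V_def)
  have T'V: "T' \<subseteq> V \<times> V" using TV by (auto simp: T'_def)
  define ac where "ac = (\<lambda>(x::'m, A, j). accepting N A j)"
  define \<omega>' where "\<omega>' = (\<lambda>(x, A::nat set, j::nat). \<omega> x)"
  have "sum_list (map \<omega>' cs) < 0" if c: "walk T' v cs v" "\<exists>z\<in>set cs. ac z" for v cs
  proof -
    have "v \<in> R" using c by (cases cs) (auto simp: T'_def)
    then obtain A0 where A0: "A0 \<subseteq> {..N}" "P A0" "((x0, A0, 0), v) \<in> T\<^sup>*" by (auto simp: R_def)
    then obtain ss where ss: "walk T (x0, A0, 0) ss v" using rtrancl_walk by metis
    have "walk T v cs v" using c(1) by (rule walk_mono) (auto simp: T'_def)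
    then have "(\<Sum>(x, _)\<leftarrow>cs. \<omega> x) < 0"
      using neg[OF A0(1,2) ss[unfolded T_def]] c(2) by (simp add: T_def ac_def)
    moreover have "\<omega>' = (\<lambda>(x, _). \<omega> x)" by (auto simp: \<omega>'_def)
    ultimately show ?thesis by simp
  qed
  then obtain \<kappa> :: "'m \<times> nat set \<times> nat \<Rightarrow> nat" and \<pi> :: "'m \<times> nat set \<times> nat \<Rightarrow> int" and C :: nat
    where C: "0 < C" and m: "\<And>x y. (x, y) \<in> T' \<Longrightarrow> \<kappa> y < \<kappa> x \<or> \<kappa> y = \<kappa> x \<and>
       (if even (\<kappa> x) then \<not> ac x else \<pi> y + int C * \<omega>' x + of_bool (ac x) \<le> \<pi> x)"
    using progress_measure_exists[OF finV T'V, of ac \<omega>'] by metis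
  obtain D where D: "\<And>v. v \<in> V \<Longrightarrow> 0 \<le> (\<pi> v - int C * \<omega>' v) + D"
    using finite_nonneg_shift[OF finV, of "\<lambda>v. \<pi> v - int C * \<omega>' v"] by blast
  \<comment> \<open>Adding \<open>2\<close> keeps the parity and reserves \<open>0\<close> for the
    states outside \<open>R\<close>.\<close>
  define \<kappa>' where "\<kappa>' m A j = (if (m, A, j) \<in> R then \<kappa> (m, A, j) + 2 else 0)" for m A j
  \<comment> \<open>The measure on the graph charges the weight of the source,
    \<open>measure_step\<close> that of the target. Subtracting the scaled weight at
    \<open>m\<close> shifts the charge along the edge, and \<open>D\<close> makes the result
    nonnegative.\<close>
  define \<pi>' where "\<pi>' m A j = nat (\<pi> (m, A, j) - int C * \<omega> m + D)" for m A j
  have \<pi>': "int (\<pi>' m A j) = \<pi> (m, A, j) - int C * \<omega> m + D" if "(m, A, j) \<in> V" for m A j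
    using D[OF that] by (simp add: \<pi>'_def \<omega>'_def)
  show ?thesis
  proof (rule that[OF C])
    show "0 < \<kappa>' x0 A 0" if "A \<subseteq> {..N}" "P A" for A
    proof -
      have "(x0, A, 0) \<in> R" unfolding R_def using that by blast
      then show ?thesis by (simp add: \<kappa>'_def)
    qed
    show "measure_step N \<kappa>' \<pi>' C (\<omega> m') m m' (fst (snd (lab m')))" if mm: "(m, m') \<in> H" for m m'
      unfolding measure_step_def
    proof (intro allI impI)
      fix A A' j assume a: "A \<subseteq> {..N}" "A' \<subseteq> {..N}" "j \<le> N"
          "tableau_step N A (fst (snd (lab m'))) A'"
        "0 < \<kappa>' m A j"
      let ?x = "(m, A, j)" and ?y = "(m', A', next_index N A j)"
      have xR: "?x \<in> R" using a(5) by (auto simp: \<kappa>'_def split: if_splits)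
      have t: "(?x, ?y) \<in> T" using a mm by (auto simp: T_def tableau_product_def)
      then have yR: "?y \<in> R" using xR unfolding R_def by (auto intro: rtrancl_into_rtrancl)
      have t': "(?x, ?y) \<in> T'" using t xR by (simp add: T'_def)
      have V: "?x \<in> V" "?y \<in> V" using t TV by auto
      have k: "\<kappa>' m A j = \<kappa> ?x + 2" "\<kappa>' m' A' (next_index N A j) = \<kappa> ?y + 2"
        using xR yR by (simp_all add: \<kappa>'_def)
      have "ac ?x = accepting N A j" "\<omega>' ?x = \<omega> m" by (simp_all add: ac_def \<omega>'_def)
      then show "0 < \<kappa>' m' A' (next_index N A j) \<and>
        (\<kappa>' m' A' (next_index N A j) < \<kappa>' m A j \<or> \<kappa>' m' A' (next_index N A j) = \<kappa>' m A j \<and>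
         (if even (\<kappa>' m A j) then \<not> accepting N A j
          else int (\<pi>' m' A' (next_index N A j)) + int C * \<omega> m' + of_bool (accepting N A j) \<le> int
              (\<pi>' m A j)))"
        using m[OF t'] unfolding k \<pi>'[OF V(1)] \<pi>'[OF V(2)] by (auto split: if_splits)
    qed
  qed
qed

text \<open>An arbitrary deterministic parity automaton for the formula with code \<open>N\<close>.
  Priorities sit on transitions; their bound \<open>B\<close> later serves as a neutral
  priority.\<close>

locale parity_automaton =
  fixes N :: nat and Q :: "'q set" and q0 :: 'q and dl :: "'q \<Rightarrow> nat set \<Rightarrow> 'q"
    and pp :: "'q \<Rightarrow> nat set \<Rightarrow> nat" and B :: nat
  assumes finite_Q: "finite Q" and q0_in: "q0 \<in> Q" and dl_in: "q \<in> Q \<Longrightarrow> dl q a \<in> Q"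
    and pp_le: "pp q a \<le> B"
    and correct: "truth u 0 N \<longleftrightarrow> even_liminf (\<lambda>n. pp (rec_nat q0 (\<lambda>n q. dl q (u n)) n) (u n))"
begin

definition follows :: "'q \<times> nat set \<times> nat \<Rightarrow> 'q \<times> nat set \<times> nat \<Rightarrow> bool" where
  "follows l l' \<longleftrightarrow>
     fst l' = dl (fst l) (fst (snd l')) \<and> snd (snd l') = pp (fst l) (fst (snd l'))"

text \<open>Two descriptions of one infinite word are compared. If the lasso is followed forever,
  the tableau part accepts infinitely often and so is the true run; hence \<open>N \<in> A0\<close>
  iff the word satisfies the formula. The labels follow the deterministic automaton; hence this is
  so iff the least priority on the cycle is even.\<close>

lemma tableau_product_cycle:
  assumes H: "\<And>x z. (x, z) \<in> H \<Longrightarrow> follows (lab x) (lab z)"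
    and x0: "fst (lab x0) = q0"
    and stem: "walk (tableau_product N H lab) (x0, A0, 0) ss v"
    and cyc: "walk (tableau_product N H lab) v cs v" and ac: "\<exists>(x, A, j)\<in>set cs. accepting N A j"
  shows "N \<in> A0 \<longleftrightarrow> even (Min ((\<lambda>(x, _). snd (snd (lab x))) ` set cs))"
proof -
  have ne: "cs \<noteq> []" using ac by auto
  have v: "cs ! 0 = v" using cyc ne by (cases cs) auto
  obtain \<rho> k where \<rho>0: "\<rho> 0 = (x0, A0, 0)" and \<rho>: "\<And>n. (\<rho> n, \<rho> (Suc n)) \<in> tableau_product N H lab"
    and per: "\<And>n. \<rho> (k + n) = cs ! (n mod length cs)"
    by (rule stem_path[OF stem, of "\<lambda>n. cs ! (n mod length cs)"])
      (use cycle_path[OF cyc ne] v in \<open>auto\<close>)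
  define X where "X n = fst (\<rho> n)" for n
  define A where "A n = fst (snd (\<rho> n))" for n
  define j where "j n = snd (snd (\<rho> n))" for n
  define u where "u n = fst (snd (lab (X (Suc n))))" for n
  have e: "(X n, X (Suc n)) \<in> H" "j (Suc n) = next_index N (A n) (j n)"
    "tableau_step N (A n) (u n) (A (Suc n))" for n
    using \<rho>[of n] by (auto simp: tableau_product_def X_def A_def j_def u_def)
  define run where "run u n = rec_nat q0 (\<lambda>n q. dl q (u n)) n" for u n
  have q: "fst (lab (X n)) = run u n" for n
  proof (induction n)
    case 0 show ?case by (simp add: X_def \<rho>0 x0 run_def)
  next
    case (Suc n)
    show ?case using H[OF e(1)[of n]] Suc by (simp add: follows_def run_def u_def)
  qed
  have p: "snd (snd (lab (X (Suc n)))) = pp (run u n) (u n)" for n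
    using H[OF e(1)[of n]] q[of n] by (simp add: follows_def u_def)
  obtain x B i where xB: "(x, B, i) \<in> set cs" "accepting N B i" using ac by auto
  have "inf_often (\<lambda>n. \<rho> (Suc n) = (x, B, i))" by (rule cycle_inf_often[OF per xB(1)])
  then have infacc: "\<exists>l\<ge>n. accepting N (A l) (j l)" for n
  proof -
    obtain l where "l \<ge> n" "\<rho> (Suc l) = (x, B, i)"
      using \<open>inf_often (\<lambda>n. \<rho> (Suc n) = (x, B, i))\<close> unfolding inf_often_def by blast
    then show ?thesis using xB(2) by (intro exI[of _ "Suc l"]) (auto simp: A_def j_def)
  qed
  have "N \<in> A 0 \<longleftrightarrow> truth u 0 N"
    by (rule tableau_truth[of N A u]) (use e accepting_imp_fair[of j N A, OF e(2) infacc] in auto)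
  moreover have "A 0 = A0" by (simp add: A_def \<rho>0)
  moreover have "truth u 0 N \<longleftrightarrow> even (Min ((\<lambda>(x, _). snd (snd (lab x))) ` set cs))" (is "_ \<longleftrightarrow>
    even ?m")
    unfolding correct run_def[symmetric]
  proof (rule even_liminf_iff[of _ _ k])
    have "?m \<in> (\<lambda>(x, _). snd (snd (lab x))) ` set cs" using ne by (intro Min_in) auto
    then obtain y where y: "y \<in> set cs" "?m = snd (snd (lab (fst y)))" by (auto simp: split_beta)
    have "inf_often (\<lambda>n. \<rho> (Suc n) = y)" by (rule cycle_inf_often[OF per y(1)])
    then show "inf_often (\<lambda>n. pp (run u n) (u n) = ?m)"
      by (rule inf_often_mono) (simp add: p[symmetric] y(2) X_def)
  next
    fix n assume "k \<le> n"
    then have "\<rho> (Suc n) = cs ! ((Suc n - k) mod length cs)" using per[of "Suc n - k"] by simp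
    then have "\<rho> (Suc n) \<in> set cs" using ne by simp
    then have "snd (snd (lab (X (Suc n)))) \<in> (\<lambda>(x, _). snd (snd (lab x))) ` set cs"
      by (force simp: X_def split_beta)
    then show "?m \<le> pp (run u n) (u n)" unfolding p by (intro Min_le) auto
  qed
  ultimately show ?thesis by simp
qed

end

section \<open>Certificates and their soundness\<close>

definition letter_energy :: "nat set \<Rightarrow> nat set \<Rightarrow> (nat literal \<Rightarrow> int) \<Rightarrow> nat set \<Rightarrow> int" where
  "letter_energy inp out w x = letter_weight w out (x \<inter> out) + letter_weight w inp (x \<inter> inp)"

text \<open>The number \<open>e m\<close> is a credit that suffices from state \<open>m\<close>. The
  measure has weight \<open>0\<close> and starts at the guesses in which the formula is false, so it
  says that no fair run begins there.\<close>

definition pos_cert where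
  "pos_cert inp out w N S m0 e \<kappa> \<pi> C \<longleftrightarrow> m0 \<in> S \<and> 0 < C \<and>
     (\<forall>A. A \<subseteq> {..N} \<longrightarrow> N \<notin> A \<longrightarrow> 0 < \<kappa> m0 A 0) \<and>
     (\<forall>m\<in>S. \<exists>a\<subseteq>out. \<forall>i\<subseteq>inp. \<exists>m'\<in>S.
        int (e m') \<le> int (e m) + letter_energy inp out w (a \<union> i) \<and>
            measure_step N \<kappa> \<pi> C 0 m m' (a \<union> i))"

text \<open>The measure starts at the guesses in which the formula is true and carries the energy as
  weight: a fair run from there loses energy without bound.\<close>

definition neg_cert where
  "neg_cert inp out w N S m0 \<kappa> \<pi> C \<longleftrightarrow> m0 \<in> S \<and> 0 < C \<and>
     (\<forall>A. A \<subseteq> {..N} \<longrightarrow> N \<in> A \<longrightarrow> 0 < \<kappa> m0 A 0) \<and>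
     (\<forall>m\<in>S. \<forall>a\<subseteq>out. \<exists>i\<subseteq>inp. \<exists>m'\<in>S.
        measure_step N \<kappa> \<pi> C (letter_energy inp out w (a \<union> i)) m m' (a \<union> i))"

text \<open>The measure is followed along the true run, which is fair. Its \<kappa> is eventually
  constant, and an even value contradicts fairness. For an odd value, telescoping bounds
  \<open>C\<close> times the weight plus the number of accepting visits by a fixed value of \<pi>;
  as the visits are unbounded, the weight has no lower bound.\<close>

lemma measure_step_unbounded:
  assumes C: "0 < C" and step: "\<And>n. measure_step N \<kappa> \<pi> C (wl n) (m n) (m (Suc n)) (u n)"
    and init: "0 < \<kappa> (m 0) {k. k \<le> N \<and> truth u 0 k} 0"
  shows "\<exists>n. (\<Sum>k<n. wl k) < b"
proof (rule ccontr)
  assume "\<not> ?thesis"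
  then have b: "b \<le> (\<Sum>k<n. wl k)" for n by (simp add: not_less)
  define A where "A i = {k. k \<le> N \<and> truth u i k}" for i
  define j where "j = rec_nat 0 (\<lambda>i. next_index N (A i))"
  have j0: "j 0 = 0" and jS: "j (Suc i) = next_index N (A i) (j i)" for i by (simp_all add: j_def)
  have jN: "j i \<le> N" for i by (induction i) (auto simp: j0 jS next_index_def)
  have AN: "A i \<subseteq> {..N}" for i by (auto simp: A_def)
  have cA: "tableau_step N (A i) (u i) (A (Suc i))" for i using truth_tableau_step
    by (simp add: A_def)
  have infacc: "\<exists>k\<ge>i. accepting N (A k) (j k)" for i
    by (rule fair_imp_accepting[of j N A, OF jS]) (use truth_fair in \<open>auto simp: A_def j0\<close>)
  define K where "K i = \<kappa> (m i) (A i) (j i)" for i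
  define p where "p i = \<pi> (m i) (A i) (j i)" for i
  have st: "0 < K (Suc i) \<and> (K (Suc i) < K i \<or> K (Suc i) = K i \<and>
    (if even (K i) then \<not> accepting N (A i) (j i)
       else int (p (Suc i)) + int C * wl i + of_bool (accepting N (A i) (j i)) \<le> int (p i)))"
           if "0 < K i" for i
    using step[of i] AN[of i] AN[of "Suc i"] jN[of i] cA[of i] that
    unfolding measure_step_def K_def p_def jS by blast
  have K0: "0 < K i" for i
  proof (induction i)
    case 0 then show ?case using init by (simp add: K_def A_def j0)
  next
    case (Suc i) then show ?case using st by blast
  qed
  obtain i0 where i0: "\<And>i. K i0 \<le> K i"
  proof -
    obtain i0 where "K i0 = (LEAST k. k \<in> range K)" by (metis LeastI rangeE rangeI)
    then have "K i0 \<le> K i" for i by (simp add: Least_le)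
    then show ?thesis using that by blast
  qed
  have Kc: "K (i0 + d) = K i0" for d
  proof (induction d)
    case (Suc d)
    have "K (Suc (i0 + d)) \<le> K (i0 + d)" using st[OF K0[of "i0 + d"]] by auto
    then show ?case using Suc i0[of "Suc (i0 + d)"] by simp
  qed simp
  have st': "if even (K i0) then \<not> accepting N (A (i0 + d)) (j (i0 + d))
       else int (p (i0 + Suc d)) + int C * wl (i0 + d) + of_bool (accepting N (A (i0 + d)) (j
           (i0 + d))) \<le> int (p (i0 + d))" for d
    using st[OF K0[of "i0 + d"]] Kc[of d] Kc[of "Suc d"] by simp
  show False
  proof (cases "even (K i0)")
    case True
    obtain k where "k \<ge> i0" "accepting N (A k) (j k)" using infacc by blast
    then show False using st'[of "k - i0"] True by simp
  next
    case False
    define a where "a d = (\<Sum>k<d. of_bool (accepting N (A (i0 + k)) (j (i0 + k))) :: int)" for d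
    have le: "int (p (i0 + d)) + int C * (\<Sum>k<d. wl (i0 + k)) + a d \<le> int (p i0)" for d
    proof (induction d)
      case (Suc d)
      then show ?case using st'[of d] False by (simp add: a_def algebra_simps)
    qed (simp add: a_def)
    have split: "(\<Sum>k<i0 + d. wl k) = (\<Sum>k<i0. wl k) + (\<Sum>k<d. wl (i0 + k))" for d
      by (induction d) auto
    have low: "int C * (b - (\<Sum>k<i0. wl k)) \<le> int C * (\<Sum>k<d. wl (i0 + k))" for d
      using b[of "i0 + d"] split[of d] by (intro mult_left_mono) auto
    have up: "a d \<le> int (p i0) - int C * (b - (\<Sum>k<i0. wl k))" for d
      using le[of d] low[of d] by linarith
    have mono: "a d \<le> a d'" if "d \<le> d'" for d d'
      unfolding a_def using that by (intro sum_mono2) auto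
    have unb: "\<exists>d. int M \<le> a d" for M
    proof (induction M)
      case 0 then show ?case by (intro exI[of _ 0]) (simp add: a_def)
    next
      case (Suc M)
      then obtain d where d: "int M \<le> a d" by blast
      obtain k where k: "k \<ge> i0 + d" "accepting N (A k) (j k)" using infacc by blast
      then have "a (Suc (k - i0)) = a (k - i0) + 1" by (simp add: a_def)
      moreover have "a d \<le> a (k - i0)" using k by (intro mono) simp
      ultimately show ?case using d by (intro exI[of _ "Suc (k - i0)"]) simp
    qed
    obtain d where "int (nat (int (p i0) - int C * (b - (\<Sum>k<i0. wl k)) + 1)) \<le> a d" using unb
      by blast
    then show False using up[of d] by linarith
  qed
qed

lemma history_in:
  assumes "lO \<in> strategies_O inp out" "lI \<in> strategies_I inp out"
  shows "history_after lO lI n \<in> histories inp out"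
proof (induction n)
  case 0 show ?case by (simp add: histories_def)
next
  case (Suc n)
  have "lO (history_after lO lI n) \<in> Pow out" using assms Suc by (auto simp: strategies_O_def)
  moreover from this have "lI (history_after lO lI n, lO (history_after lO lI n)) \<in> Pow inp"
    using assms(2) Suc unfolding strategies_I_def by blast
  ultimately show ?case using Suc by (simp add: histories_def Let_def)
qed

lemma energy_level_eq: "energy_level inp out w u n = (\<Sum>k<n. letter_energy inp out w (u k))"
  by (simp add: energy_level_def letter_energy_def)

lemma pos_cert_sound:
  assumes "pos_cert inp out w N S m0 e \<kappa> \<pi> C"
  shows "E_realizable inp out w (dec_ltl N)"
proof -
  define ok where "ok m a i m' \<longleftrightarrow>
    int (e m') \<le> int (e m) + letter_energy inp out w (a \<union> i) \<and>
        measure_step N \<kappa> \<pi> C 0 m m' (a \<union> i)" for m a i m'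
  have m0: "m0 \<in> S" and C: "0 < C" and init: "\<And>A. A \<subseteq> {..N} \<Longrightarrow> N \<notin> A \<Longrightarrow> 0 < \<kappa> m0 A 0"
    and "\<forall>m\<in>S. \<exists>a\<subseteq>out. \<forall>i\<subseteq>inp. \<exists>m'\<in>S.
        int (e m') \<le> int (e m) + letter_energy inp out w (a \<union> i) \<and>
            measure_step N \<kappa> \<pi> C 0 m m' (a \<union> i)"
    using assms unfolding pos_cert_def by blast+
  then have all: "\<forall>m\<in>S. \<exists>a\<subseteq>out. \<forall>i\<subseteq>inp. \<exists>m'\<in>S. ok m a i m'" unfolding ok_def by blast
  define f where "f m = (SOME a. a \<subseteq> out \<and> (\<forall>i\<subseteq>inp. \<exists>m'\<in>S. ok m a i m'))" for m
  have f: "f m \<subseteq> out \<and> (\<forall>i\<subseteq>inp. \<exists>m'\<in>S. ok m (f m) i m')" if "m \<in> S" for m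
    unfolding f_def by (rule someI_ex) (use all that in blast)
  define g where "g m i = (SOME m'. m' \<in> S \<and> ok m (f m) i m')" for m i
  have g: "g m i \<in> S \<and> ok m (f m) i (g m i)" if "m \<in> S" "i \<subseteq> inp" for m i
    unfolding g_def by (rule someI_ex) (use f that in blast)
  define ms where "ms = foldl (\<lambda>m (a :: nat set, i). g m i) m0"
  have msS: "ms hs \<in> S" if "hs \<in> histories inp out" for hs
    using that by (induction hs rule: rev_induct) (auto simp: ms_def m0 histories_def g)
  define lO where "lO hs = f (ms hs)" for hs
  have lO: "lO \<in> strategies_O inp out" using f msS by (auto simp: strategies_O_def lO_def)
  show ?thesis unfolding E_realizable_def
  proof (intro bexI[OF _ lO] exI[of _ "e m0"] ballI)
    fix lI assume lI: "lI \<in> strategies_I inp out"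
    define H where "H n = history_after lO lI n" for n
    define m where "m n = ms (H n)" for n
    define i where "i n = lI (H n, lO (H n))" for n
    let ?u = "outcome lO lI"
    have HS: "H n \<in> histories inp out" for n using history_in[OF lO lI] by (simp add: H_def)
    have mS: "m n \<in> S" for n using msS HS by (simp add: m_def)
    have "lO (H n) \<in> Pow out" for n using lO HS unfolding strategies_O_def by blast
    then have "i n \<in> Pow inp" for n using lI HS[of n] unfolding strategies_I_def i_def by blast
    then have iS: "i n \<subseteq> inp" for n by blast
    have u: "?u n = f (m n) \<union> i n" for n by (simp add: outcome_def H_def m_def i_def lO_def Let_def)
    have "H (Suc n) = H n @ [(lO (H n), i n)]" for n by (simp add: H_def i_def Let_def)
    then have mSuc: "m (Suc n) = g (m n) (i n)" for n by (simp add: m_def ms_def)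
    have m_0: "m 0 = m0" by (simp add: m_def ms_def H_def)
    have gg: "int (e (m (Suc n))) \<le> int (e (m n)) + letter_energy inp out w (?u n)"
      "measure_step N \<kappa> \<pi> C 0 (m n) (m (Suc n)) (?u n)" for n
      using g[OF mS iS, of n n] by (simp_all add: u mSuc ok_def)
    have "int (e (m n)) \<le> int (e m0) + energy_level inp out w ?u n" for n
    proof (induction n)
      case 0 then show ?case by (simp add: m_0 energy_level_eq)
    next
      case (Suc n) then show ?case using gg(1)[of n] by (simp add: energy_level_eq)
    qed
    then have en: "0 \<le> int (e m0) + energy_level inp out w ?u n" for n
      by (meson of_nat_0_le_iff order_trans)
    have "truth ?u 0 N"
    proof (rule ccontr)
      assume "\<not> ?thesis"
      then have "0 < \<kappa> (m 0) {k. k \<le> N \<and> truth ?u 0 k} 0" unfolding m_0 by (intro init) auto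
      \<comment> \<open>If the formula failed, the true run would start at a guess covered by the
        measure; with all weights \<open>0\<close> a sum of zeros would become negative.\<close>
      then have "\<exists>n::nat. (\<Sum>k<n. (0::int)) < 0" using C gg(2)
        by - (rule measure_step_unbounded[where wl = "\<lambda>_. 0"
            and m = m and u = ?u and N = N and \<kappa> = \<kappa> and \<pi> = \<pi> and C = C])
      then show False by simp
    qed
    then show "models ?u (dec_ltl N) \<and> (\<forall>n. 0 \<le> int (e m0) + energy_level inp out w ?u n)"
      using en by (simp add: models_def truth_def)
  qed
qed

lemma neg_cert_sound:
  assumes "neg_cert inp out w N S m0 \<kappa> \<pi> C"
  shows "\<not> E_realizable inp out w (dec_ltl N)"
proof
  assume "E_realizable inp out w (dec_ltl N)"
  then obtain lO c0 where lO: "lO \<in> strategies_O inp out"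
    and win: "\<And>lI. lI \<in> strategies_I inp out \<Longrightarrow> models (outcome lO lI) (dec_ltl N) \<and>
        (\<forall>n. int c0 + energy_level inp out w (outcome lO lI) n \<ge> 0)"
    unfolding E_realizable_def by blast
  define ok where "ok m a i m' \<longleftrightarrow>
    measure_step N \<kappa> \<pi> C (letter_energy inp out w (a \<union> i)) m m' (a \<union> i)" for m a i m'
  have m0: "m0 \<in> S" and C: "0 < C" and init: "\<And>A. A \<subseteq> {..N} \<Longrightarrow> N \<in> A \<Longrightarrow> 0 < \<kappa> m0 A 0"
    and "\<forall>m\<in>S. \<forall>a\<subseteq>out. \<exists>i\<subseteq>inp. \<exists>m'\<in>S.
        measure_step N \<kappa> \<pi> C (letter_energy inp out w (a \<union> i)) m m' (a \<union> i)"
    using assms unfolding neg_cert_def by blast+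
  then have all: "\<forall>m\<in>S. \<forall>a\<subseteq>out. \<exists>i\<subseteq>inp. \<exists>m'\<in>S. ok m a i m'" unfolding ok_def by blast
  define r where "r m a = (SOME i. i \<subseteq> inp \<and> (\<exists>m'\<in>S. ok m a i m'))" for m a
  have r: "r m a \<subseteq> inp \<and> (\<exists>m'\<in>S. ok m a (r m a) m')" if "m \<in> S" "a \<subseteq> out" for m a
    unfolding r_def by (rule someI_ex) (use all that in blast)
  define g where "g m a = (SOME m'. m' \<in> S \<and> ok m a (r m a) m')" for m a
  have "g m a \<in> S \<and> ok m a (r m a) (g m a)" if "m \<in> S" "a \<subseteq> out" for m a
    unfolding g_def by (rule someI_ex) (use r that in blast)
  then have g: "r m a \<subseteq> inp \<and> g m a \<in> S \<and> ok m a (r m a) (g m a)" if "m \<in> S" "a \<subseteq> out" for m a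
    using r that by blast
  define ms where "ms = foldl (\<lambda>m (a, i :: nat set). g m a) m0"
  have msS: "ms hs \<in> S" if "hs \<in> histories inp out" for hs
    using that by (induction hs rule: rev_induct) (auto simp: ms_def m0 histories_def g)
  define lI where "lI = (\<lambda>(hs, a). r (ms hs) a)"
  have lI: "lI \<in> strategies_I inp out" using g msS by (auto simp: strategies_I_def lI_def)
  define H where "H n = history_after lO lI n" for n
  define m where "m n = ms (H n)" for n
  let ?u = "outcome lO lI"
  have HS: "H n \<in> histories inp out" for n using history_in[OF lO lI] by (simp add: H_def)
  have mS: "m n \<in> S" for n using msS HS by (simp add: m_def)
  have "lO (H n) \<in> Pow out" for n using lO HS unfolding strategies_O_def by blast
  then have aS: "lO (H n) \<subseteq> out" for n by blast
  have u: "?u n = lO (H n) \<union> r (m n) (lO (H n))" for n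
    by (simp add: outcome_def H_def m_def lI_def Let_def)
  have "H (Suc n) = H n @ [(lO (H n), r (m n) (lO (H n)))]" for n
    by (simp add: H_def lI_def m_def Let_def)
  then have mSuc: "m (Suc n) = g (m n) (lO (H n))" for n by (simp add: m_def ms_def)
  have m_0: "m 0 = m0" by (simp add: m_def ms_def H_def)
  have st: "measure_step N \<kappa> \<pi> C (letter_energy inp out w (?u n)) (m n) (m (Suc n)) (?u n)" for n
    using g[OF mS aS, of n n] by (simp add: u mSuc ok_def)
  have "truth ?u 0 N" using win[OF lI] by (simp add: models_def truth_def)
  then have "0 < \<kappa> (m 0) {k. k \<le> N \<and> truth ?u 0 k} 0" unfolding m_0 by (intro init) auto
  \<comment> \<open>The bound may be chosen freely, so it is taken to be the negated credit of the
    strategy under attack.\<close>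
  then have "\<exists>n. (\<Sum>k<n. letter_energy inp out w (?u k)) < - int c0" using C st
    by - (rule measure_step_unbounded[where wl = "\<lambda>k. letter_energy inp out w (?u k)"
        and m = m and u = ?u and N = N and \<kappa> = \<kappa> and \<pi> = \<pi> and C = C])
  then obtain n where "energy_level inp out w ?u n < - int c0" unfolding energy_level_eq by blast
  then show False using win[OF lI] by (smt (verit))
qed

section \<open>The arena and the existence of certificates\<close>

context parity_automaton
begin

definition arena_weight :: "nat set \<Rightarrow> nat set \<Rightarrow> (nat literal \<Rightarrow> int) \<Rightarrow> ('q \<times> nat set \<times> nat) +
    ('q \<times> nat set) \<Rightarrow> int" where
  "arena_weight inp out w v = (case v of Inl l \<Rightarrow> letter_energy inp out w (fst (snd l)) | Inr _ \<Rightarrow> 0)"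

text \<open>No priority exceeds \<open>B\<close>, so the positions of the input player do not affect
  the minimum on a closed walk.\<close>

definition arena_prio :: "('q \<times> nat set \<times> nat) + ('q \<times> nat set) \<Rightarrow> nat" where
  "arena_prio v = (case v of Inl l \<Rightarrow> snd (snd l) | Inr _ \<Rightarrow> B)"

definition arena_vertices :: "nat set \<Rightarrow> nat set \<Rightarrow> (('q \<times> nat set \<times> nat) + ('q \<times> nat set)) set" where
  "arena_vertices inp out = Inl ` (Q \<times> Pow (inp \<union> out) \<times> {..B}) \<union> Inr ` (Q \<times> Pow out)"

text \<open>The letter just read and its priority are part of the output player's positions, so that
  weights and priorities are attached to positions.\<close>

definition arena_edges :: "nat set \<Rightarrow> nat set \<Rightarrow>
    ((('q \<times> nat set \<times> nat) + ('q \<times> nat set)) \<times> (('q \<times> nat set \<times> nat) + ('q \<times> nat set))) set" where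
  "arena_edges inp out =
     {(Inl (q, a, p), Inr (q, b)) |q a p b. q \<in> Q \<and> a \<subseteq> inp \<union> out \<and> p \<le> B \<and> b \<subseteq> out} \<union>
     {(Inr (q, b), Inl (dl q (b \<union> i), b \<union> i, pp q (b \<union> i))) |q b i.
       q \<in> Q \<and> b \<subseteq> out \<and> i \<subseteq> inp}"

text \<open>Letter and priority are dummies here. Winning looks only at closed walks, and a closed
  walk through this position enters it by an edge that really produces this letter and
  priority.\<close>

definition arena_init :: "('q \<times> nat set \<times> nat) + ('q \<times> nat set)" where
  "arena_init = Inl (q0, {}, 0)"

text \<open>One full round, from a position of the output player to the next one: a certificate has
  one transition per round.\<close>

definition two_step :: "('x \<times> 'x) set \<Rightarrow> ('x \<Rightarrow> ('q \<times> nat set \<times> nat) + ('q \<times> nat set)) \<Rightarrow>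
    ('x \<times> 'x) set" where
  "two_step F vt = {(x, z). \<exists>y. (x, y) \<in> F \<and> (y, z) \<in> F \<and> isl (vt x)}"

lemma two_stepE:
  assumes "(x, z) \<in> two_step F vt" "\<forall>x y. (x, y) \<in> F \<longrightarrow> (vt x, vt y) \<in> arena_edges inp out"
  obtains y q a p b i where "(x, y) \<in> F" "(y, z) \<in> F" "vt x = Inl (q, a, p)" "vt y = Inr (q, b)"
    "vt z = Inl (dl q (b \<union> i), b \<union> i, pp q (b \<union> i))" "p \<le> B" "b \<subseteq> out" "i \<subseteq> inp"
proof -
  obtain y where y: "(x, y) \<in> F" "(y, z) \<in> F" "isl (vt x)" using assms(1)
    by (auto simp: two_step_def)
  have 1: "(vt x, vt y) \<in> arena_edges inp out" and 2: "(vt y, vt z) \<in> arena_edges inp out"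
    using assms(2) y by blast+
  from 1 y(3) obtain q a p b where *: "vt x = Inl (q, a, p)" "vt y = Inr (q, b)" "p \<le> B" "b \<subseteq> out"
    by (auto simp: arena_edges_def)
  from 2 * obtain i where "vt z = Inl (dl q (b \<union> i), b \<union> i, pp q (b \<union> i))" "i \<subseteq> inp"
    by (auto simp: arena_edges_def)
  then show ?thesis using that y * by blast
qed

lemma two_step_walk:
  assumes F: "\<forall>x y. (x, y) \<in> F \<longrightarrow> (vt x, vt y) \<in> arena_edges inp out"
    and "walk (two_step F vt) x xs z"
  shows "\<exists>ys. walk F x ys z \<and> (xs \<noteq> [] \<longrightarrow> ys \<noteq> []) \<and>
    sum_list (map (arena_weight inp out w) (map vt ys)) = (\<Sum>x\<leftarrow>xs.
        letter_energy inp out w (fst (snd (projl (vt x))))) \<and>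
    (\<lambda>x. snd (snd (projl (vt x)))) ` set xs \<subseteq> arena_prio ` vt ` set ys \<and>
    arena_prio ` vt ` set ys \<subseteq> insert (B) ((\<lambda>x. snd (snd (projl (vt x)))) ` set xs) \<and>
    (\<lambda>x. snd (snd (projl (vt x)))) ` set xs \<subseteq> {..B}"
  using assms(2)
proof (induction rule: walk.induct)
  case (walk_Nil x)
  show ?case by (rule exI[of _ "[]"]) simp
next
  case (walk_Cons x z xs t)
  from walk_Cons.IH obtain ys where ys: "walk F z ys t" "xs \<noteq> [] \<longrightarrow> ys \<noteq> []"
    "sum_list (map (arena_weight inp out w) (map vt ys)) = (\<Sum>x\<leftarrow>xs.
      letter_energy inp out w (fst (snd (projl (vt x)))))"
    "(\<lambda>x. snd (snd (projl (vt x)))) ` set xs \<subseteq> arena_prio ` vt ` set ys"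
    "arena_prio ` vt ` set ys \<subseteq> insert (B) ((\<lambda>x. snd (snd (projl (vt x)))) ` set xs)"
    "(\<lambda>x. snd (snd (projl (vt x)))) ` set xs \<subseteq> {..B}" by (elim exE conjE) (rule that; assumption)
  obtain y q a p b i where y: "(x, y) \<in> F" "(y, z) \<in> F" "vt x = Inl (q, a, p)" "vt y = Inr (q, b)"
    "p \<le> B"
    by (rule two_stepE[OF walk_Cons.hyps(1) F])
  let ?ys = "x # y # ys"
  have "walk F x ?ys t" using ys(1) y by auto
  moreover have "sum_list (map (arena_weight inp out w) (map vt ?ys)) =
      (\<Sum>x\<leftarrow>x # xs. letter_energy inp out w (fst (snd (projl (vt x)))))"
    using ys(3) y by (simp add: arena_weight_def)
  moreover have "arena_prio (vt x) = p" "arena_prio (vt y) = B" using y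
    by (simp_all add: arena_prio_def)
  moreover have "(\<lambda>x. snd (snd (projl (vt x)))) ` set (x # xs) \<subseteq> arena_prio ` vt ` set ?ys"
    using ys(4) y calculation(3) by auto
  moreover have "arena_prio ` vt ` set ?ys \<subseteq> insert B ((\<lambda>x.
    snd (snd (projl (vt x)))) ` set (x # xs))"
    using ys(5) y calculation(3,4) by auto
  moreover have "(\<lambda>x. snd (snd (projl (vt x)))) ` set (x # xs) \<subseteq> {..B}" using ys(6) y by auto
  ultimately show ?case by (intro exI[of _ ?ys] conjI) (assumption | simp)+
qed

lemma two_step_good:
  assumes F: "\<forall>x y. (x, y) \<in> F \<longrightarrow> (vt x, vt y) \<in> arena_edges inp out"
    and w: "walk (two_step F vt) x xs x" and ne: "xs \<noteq> []"
  obtains ys where "walk F x ys x" "ys \<noteq> []"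
    "good (arena_weight inp out w) (arena_prio) (map vt ys) \<longleftrightarrow>
      0 \<le> (\<Sum>x\<leftarrow>xs. letter_energy inp out w (fst (snd (projl (vt x))))) \<and>
      even (Min ((\<lambda>x. snd (snd (projl (vt x)))) ` set xs))"
proof -
  from two_step_walk[where vt = vt, OF F w, where w = w]
  obtain ys where ys: "walk F x ys x" "xs \<noteq> [] \<longrightarrow> ys \<noteq> []"
    "sum_list (map (arena_weight inp out w) (map vt ys)) = (\<Sum>x\<leftarrow>xs.
      letter_energy inp out w (fst (snd (projl (vt x)))))"
    "(\<lambda>x. snd (snd (projl (vt x)))) ` set xs \<subseteq> arena_prio ` vt ` set ys"
    "arena_prio ` vt ` set ys \<subseteq> insert (B) ((\<lambda>x. snd (snd (projl (vt x)))) ` set xs)"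
    "(\<lambda>x. snd (snd (projl (vt x)))) ` set xs \<subseteq> {..B}"
    by (elim exE conjE) (rule that; assumption)
  let ?A = "(\<lambda>x. snd (snd (projl (vt x)))) ` set xs"
  have A: "finite ?A" "?A \<noteq> {}" using ne by auto
  have "Min (arena_prio ` set (map vt ys)) = Min ?A"
  proof (rule Min_eqI)
    show "Min ?A \<in> arena_prio ` set (map vt ys)" using Min_in[OF A] ys(4) by auto
    fix y assume "y \<in> arena_prio ` set (map vt ys)"
    then have "y = B \<or> y \<in> ?A" using ys(5) by auto
    moreover have "Min ?A \<le> B" using Min_in[OF A] ys(6) by blast
    ultimately show "Min ?A \<le> y" using A(1) by (metis Min_le)
  qed simp
  then show ?thesis using that[OF ys(1)] ys(2,3) ne unfolding good_def by simp
qed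

lemma arena_edges_props:
  assumes "finite inp" "finite out"
  shows "finite (arena_vertices inp out)"
      "arena_edges inp out \<subseteq> arena_vertices inp out \<times> arena_vertices inp out"
    "\<And>u. u \<in> arena_vertices inp out \<Longrightarrow>
      \<exists>v. (u, v) \<in> arena_edges inp out" "arena_init \<in> arena_vertices inp out"
proof -
  show "finite (arena_vertices inp out)" using assms by (simp add: arena_vertices_def finite_Q)
  show "arena_edges inp out \<subseteq> arena_vertices inp out \<times> arena_vertices inp out"
    by (auto simp: arena_edges_def arena_vertices_def intro!: dl_in pp_le)
  show "arena_init \<in> arena_vertices inp out" by (simp add: arena_init_def arena_vertices_def q0_in)
  fix u assume "u \<in> arena_vertices inp out"
  then consider q a p where "u = Inl (q, a, p)" "q \<in> Q" "a \<subseteq> inp \<union> out" "p \<le> B"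
    | q b where "u = Inr (q, b)" "q \<in> Q" "b \<subseteq> out" by (auto simp: arena_vertices_def)
  then show "\<exists>v. (u, v) \<in> arena_edges inp out"
  proof cases
    case 1
    then have "(u, Inr (q, {})) \<in> arena_edges inp out" by (auto simp: arena_edges_def)
    then show ?thesis ..
  next
    case 2
    then have "(u, Inl (dl q (b \<union> {}), b \<union> {}, pp q (b \<union> {}))) \<in> arena_edges inp out"
      unfolding arena_edges_def by blast
    then show ?thesis ..
  qed
qed

lemma two_step_follows:
  assumes F: "\<forall>x y. (x, y) \<in> F \<longrightarrow> (vt x, vt y) \<in> arena_edges inp out" and "(x, z) \<in> two_step F vt"
  shows "follows (projl (vt x)) (projl (vt z))"
proof -
  obtain y q a p b i where "vt x = Inl (q, a, p)" "vt z = Inl (dl q (b \<union> i), b \<union> i, pp q (b \<union> i))"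
    by (rule two_stepE[where vt = vt, OF assms(2) F])
  then show ?thesis by (simp add: follows_def)
qed

lemma tableau_product_proj:
  "walk (tableau_product N H lab) v cs v' \<Longrightarrow> walk H (fst v) (map fst cs) (fst v')"
  by (rule walk_image[where f = fst]) (auto simp: tableau_product_def)

text \<open>The machine consists of the output positions of the strategy graph. Its closed walks
  have even least priority, so by \<open>tableau_product_cycle\<close> no accepting cycle of the
  product is reachable from a guess without \<open>N\<close>, and the cycle condition for the
  measure holds vacuously. The nonnegative weight of the closed walks gives the potential behind
  \<open>e\<close>.\<close>

lemma pos_cert_exists:
  assumes fin: "finite inp" "finite out"
    and win: "win1 (range Inr) (arena_weight inp out w) (arena_prio)
        (arena_edges inp out) arena_init"
  shows "\<exists>(S::nat set) m0 e \<kappa> \<pi> C. finite S \<and> pos_cert inp out w N S m0 e \<kappa> \<pi> C"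
proof -
  obtain X F vt x0 where SG: "strategy_graph (range Inr) (arena_weight inp out w) (arena_prio)
    (arena_edges inp out) X F vt"
    and x0: "x0 \<in> X" "vt x0 = arena_init" using win unfolding win1_def by blast
  have finX: "finite X" and FX: "F \<subseteq> X \<times> X"
    and F: "\<forall>x y. (x, y) \<in> F \<longrightarrow> (vt x, vt y) \<in> arena_edges inp out"
    and T: "\<And>x. x \<in> X \<Longrightarrow> \<exists>y. (x, y) \<in> F"
    and C: "\<And>x u. x \<in> X \<Longrightarrow> vt x \<in> range Inr \<Longrightarrow> (vt x, u) \<in> arena_edges inp out \<Longrightarrow>
        \<exists>y. (x, y) \<in> F \<and> vt y = u"
    and G: "\<And>x xs. xs \<noteq> [] \<Longrightarrow> walk F x xs x \<Longrightarrow> good (arena_weight inp out w) (arena_prio) (map vt xs)"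
    using SG unfolding strategy_graph_def by simp_all
  define S where "S = {x \<in> X. isl (vt x)}"
  define H where "H = two_step F vt"
  define lab where "lab x = projl (vt x)" for x
  have finS: "finite S" using finX by (simp add: S_def)
  have x0S: "x0 \<in> S" using x0 by (simp add: S_def arena_init_def)
  have HS: "H \<subseteq> S \<times> S"
  proof
    fix e assume "e \<in> H"
    then obtain x z where e: "e = (x, z)" "(x, z) \<in> two_step F vt" by (cases e) (auto simp: H_def)
    show "e \<in> S \<times> S" by (rule two_stepE[OF e(2) F]) (use e(1) FX in \<open>auto simp: S_def\<close>)
  qed
  have Hf: "follows (lab x) (lab z)" if "(x, z) \<in> H" for x z
    using two_step_follows[where vt = vt, OF F] that by (simp add: H_def lab_def)
  have l0: "fst (lab x0) = q0" using x0 by (simp add: lab_def arena_init_def)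
  have Hgood: "0 \<le> (\<Sum>x\<leftarrow>xs. letter_energy inp out w (fst (snd (lab x)))) \<and>
      even (Min ((\<lambda>x. snd (snd (lab x))) ` set xs))" if xs: "walk H x xs x" "xs \<noteq> []" for x xs
  proof -
    obtain ys where "walk F x ys x" "ys \<noteq> []"
      "good (arena_weight inp out w) (arena_prio) (map vt ys) \<longleftrightarrow>
        0 \<le> (\<Sum>x\<leftarrow>xs. letter_energy inp out w (fst (snd (projl (vt x))))) \<and>
        even (Min ((\<lambda>x. snd (snd (projl (vt x)))) ` set xs))"
      by (rule two_step_good[where vt = vt, OF F xs(1)[unfolded H_def] xs(2)])
    then show ?thesis using G by (simp add: lab_def)
  qed
  define \<omega> where "\<omega> x = letter_energy inp out w (fst (snd (lab x)))" for x
  have "sum_list (map (\<lambda>x. - \<omega> x) xs) \<le> 0" if "walk H x xs x" "xs \<noteq> []" for x xs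
    using Hgood[OF that] by (simp add: \<omega>_def uminus_sum_list_map[symmetric, unfolded comp_def])
  then obtain \<eta> :: "nat \<Rightarrow> int" where \<eta>: "\<And>x y. (x, y) \<in> H \<Longrightarrow> \<eta> y + - \<omega> x \<le> \<eta> x"
    using potential_exists[OF finS HS, of "\<lambda>x. - \<omega> x"] by metis
  obtain D where D: "\<And>x. x \<in> S \<Longrightarrow> 0 \<le> (\<eta> x + \<omega> x) + D"
    using finite_nonneg_shift[OF finS, of "\<lambda>x. \<eta> x + \<omega> x"] by blast
  \<comment> \<open>The potential for the negated weights charges the source of an edge; adding
    \<open>\<omega> x\<close> moves the charge to the letter read on the edge, as the certificate
    demands.\<close>
  define e where "e x = nat (\<eta> x + \<omega> x + D)" for x
  have e: "int (e z) \<le> int (e x) + \<omega> z" if "(x, z) \<in> H" for x z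
    using that HS \<eta>[OF that] D[of x] D[of z] by (auto simp: e_def)
  have neg: False if "A0 \<subseteq> {..N}" "N \<notin> A0" "walk (tableau_product N H lab) (x0, A0, 0) ss v"
      "walk (tableau_product N H lab) v cs v" "\<exists>(x, A, j)\<in>set cs. accepting N A j" for A0 ss v cs
  proof -
    have "odd (Min ((\<lambda>(x, _). snd (snd (lab x))) ` set cs))"
      using tableau_product_cycle[where lab = lab, OF Hf l0 that(3-5)] that(2) by blast
    moreover have "(\<lambda>(x,
      _). snd (snd (lab x))) ` set cs = (\<lambda>x. snd (snd (lab x))) ` set (map fst cs)"
      by (force simp: split_beta)
    moreover have "walk H (fst v) (map fst cs) (fst v)" by (rule tableau_product_proj[OF that(4)])
    moreover have "map fst cs \<noteq> []" using that(5) by auto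
    ultimately show False using Hgood by metis
  qed
  obtain \<kappa> \<pi> :: "nat \<Rightarrow> nat set \<Rightarrow> nat \<Rightarrow> nat" and K where K: "0 < K"
    "\<And>A. A \<subseteq> {..N} \<Longrightarrow> N \<notin> A \<Longrightarrow> 0 < \<kappa> x0 A 0"
    "\<And>m m'. (m, m') \<in> H \<Longrightarrow> measure_step N \<kappa> \<pi> K 0 m m' (fst (snd (lab m')))"
    by (rule measure_step_exists[OF finS HS x0S, of N "\<lambda>A. N \<notin> A" lab "\<lambda>_. 0"]) (use neg in blast)+
  have "\<exists>a\<subseteq>out. \<forall>i\<subseteq>inp. \<exists>m'\<in>S.
      int (e m') \<le> int (e m) + letter_energy inp out w (a \<union> i) \<and>
          measure_step N \<kappa> \<pi> K 0 m m' (a \<union> i)" if m: "m \<in> S" for m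
  proof -
    obtain y where y: "(m, y) \<in> F" using T m by (auto simp: S_def)
    obtain q a p b where my: "vt m = Inl (q, a, p)" "vt y = Inr (q, b)" "b \<subseteq> out" "q \<in> Q"
      using F[rule_format, OF y] m by (auto simp: arena_edges_def S_def)
    have "\<exists>m'\<in>S. int (e m') \<le> int (e m) + letter_energy inp out w (b \<union> i) \<and>
      measure_step N \<kappa> \<pi> K 0 m m' (b \<union> i)"
      if i: "i \<subseteq> inp" for i
    proof -
      let ?l = "(dl q (b \<union> i), b \<union> i, pp q (b \<union> i))"
      have "(vt y, Inl ?l) \<in> arena_edges inp out" unfolding my arena_edges_def using my i by blast
      moreover have "y \<in> X" "vt y \<in> range Inr" using y FX my by auto
      ultimately obtain z where z: "(y, z) \<in> F" "vt z = Inl ?l" using C by blast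
      have mz: "(m, z) \<in> H" unfolding H_def two_step_def using y z m by (auto simp: S_def)
      then have "z \<in> S" using HS by blast
      then show ?thesis using e[OF mz] K(3)[OF mz] z(2) by (auto simp: \<omega>_def lab_def)
    qed
    then show ?thesis using my(3) by blast
  qed
  then have "pos_cert inp out w N S x0 e \<kappa> \<pi> K" unfolding pos_cert_def using x0S K by blast
  then show ?thesis using finS by blast
qed

text \<open>The spoiler is positional, so positions of the arena are the states. An accepting cycle
  reachable from a guess with \<open>N\<close> has even least priority; since cycles of the spoiler
  are not good, its weight is negative, as the measure demands.\<close>

lemma neg_cert_exists:
  assumes fin: "finite inp" "finite out"
    and win: "win2 (range Inr) (arena_weight inp out w) (arena_prio) (arena_vertices inp out)
        (arena_edges inp out) arena_init"
  shows "\<exists>(S::(('q \<times> nat set \<times> nat) + ('q \<times> nat set)) set) m0 \<kappa> \<pi> C. finite S \<and>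
      neg_cert inp out w N S m0 \<kappa> \<pi> C"
proof -
  obtain E' where SG: "spoiler_graph (range Inr) (arena_weight inp out w) (arena_prio)
    (arena_vertices inp out) (arena_edges inp out) arena_init E'"
    using win unfolding win2_def by blast
  have E': "E' \<subseteq> arena_edges inp out" "\<forall>(u, v)\<in>arena_edges inp out. u \<notin> range Inr \<longrightarrow> (u, v) \<in> E'"
    "\<forall>u\<in>arena_vertices inp out. \<exists>v. (u, v) \<in> E'"
    and bad: "\<And>x xs. (arena_init, x) \<in> E'\<^sup>* \<Longrightarrow> xs \<noteq> [] \<Longrightarrow> walk E' x xs x \<Longrightarrow>
        \<not> good (arena_weight inp out w) (arena_prio) xs"
    using SG unfolding spoiler_graph_def by simp_all
  note props = arena_edges_props[OF fin]
  define R where "R = E'\<^sup>* `` {arena_init}"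
  define S where "S = {x \<in> R. isl x}"
  define F where "F = {(x, y) \<in> E'. x \<in> R}"
  define H where "H = two_step F id"
  have FE: "\<forall>x y. (x, y) \<in> F \<longrightarrow> (id x, id y) \<in> arena_edges inp out" using E'(1) by (auto simp: F_def)
  have FR: "F \<subseteq> R \<times> R" by (auto simp: F_def R_def intro: rtrancl_into_rtrancl)
  have RV: "R \<subseteq> arena_vertices inp out"
  proof
    fix x assume "x \<in> R"
    then have "(arena_init, x) \<in> E'\<^sup>*" by (simp add: R_def)
    then show "x \<in> arena_vertices inp out"
      by (induction rule: rtrancl_induct) (use props E'(1) in auto)
  qed
  have finS: "finite S" using finite_subset[OF RV props(1)] by (simp add: S_def)
  have x0S: "arena_init \<in> S" by (simp add: S_def R_def arena_init_def)
  have HS: "H \<subseteq> S \<times> S"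
  proof
    fix e assume "e \<in> H"
    then obtain x z where e: "e = (x, z)" "(x, z) \<in> two_step F id" by (cases e) (auto simp: H_def)
    show "e \<in> S \<times> S" by (rule two_stepE[OF e(2) FE]) (use e(1) FR in \<open>auto simp: S_def\<close>)
  qed
  have Hf: "follows (projl x) (projl z)" if "(x, z) \<in> H" for x z
    using two_step_follows[where vt = id, OF FE] that by (simp add: H_def)
  have l0: "fst (projl arena_init) = q0" by (simp add: arena_init_def)
  define \<omega> where "\<omega> x = letter_energy inp out w (fst (snd (projl x)))"
    for x :: "('q \<times> nat set \<times> nat) + ('q \<times> nat set)"
  have neg: "(\<Sum>(x, _)\<leftarrow>cs. \<omega> x) < 0" if "A0 \<subseteq> {..N}" "N \<in> A0"
      "walk (tableau_product N H projl) (arena_init, A0, 0) ss v"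
      "walk (tableau_product N H projl) v cs v" "\<exists>(x, A, j)\<in>set cs. accepting N A j" for A0 ss v cs
  proof -
    have "even (Min ((\<lambda>(x, _). snd (snd (projl x))) ` set cs))"
      using tableau_product_cycle[where lab = projl, OF Hf l0 that(3-5)] that(2) by blast
    moreover have "(\<lambda>(x,
      _). snd (snd (projl x))) ` set cs = (\<lambda>x. snd (snd (projl x))) ` set (map fst cs)"
      by (force simp: split_beta)
    ultimately have ev: "even (Min ((\<lambda>x. snd (snd (projl x))) ` set (map fst cs)))" by metis
    have w: "walk H (fst v) (map fst cs) (fst v)" by (rule tableau_product_proj[OF that(4)])
    have ne: "map fst cs \<noteq> []" using that(5) by auto
    obtain ys where ys: "walk F (fst v) ys (fst v)" "ys \<noteq> []"
      "good (arena_weight inp out w) (arena_prio) (map id ys) \<longleftrightarrow>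
        0 \<le> (\<Sum>x\<leftarrow>map fst cs. letter_energy inp out w (fst (snd (projl (id x))))) \<and>
        even (Min ((\<lambda>x. snd (snd (projl (id x)))) ` set (map fst cs)))"
      by (rule two_step_good[where vt = id, OF FE w[unfolded H_def] ne])
    have "fst v \<in> R" using ys(1,2) by (cases ys) (auto simp: F_def)
    then have r: "(arena_init, fst v) \<in> E'\<^sup>*" by (simp add: R_def)
    have "walk E' (fst v) ys (fst v)" using ys(1) by (rule walk_mono) (auto simp: F_def)
    then have "\<not> good (arena_weight inp out w) (arena_prio) ys" using bad[OF r ys(2)] by blast
    then have "(\<Sum>x\<leftarrow>map fst cs. \<omega> x) < 0" using ys(3) ev by (simp add: \<omega>_def)
    moreover have "(\<lambda>(x, _). \<omega> x) = \<omega> \<circ> (fst :: _ \<times> nat set \<times> nat \<Rightarrow> _)" by auto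
    ultimately show ?thesis by simp
  qed
  obtain \<kappa> \<pi> :: "('q \<times> nat set \<times> nat) + ('q \<times> nat set) \<Rightarrow> nat set \<Rightarrow> nat \<Rightarrow> nat" and K where K: "0 < K"
    "\<And>A. A \<subseteq> {..N} \<Longrightarrow> N \<in> A \<Longrightarrow> 0 < \<kappa> arena_init A 0"
    "\<And>m m'. (m, m') \<in> H \<Longrightarrow> measure_step N \<kappa> \<pi> K (\<omega> m') m m' (fst (snd (projl m')))"
    by (rule measure_step_exists[OF finS HS x0S, of N "\<lambda>A. N \<in> A" projl \<omega>]) (use neg in blast)+
  have "\<exists>i\<subseteq>inp. \<exists>m'\<in>S. measure_step N \<kappa> \<pi> K (letter_energy inp out w (a \<union> i)) m m' (a \<union> i)"
    if m: "m \<in> S" and a: "a \<subseteq> out" for m a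
  proof -
    obtain q c p where mq: "m = Inl (q, c, p)" "q \<in> Q" "c \<subseteq> inp \<union> out" "p \<le> B"
      using m RV by (auto simp: S_def arena_vertices_def)
    have "(m, Inr (q, a)) \<in> arena_edges inp out" using mq a by (auto simp: arena_edges_def)
    then have "(m, Inr (q, a)) \<in> E'" using E'(2) mq(1) by blast
    then have f1: "(m, Inr (q, a)) \<in> F" using m by (simp add: F_def S_def)
    then have "Inr (q, a) \<in> R" using FR by blast
    then obtain z where "(Inr (q, a), z) \<in> E'" using E'(3) RV by blast
    then have f2: "(Inr (q, a), z) \<in> F" using \<open>Inr (q, a) \<in> R\<close> by (simp add: F_def)
    obtain i where i: "i \<subseteq> inp" "z = Inl (dl q (a \<union> i), a \<union> i, pp q (a \<union> i))"
      using FE[rule_format, OF f2] by (auto simp: arena_edges_def)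
    have mz: "(m, z) \<in> H" unfolding H_def two_step_def using f1 f2 mq(1) by auto
    then have "z \<in> S" using HS by blast
    moreover have "measure_step N \<kappa> \<pi> K (letter_energy inp out w (a \<union> i)) m z (a \<union> i)"
      using K(3)[OF mz] i(2) by (simp add: \<omega>_def)
    ultimately show ?thesis using i(1) by blast
  qed
  then have "neg_cert inp out w N S arena_init \<kappa> \<pi> K" unfolding neg_cert_def using x0S K by blast
  then show ?thesis using finS by blast
qed

lemma cert_exists:
  assumes "finite inp" "finite out"
  shows "(\<exists>(S::nat set) m0 e \<kappa> \<pi> C. finite S \<and> pos_cert inp out w N S m0 e \<kappa> \<pi> C) \<or>
    (\<exists>(S::(('q \<times> nat set \<times> nat) + ('q \<times> nat set)) set) m0 \<kappa> \<pi> C. finite S \<and>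
        neg_cert inp out w N S m0 \<kappa> \<pi> C)"
proof -
  have "win1 (range Inr) (arena_weight inp out w) arena_prio (arena_edges inp out) arena_init \<or>
      win2 (range Inr) (arena_weight inp out w) arena_prio (arena_vertices inp out)
          (arena_edges inp out) arena_init"
    by (rule win1_or_win2) (use arena_edges_props[OF assms] in auto)
  then show ?thesis using pos_cert_exists[OF assms, of w] neg_cert_exists[OF assms, of w] by argo
qed

end

section \<open>Recursive functions\<close>

text \<open>The closure of \<open>recursive\<close> under agreement on lists of length
  \<open>n\<close>. Functions can then be written in their natural form, which may differ from
  Kleene's on lists of other lengths.\<close>

definition recf :: "nat \<Rightarrow> (nat list \<Rightarrow> nat) \<Rightarrow> bool" where
  "recf n F \<longleftrightarrow> (\<exists>g. recursive n g \<and> (\<forall>xs. length xs = n \<longrightarrow> F xs = g xs))"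

definition decp :: "nat \<Rightarrow> (nat list \<Rightarrow> bool) \<Rightarrow> bool" where
  "decp n P \<longleftrightarrow> recf n (\<lambda>xs. of_bool (P xs))"

lemma recursive_recf: "recursive n g \<Longrightarrow> recf n g"
  by (auto simp: recf_def)

lemma recf_cong: "recf n F \<Longrightarrow> (\<And>xs. length xs = n \<Longrightarrow> F xs = G xs) \<Longrightarrow> recf n G"
  unfolding recf_def by metis

lemma recf_comp:
  assumes "recf (length as) F" "\<And>a. a \<in> set as \<Longrightarrow> recf n a"
  shows "recf n (\<lambda>xs. F (map (\<lambda>a. a xs) as))"
proof -
  obtain g where g: "recursive (length as) g" "\<And>xs. length xs = length as \<Longrightarrow> F xs = g xs"
    using assms(1) by (auto simp: recf_def)
  have "\<forall>a\<in>set as. \<exists>b. recursive n b \<and> (\<forall>xs. length xs = n \<longrightarrow> a xs = b xs)"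
    using assms(2) by (auto simp: recf_def)
  then obtain c where c: "\<And>a. a \<in> set as \<Longrightarrow> recursive n (c a)"
    "\<And>a xs. a \<in> set as \<Longrightarrow> length xs = n \<Longrightarrow> a xs = c a xs" by metis
  have "recursive n (\<lambda>xs. g (map (\<lambda>f. f xs) (map c as)))"
    by (rule recursive.comp) (use g(1) c(1) in auto)
  moreover have "F (map (\<lambda>a. a xs) as) = g (map (\<lambda>f. f xs) (map c as))" if "length xs = n" for xs
    using g(2) c(2) that by (simp cong: map_cong)
  ultimately show ?thesis unfolding recf_def by blast
qed

lemma recf_nth: "i < n \<Longrightarrow> recf n (\<lambda>xs. xs ! i)"
  by (rule recursive_recf) (rule recursive.proj)

lemma nth_funpow_tl: "k \<le> length xs \<Longrightarrow> (tl ^^ k) xs = drop k xs"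
  by (induction k) (auto simp: drop_Suc tl_drop)

lemma recf_tl_nth: "k + i < n \<Longrightarrow> recf n (\<lambda>xs. (tl ^^ k) xs ! i)"
  by (rule recf_cong[OF recf_nth[of "k + i"]]) (auto simp: nth_funpow_tl)

lemma recf_tl_hd: "k < n \<Longrightarrow> recf n (\<lambda>xs. hd ((tl ^^ k) xs))"
  by (rule recf_cong[OF recf_nth[of k]]) (auto simp: nth_funpow_tl hd_drop_conv_nth)

lemma recf_comp1: "recf 1 (\<lambda>xs. f (xs ! 0)) \<Longrightarrow> recf n a \<Longrightarrow> recf n (\<lambda>xs. f (a xs))"
  using recf_comp[of "[a]" "\<lambda>xs. f (xs ! 0)" n] by simp

lemma recf_comp2: "recf 2 (\<lambda>xs. f (xs ! 0) (xs ! 1)) \<Longrightarrow> recf n a \<Longrightarrow> recf n b \<Longrightarrow>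
    recf n (\<lambda>xs. f (a xs) (b xs))"
  using recf_comp[of "[a, b]" "\<lambda>xs. f (xs ! 0) (xs ! 1)" n] by (auto simp: numeral_2_eq_2)

lemma recf_Suc: "recf n a \<Longrightarrow> recf n (\<lambda>xs. Suc (a xs))"
proof (erule recf_comp1[where f = Suc, rotated])
  show "recf 1 (\<lambda>xs. Suc (xs ! 0))"
    by (rule recf_cong[OF recursive_recf[OF recursive.succ]]) (auto simp: length_Suc_conv)
qed

lemma recf_const: "recf n (\<lambda>_. k)"
proof (induction k)
  case 0 show ?case by (rule recursive_recf) (rule recursive.zero)
next
  case (Suc k) then show ?case by (rule recf_Suc)
qed

text \<open>Kleene's scheme recurses on the first argument. Substituting \<open>b\<close> for it,
  with the parameters copied behind, allows an arbitrary recursive bound.\<close>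

lemma recf_rec:
  assumes "recf n g" "recf (Suc (Suc n)) (\<lambda>zs. h (zs ! 0) (zs ! 1) (tl (tl zs)))" "recf n b"
  shows "recf n (\<lambda>xs. rec_nat (g xs) (\<lambda>k r. h k r xs) (b xs))"
proof -
  obtain g' where g': "recursive n g'" "\<And>xs. length xs = n \<Longrightarrow> g xs = g' xs"
    using assms(1) by (auto simp: recf_def)
  obtain h' where h': "recursive (Suc (Suc n)) h'"
    "\<And>zs. length zs = Suc (Suc n) \<Longrightarrow> h (zs ! 0) (zs ! 1) (tl (tl zs)) = h' zs"
    using assms(2) by (auto simp: recf_def)
  let ?R = "\<lambda>xs. rec_nat (g' (tl xs)) (\<lambda>k r. h' (k # r # tl xs)) (hd xs)"
  have R: "recf (Suc n) ?R" by (rule recursive_recf) (rule recursive.prim_rec[OF g'(1) h'(1)])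
  let ?as = "b # map (\<lambda>i xs. xs ! i) [0..<n]"
  have "recf n (\<lambda>xs. ?R (map (\<lambda>a. a xs) ?as))"
    by (rule recf_comp) (use R assms(3) in \<open>auto intro: recf_nth\<close>)
  then show ?thesis
  proof (rule recf_cong)
    fix xs :: "nat list" assume xs: "length xs = n"
    then have m: "map (\<lambda>a. a xs) ?as = b xs # xs" by (auto intro: nth_equalityI)
    have "rec_nat (g' xs) (\<lambda>k r. h' (k # r # xs)) m = rec_nat (g xs) (\<lambda>k r. h k r xs) m" for m
    proof (induction m)
      case (Suc m)
      have "h m (rec_nat (g xs) (\<lambda>k r. h k r xs) m) xs = h' (m # rec_nat (g xs) (\<lambda>k r.
        h k r xs) m # xs)"
        using h'(2)[of "m # rec_nat (g xs) (\<lambda>k r. h k r xs) m # xs"] xs by simp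
      then show ?case using Suc by simp
    qed (use g'(2) xs in simp)
    then show "?R (map (\<lambda>a. a xs) ?as) = rec_nat (g xs) (\<lambda>k r. h k r xs) (b xs)" unfolding m by simp
  qed
qed

lemma recf_add: "recf n a \<Longrightarrow> recf n b \<Longrightarrow> recf n (\<lambda>xs. a xs + b xs)"
proof (erule (1) recf_comp2[where f = "(+)", rotated])
  have "recf 2 (\<lambda>xs. rec_nat (xs ! 1) (\<lambda>k r. Suc r) (xs ! 0))"
    by (rule recf_rec) (intro recf_Suc recf_nth; simp)+
  moreover have "rec_nat y (\<lambda>k r. Suc r) x = x + y" for x y :: nat by (induction x) auto
  ultimately show "recf 2 (\<lambda>xs. xs ! 0 + xs ! 1)" by simp
qed

lemma recf_mult: "recf n a \<Longrightarrow> recf n b \<Longrightarrow> recf n (\<lambda>xs. a xs * b xs)"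
proof (erule (1) recf_comp2[where f = "(*)", rotated])
  have "recf (Suc (Suc 2)) (\<lambda>zs. tl (tl zs) ! 1)" using recf_tl_nth[of 2 1 4]
    by (simp add: numeral_eq_Suc)
  then have "recf 2 (\<lambda>xs. rec_nat 0 (\<lambda>k r. r + xs ! 1) (xs ! 0))"
    by (intro recf_rec recf_const recf_add recf_nth) simp_all
  moreover have "rec_nat 0 (\<lambda>k r. r + y) x = x * y" for x y :: nat by (induction x) auto
  ultimately show "recf 2 (\<lambda>xs. xs ! 0 * xs ! 1)" by simp
qed

lemma recf_diff: "recf n a \<Longrightarrow> recf n b \<Longrightarrow> recf n (\<lambda>xs. a xs - b xs)"
proof (erule (1) recf_comp2[where f = "(-)", rotated])
  have "recf 1 (\<lambda>xs. rec_nat 0 (\<lambda>k r. k) (xs ! 0))"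
    by (intro recf_rec recf_const recf_nth) simp_all
  moreover have "rec_nat 0 (\<lambda>k r. k) x = x - 1" for x :: nat by (cases x) auto
  ultimately have p: "recf 1 (\<lambda>xs. xs ! 0 - 1)" by simp
  have "recf 2 (\<lambda>xs. rec_nat (xs ! 0) (\<lambda>k r. r - 1) (xs ! 1))"
    by (intro recf_rec recf_nth recf_comp1[OF p]) simp_all
  moreover have "rec_nat x (\<lambda>k r. r - 1) y = x - y" for x y :: nat by (induction y) auto
  ultimately show "recf 2 (\<lambda>xs. xs ! 0 - xs ! 1)" by simp
qed

section \<open>Decidable predicates\<close>

lemma decp_cong: "decp n P \<Longrightarrow> (\<And>xs. length xs = n \<Longrightarrow> P xs = Q xs) \<Longrightarrow> decp n Q"
  unfolding decp_def by (erule recf_cong) simp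

lemma recf_of_bool: "decp n P \<Longrightarrow> recf n (\<lambda>xs. of_bool (P xs))"
  by (simp add: decp_def)

lemma decp_zero:
  assumes "recf n a" shows "decp n (\<lambda>xs. a xs = 0)"
proof -
  have "recf n (\<lambda>xs. 1 - a xs)" by (intro recf_diff recf_const assms)
  then show ?thesis unfolding decp_def by (rule recf_cong) simp
qed

lemma decp_not:
  assumes "decp n P" shows "decp n (\<lambda>xs. \<not> P xs)"
  using decp_zero[OF recf_of_bool[OF assms]] by simp

lemma decp_conj:
  assumes "decp n P" "decp n Q" shows "decp n (\<lambda>xs. P xs \<and> Q xs)"
  unfolding decp_def of_bool_conj using assms by (intro recf_mult) (simp_all add: decp_def)

lemma decp_disj:
  assumes "decp n P" "decp n Q" shows "decp n (\<lambda>xs. P xs \<or> Q xs)"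
  using decp_not[OF decp_conj[OF decp_not[OF assms(1)] decp_not[OF assms(2)]]] by simp

lemma decp_imp:
  assumes "decp n P" "decp n Q" shows "decp n (\<lambda>xs. P xs \<longrightarrow> Q xs)"
  using decp_disj[OF decp_not[OF assms(1)] assms(2)] unfolding imp_conv_disj .

lemma decp_iff:
  assumes "decp n P" "decp n Q" shows "decp n (\<lambda>xs. P xs \<longleftrightarrow> Q xs)"
  using decp_conj[OF decp_imp[OF assms] decp_imp[OF assms(2,1)]] by (rule decp_cong) blast

lemma decp_le:
  assumes "recf n a" "recf n b" shows "decp n (\<lambda>xs. a xs \<le> b xs)"
  using decp_zero[OF recf_diff[OF assms]] by (rule decp_cong) simp

lemma decp_less:
  assumes "recf n a" "recf n b" shows "decp n (\<lambda>xs. a xs < b xs)"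
  using decp_le[OF recf_Suc[OF assms(1)] assms(2)] by (rule decp_cong) (simp add: Suc_le_eq)

lemma decp_eq:
  assumes "recf n a" "recf n b" shows "decp n (\<lambda>xs. a xs = b xs)"
  using decp_conj[OF decp_le[OF assms] decp_le[OF assms(2,1)]] by (rule decp_cong) auto

lemma recf_if:
  assumes "decp n P" "recf n a" "recf n b"
  shows "recf n (\<lambda>xs. if P xs then a xs else b xs)"
proof -
  have "recf n (\<lambda>xs. of_bool (P xs) * a xs + of_bool (\<not> P xs) * b xs)"
    by (intro recf_add recf_mult recf_of_bool decp_not assms)
  then show ?thesis by (rule recf_cong) simp
qed

lemma decp_if:
  assumes "decp n P" "decp n Q" "decp n R"
  shows "decp n (\<lambda>xs. if P xs then Q xs else R xs)"
  using decp_conj[OF decp_imp[OF assms(1,2)] decp_imp[OF decp_not[OF assms(1)] assms(3)]]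
  by (rule decp_cong) simp

lemma recf_drop1:
  assumes "recf (Suc n) F" shows "recf (Suc (Suc n)) (\<lambda>zs. F (zs ! 0 # tl (tl zs)))"
proof -
  let ?as = "(\<lambda>xs. xs ! 0) # map (\<lambda>i xs. xs ! Suc (Suc i)) [0..<n]"
  have "recf (Suc (Suc n)) (\<lambda>xs. F (map (\<lambda>a. a xs) ?as))"
    by (rule recf_comp) (use assms in \<open>auto intro: recf_nth\<close>)
  then show ?thesis
  proof (rule recf_cong)
    fix zs :: "nat list" assume "length zs = Suc (Suc n)"
    then have "map (\<lambda>a. a zs) ?as = zs ! 0 # tl (tl zs)"
      by (auto intro!: nth_equalityI simp: nth_tl)
    then show "F (map (\<lambda>a. a zs) ?as) = F (zs ! 0 # tl (tl zs))" by simp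
  qed
qed

lemma recf_sum:
  assumes "recf n b" "recf (Suc n) (\<lambda>ys. f (hd ys) (tl ys))"
  shows "recf n (\<lambda>xs. \<Sum>k<b xs. f k xs)"
proof -
  have "recf (Suc (Suc n)) (\<lambda>zs. f (zs ! 0) (tl (tl zs)))" using recf_drop1[OF assms(2)] by simp
  then have "recf n (\<lambda>xs. rec_nat 0 (\<lambda>k r. r + f k xs) (b xs))"
    by (intro recf_rec recf_const recf_add recf_nth assms(1)) simp_all
  moreover have "rec_nat 0 (\<lambda>k r. r + f k xs) m = (\<Sum>k<m. f k xs)" for m xs by (induction m) auto
  ultimately show ?thesis by simp
qed

text \<open>A bounded universal statement holds iff the number of its counterexamples is
  zero.\<close>

lemma decp_all:
  assumes "recf n b" "decp (Suc n) (\<lambda>ys. P (hd ys) (tl ys))"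
  shows "decp n (\<lambda>xs. \<forall>k<b xs. P k xs)"
proof -
  have "recf n (\<lambda>xs. \<Sum>k<b xs. of_bool (\<not> P k xs))"
    by (rule recf_sum[OF assms(1)]) (rule recf_of_bool[OF decp_not[OF assms(2)]])
  from decp_zero[OF this] show ?thesis by (rule decp_cong) auto
qed

lemma decp_ex:
  assumes "recf n b" "decp (Suc n) (\<lambda>ys. P (hd ys) (tl ys))"
  shows "decp n (\<lambda>xs. \<exists>k<b xs. P k xs)"
  using decp_not[OF decp_all[OF assms(1) decp_not[OF assms(2)]]] by simp

lemma recf_Least:
  assumes "decp (Suc n) (\<lambda>ys. P (hd ys) (tl ys))" "\<And>xs. length xs = n \<Longrightarrow> \<exists>k. P k xs"
  shows "recf n (\<lambda>xs. LEAST k. P k xs)"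
proof -
  from decp_not[OF assms(1)] obtain g where g: "recursive (Suc n) g"
    "\<And>ys. length ys = Suc n \<Longrightarrow> of_bool (\<not> P (hd ys) (tl ys)) = g ys"
    unfolding decp_def recf_def by blast
  have eq: "g (k # xs) = 0 \<longleftrightarrow> P k xs" if "length xs = n" for k xs
    using g(2)[of "k # xs"] that by (auto split: if_splits)
  have "recursive n (\<lambda>xs. LEAST k. g (k # xs) = 0)"
    by (rule recursive.minimise[OF g(1)]) (use eq assms(2) in auto)
  then show ?thesis by (rule recf_cong[OF recursive_recf]) (simp add: eq)
qed

text \<open>Variables are handled in de Bruijn style: every bounded quantifier or sum puts its
  variable in front of the argument list, so outer variables appear behind iterated
  \<open>tl\<close>. The depth suffices for the nested quantifiers of the certificate
  checks.\<close>

lemmas recf_vars =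
  recf_nth
  recf_tl_nth[of "Suc 0", simplified] recf_tl_hd[of 0, simplified]
  recf_tl_nth[of "Suc (Suc 0)", simplified] recf_tl_hd[of "Suc 0", simplified]
  recf_tl_nth[of "Suc (Suc (Suc 0))", simplified] recf_tl_hd[of "Suc (Suc 0)", simplified]
  recf_tl_nth[of "Suc (Suc (Suc (Suc 0)))", simplified] recf_tl_hd[of "Suc (Suc (Suc 0))",
      simplified]
  recf_tl_nth[of "Suc (Suc (Suc (Suc (Suc 0))))", simplified]
  recf_tl_hd[of "Suc (Suc (Suc (Suc 0)))", simplified]
  recf_tl_nth[of "Suc (Suc (Suc (Suc (Suc (Suc 0)))))", simplified]
  recf_tl_hd[of "Suc (Suc (Suc (Suc (Suc 0))))", simplified]
  recf_tl_nth[of "Suc (Suc (Suc (Suc (Suc (Suc (Suc 0))))))", simplified]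
  recf_tl_hd[of "Suc (Suc (Suc (Suc (Suc (Suc 0)))))", simplified]
  recf_tl_nth[of "Suc (Suc (Suc (Suc (Suc (Suc (Suc (Suc 0)))))))", simplified]
  recf_tl_hd[of "Suc (Suc (Suc (Suc (Suc (Suc (Suc 0))))))", simplified]

lemmas recf_arith = recf_const recf_Suc recf_add recf_mult recf_diff recf_of_bool recf_if recf_sum
  decp_not decp_conj decp_disj decp_imp decp_iff decp_le decp_less decp_eq decp_if decp_all decp_ex

lemma recf_div:
  assumes "recf n a" "recf n b" "\<And>xs. length xs = n \<Longrightarrow> 0 < b xs"
  shows "recf n (\<lambda>xs. a xs div b xs)"
proof -
  \<comment> \<open>Minimisation has to succeed for all arguments, also for divisor
    \<open>0\<close>; so the divisor is represented by its predecessor.\<close>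
  have "recf 2 (\<lambda>xs. LEAST q. xs ! 0 < Suc q * Suc (xs ! 1))"
  proof (rule recf_Least)
    show "decp (Suc 2) (\<lambda>ys. tl ys ! 0 < Suc (hd ys) * Suc (tl ys ! 1))"
      by (intro recf_arith recf_vars) simp_all
    show "\<exists>q. xs ! 0 < Suc q * Suc (xs ! 1)" for xs :: "nat list"
      by (rule exI[of _ "xs ! 0"]) simp
  qed
  moreover have "(LEAST q. x < Suc q * Suc d) = x div Suc d" for x d :: nat
  proof (rule Least_equality)
    show "x < Suc (x div Suc d) * Suc d"
      by (metis dividend_less_div_times mult_Suc zero_less_Suc add.commute)
    show "x div Suc d \<le> q" if "x < Suc q * Suc d" for q
      using that by (simp add: div_less_iff_less_mult less_Suc_eq_le[symmetric])
  qed
  ultimately have "recf 2 (\<lambda>xs. xs ! 0 div Suc (xs ! 1))" by simp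
  from recf_comp2[OF this assms(1) recf_diff[OF assms(2) recf_const[of n 1]]]
  show ?thesis by (rule recf_cong) (use assms(3) in force)
qed

lemma decp_even: "recf n a \<Longrightarrow> decp n (\<lambda>xs. even (a xs))"
proof -
  assume a: "recf n a"
  have "decp n (\<lambda>xs. a xs \<le> 2 * (a xs div 2))"
    by (intro recf_arith recf_div a) simp
  then show ?thesis by (rule decp_cong) presburger
qed

lemma recf_power2: "recf n a \<Longrightarrow> recf n (\<lambda>xs. 2 ^ a xs)"
proof (erule recf_comp1[where f = "(^) 2", rotated])
  have "recf 1 (\<lambda>xs. rec_nat 1 (\<lambda>k r. 2 * r) (xs ! 0))"
    by (intro recf_rec recf_const recf_mult recf_nth) simp_all
  moreover have "rec_nat 1 (\<lambda>k r. 2 * r) x = (2 ^ x :: nat)" for x by (induction x) auto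
  ultimately show "recf 1 (\<lambda>xs. 2 ^ (xs ! 0))" by simp
qed

lemma decp_mem: "recf n a \<Longrightarrow> recf n b \<Longrightarrow> decp n (\<lambda>xs. a xs \<in> set_decode (b xs))"
  unfolding set_decode_def mem_Collect_eq
  by (intro decp_not decp_even recf_div recf_power2) simp_all

lemma recf_prod_encode: "recf n a \<Longrightarrow> recf n b \<Longrightarrow> recf n (\<lambda>xs. prod_encode (a xs, b xs))"
  unfolding prod_encode_def split_conv triangle_def
  by (intro recf_arith recf_div) simp_all

text \<open>Pairing is inverted by search. A component is at most the code, which bounds the inner
  quantifier.\<close>

lemma recf_fst: "recf n a \<Longrightarrow> recf n (\<lambda>xs. fst (prod_decode (a xs)))"
proof (erule recf_comp1[where f = "\<lambda>x. fst (prod_decode x)", rotated])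
  have "recf 1 (\<lambda>xs. LEAST x. \<exists>y<Suc (xs ! 0). prod_encode (x, y) = xs ! 0)"
  proof (rule recf_Least)
    show "decp (Suc 1) (\<lambda>ys. \<exists>y<Suc (tl ys ! 0). prod_encode (hd ys, y) = tl ys ! 0)"
      by (intro recf_arith recf_prod_encode recf_vars) simp_all
    show "\<exists>x. \<exists>y<Suc (xs ! 0). prod_encode (x, y) = xs ! 0" for xs :: "nat list"
      by (metis le_imp_less_Suc le_prod_encode_2 prod_decode_inverse surj_pair)
  qed
  moreover have "(LEAST x. \<exists>y<Suc z. prod_encode (x, y) = z) = fst (prod_decode z)" for z
  proof (rule Least_equality)
    show "\<exists>y<Suc z. prod_encode (fst (prod_decode z), y) = z"
      by (metis le_imp_less_Suc le_prod_encode_2 prod_decode_inverse prod.collapse)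
    show "fst (prod_decode z) \<le> x" if "\<exists>y<Suc z. prod_encode (x, y) = z" for x
      using that by auto
  qed
  ultimately show "recf 1 (\<lambda>xs. fst (prod_decode (xs ! 0)))" by simp
qed

lemma recf_snd: "recf n a \<Longrightarrow> recf n (\<lambda>xs. snd (prod_decode (a xs)))"
proof (erule recf_comp1[where f = "\<lambda>x. snd (prod_decode x)", rotated])
  have "recf 1 (\<lambda>xs. LEAST y. \<exists>x<Suc (xs ! 0). prod_encode (x, y) = xs ! 0)"
  proof (rule recf_Least)
    show "decp (Suc 1) (\<lambda>ys. \<exists>x<Suc (tl ys ! 0). prod_encode (x, hd ys) = tl ys ! 0)"
      by (intro recf_arith recf_prod_encode recf_vars) simp_all
    show "\<exists>y. \<exists>x<Suc (xs ! 0). prod_encode (x, y) = xs ! 0" for xs :: "nat list"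
      by (metis le_imp_less_Suc le_prod_encode_1 prod_decode_inverse surj_pair)
  qed
  moreover have "(LEAST y. \<exists>x<Suc z. prod_encode (x, y) = z) = snd (prod_decode z)" for z
  proof (rule Least_equality)
    show "\<exists>x<Suc z. prod_encode (x, snd (prod_decode z)) = z"
      by (metis le_imp_less_Suc le_prod_encode_1 prod_decode_inverse prod.collapse)
    show "snd (prod_decode z) \<le> y" if "\<exists>x<Suc z. prod_encode (x, y) = z" for y
      using that by auto
  qed
  ultimately show "recf 1 (\<lambda>xs. snd (prod_decode (xs ! 0)))" by simp
qed

text \<open>Beyond the end of the coded list the value is \<open>0\<close>, because \<open>0 - 1 = 0\<close>.\<close>

definition code_nth :: "nat \<Rightarrow> nat \<Rightarrow> nat" where
  "code_nth n k = fst (prod_decode (rec_nat n (\<lambda>_ r. snd (prod_decode (r - 1))) k - 1))"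

lemma code_nth_list_encode: "k < length xs \<Longrightarrow> code_nth (list_encode xs) k = xs ! k"
proof -
  have "rec_nat (list_encode xs) (\<lambda>_ r. snd (prod_decode (r - 1))) k = list_encode (drop k xs)"
    if "k \<le> length xs" for k
    using that
  proof (induction k)
    case (Suc k)
    then have "drop k xs = xs ! k # drop (Suc k) xs" by (simp add: Cons_nth_drop_Suc)
    then show ?case using Suc by simp
  qed simp
  moreover assume "k < length xs"
  moreover from this have "drop k xs = xs ! k # drop (Suc k) xs" by (simp add: Cons_nth_drop_Suc)
  ultimately show ?thesis by (simp add: code_nth_def)
qed

lemma recf_code_nth: "recf n a \<Longrightarrow> recf n b \<Longrightarrow> recf n (\<lambda>xs. code_nth (a xs) (b xs))"
  unfolding code_nth_def by (intro recf_fst recf_diff recf_rec recf_snd recf_const recf_nth)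
      simp_all

section \<open>Deciding E-realizability\<close>

lemma set_decode_less:
  assumes "p \<in> set_decode A" shows "2 ^ p \<le> A"
proof -
  have eq: "set_decode (set_encode {p}) = {p}" by (rule set_encode_inverse) simp
  have "set_decode (set_encode {p}) \<subseteq> set_decode A" unfolding eq using assms by blast
  then have "set_encode {p} \<le> A" by (rule subset_decode_imp_le)
  then show ?thesis by (simp add: set_encode_def)
qed

lemma set_decode_less_self: "p \<in> set_decode A \<Longrightarrow> p < A"
  using set_decode_less[of p A] less_exp[of p] by linarith

text \<open>Turns quantification over guesses, the subsets of \<open>{..N}\<close>, into bounded
  quantification over codes.\<close>

lemma set_decode_subset_iff: "A < 2 ^ Suc N \<longleftrightarrow> set_decode A \<subseteq> {..N}"
proof
  assume A: "A < 2 ^ Suc N"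
  show "set_decode A \<subseteq> {..N}"
  proof
    fix p assume "p \<in> set_decode A"
    then have "(2::nat) ^ p < 2 ^ Suc N" using set_decode_less A by (meson le_less_trans)
    then have "p < Suc N" by (rule power_less_imp_less_exp[rotated]) simp
    then show "p \<in> {..N}" by simp
  qed
next
  assume "set_decode A \<subseteq> {..N}"
  then have "set_decode A \<subseteq> set_decode (set_encode {..N})" by simp
  then have "A \<le> set_encode {..N}" by (rule subset_decode_imp_le)
  also have "set_encode {..N} < 2 ^ Suc N" unfolding set_encode_def by (induction N) auto
  finally show "A < 2 ^ Suc N" .
qed

section \<open>Measures stored as finite tables\<close>

definition table :: "nat \<Rightarrow> nat \<Rightarrow> nat \<Rightarrow> nat \<Rightarrow> nat" where
  "table t m A j = code_nth t (prod_encode (m, prod_encode (A, j)))"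

abbreviation table_set :: "nat \<Rightarrow> nat \<Rightarrow> nat set \<Rightarrow> nat \<Rightarrow> nat" where
  "table_set t m A j \<equiv> table t m (set_encode A) j"

text \<open>The weight enters as a difference \<open>wp - wn\<close> of naturals with the subtracted
  part moved to the other side, so the inequality stays within the natural numbers.\<close>

definition measure_step_code where
  "measure_step_code N s t C wp wn m m' a i \<longleftrightarrow> (\<forall>A<2 ^ Suc N. \<forall>A'<2 ^ Suc N. \<forall>j<Suc N.
     tableau_step N (set_decode A) (set_decode a \<union> set_decode i) (set_decode A') \<longrightarrow>
         0 < table s m A j \<longrightarrow>
     0 < table s m' A' (next_index N (set_decode A) j) \<and>
     (table s m' A' (next_index N (set_decode A) j) < table s m A j \<or>
      table s m' A' (next_index N (set_decode A) j) = table s m A j \<and>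
      (if even (table s m A j) then \<not> accepting N (set_decode A) j
       else table t m' A' (next_index N (set_decode A) j) + C * wp + of_bool (accepting N
           (set_decode A) j)
         \<le> table t m A j + C * wn)))"

lemma measure_step_code_iff:
  "measure_step_code N s t C wp wn m m' a i \<longleftrightarrow>
   measure_step N (table_set s) (table_set t) C (int wp - int wn) m m'
       (set_decode a \<union> set_decode i)"
proof -
  have ineq: "x' + C * wp + of_bool b \<le> x + C * wn \<longleftrightarrow>
      int x' + int C * (int wp - int wn) + of_bool b \<le> int x" for x x' :: nat and b
  proof -
    have "x' + C * wp + of_bool b \<le> x + C * wn \<longleftrightarrow>
        int (x' + C * wp + of_bool b) \<le> int (x + C * wn)" by (rule of_nat_le_iff[symmetric])
    then show ?thesis by (auto simp: algebra_simps)
  qed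
  \<comment> \<open>Each guess occurs twice, as code and as set, so both statements become instances
    of \<open>body\<close> that differ only in their quantifiers.\<close>
  define body where "body A0 A A0' A' j \<longleftrightarrow>
     (tableau_step N A (set_decode a \<union> set_decode i) A' \<longrightarrow> 0 < table s m A0 j \<longrightarrow>
      0 < table s m' A0' (next_index N A j) \<and>
      (table s m' A0' (next_index N A j) < table s m A0 j \<or>
       table s m' A0' (next_index N A j) = table s m A0 j \<and>
       (if even (table s m A0 j) then \<not> accepting N A j
        else table t m' A0' (next_index N A j) + C * wp + of_bool
            (accepting N A j) \<le> table t m A0 j + C * wn)))"
    for A0 A A0' A' j
  have 1: "measure_step_code N s t C wp wn m m' a i \<longleftrightarrow>
      (\<forall>A<2 ^ Suc N. \<forall>A'<2 ^ Suc N. \<forall>j<Suc N. body A (set_decode A) A' (set_decode A') j)"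
    unfolding measure_step_code_def body_def ..
  have 2: "measure_step N (table_set s) (table_set t) C (int wp - int wn) m m'
    (set_decode a \<union> set_decode i) \<longleftrightarrow>
      (\<forall>A A' j. A \<subseteq> {..N} \<longrightarrow> A' \<subseteq> {..N} \<longrightarrow> j \<le> N \<longrightarrow> body (set_encode A) A (set_encode A') A' j)"
    unfolding measure_step_def body_def ineq ..
  show ?thesis unfolding 1 2
  proof (intro iffI allI impI)
    fix A A' :: "nat set" and j :: nat
    assume *: "\<forall>A<2 ^ Suc N. \<forall>A'<2 ^ Suc N. \<forall>j<Suc N. body A (set_decode A) A' (set_decode A') j"
      and A: "A \<subseteq> {..N}" "A' \<subseteq> {..N}" "j \<le> N"
    have f: "finite A" "finite A'" using A finite_subset by blast+
    then have "set_encode A < 2 ^ Suc N" "set_encode A' < 2 ^ Suc N"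
      unfolding set_decode_subset_iff using A by simp_all
    then show "body (set_encode A) A (set_encode A') A' j"
      using *[rule_format, of "set_encode A" "set_encode A'" j] A f by simp
  next
    fix A A' j :: nat
    assume *: "\<forall>A A' j. A \<subseteq> {..N} \<longrightarrow> A' \<subseteq> {..N} \<longrightarrow> j \<le> N \<longrightarrow>
        body (set_encode A) A (set_encode A') A' j"
      and A: "A < 2 ^ Suc N" "A' < 2 ^ Suc N" "j < Suc N"
    show "body A (set_decode A) A' (set_decode A') j"
      using *[rule_format, of "set_decode A"
          "set_decode A'" j] A(1,2)[unfolded set_decode_subset_iff] A(3)
      by simp
  qed
qed

lemma measure_step_transfer:
  assumes "\<And>A j. A \<subseteq> {..N} \<Longrightarrow> j \<le> N \<Longrightarrow> \<kappa> m A j = \<kappa>' k A j \<and> \<pi> m A j = \<pi>' k A j"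
    "\<And>A j. A \<subseteq> {..N} \<Longrightarrow> j \<le> N \<Longrightarrow> \<kappa> m' A j = \<kappa>' k' A j \<and> \<pi> m' A j = \<pi>' k' A j"
    and t: "measure_step N \<kappa> \<pi> C wl m m' x"
  shows "measure_step N \<kappa>' \<pi>' C wl k k' x"
  unfolding measure_step_def
proof (intro allI impI)
  fix A A' j
  assume a: "A \<subseteq> {..N}" "A' \<subseteq> {..N}" "j \<le> N" "tableau_step N A x A'" "0 < \<kappa>' k A j"
  have n: "next_index N A j \<le> N" using a(3) by (auto simp: next_index_def)
  show "0 < \<kappa>' k' A' (next_index N A j) \<and>
     (\<kappa>' k' A' (next_index N A j) < \<kappa>' k A j \<or> \<kappa>' k' A' (next_index N A j) = \<kappa>' k A j \<and>
      (if even (\<kappa>' k A j) then \<not> accepting N A j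
       else int (\<pi>' k' A' (next_index N A j)) + int C * wl + of_bool (accepting N A j) \<le> int
           (\<pi>' k A j)))"
    using t[unfolded measure_step_def, rule_format, of A A' j] a
    unfolding assms(1)[OF a(1,3), THEN conjunct1] assms(1)[OF a(1,3), THEN conjunct2]
      assms(2)[OF a(2) n, THEN conjunct1] assms(2)[OF a(2) n, THEN conjunct2] by blast
qed

lemma table_exists: "\<exists>t. \<forall>k<b. code_nth t k = f k"
  by (rule exI[of _ "list_encode (map f [0..<b])"]) (simp add: code_nth_list_encode)

lemma table_set_exists:
  "\<exists>t. \<forall>m<M. \<forall>A. A \<subseteq> {..N} \<longrightarrow> (\<forall>j\<le>N. table_set t m A j = \<kappa> m A j)"
proof -
  define D where "D = (\<lambda>(m, A, j). prod_encode (m, prod_encode (set_encode A,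
    j))) ` ({..<M} \<times> Pow {..N} \<times> {..N})"
  have "finite D" by (simp add: D_def)
  then obtain b where b: "\<And>k. k \<in> D \<Longrightarrow> k < b" by (meson finite_nat_set_iff_bounded)
  define f where "f k = (case prod_decode k of (m, y) \<Rightarrow> case prod_decode y of (A,
    j) \<Rightarrow> \<kappa> m (set_decode A) j)" for k
  obtain t where t: "\<And>k. k < b \<Longrightarrow> code_nth t k = f k" using table_exists by blast
  have "table_set t m A j = \<kappa> m A j" if "m < M" "A \<subseteq> {..N}" "j \<le> N" for m A j
  proof -
    have "prod_encode (m, prod_encode (set_encode A, j)) \<in> D" unfolding D_def using that by force
    moreover have "finite A" using that(2) finite_subset by blast
    ultimately show ?thesis using t[OF b] by (simp add: table_def f_def)
  qed
  then show ?thesis by blast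
qed

text \<open>The states are numbered: \<open>g\<close> recovers the state of a number,
  \<open>f\<close> gives the number of a chosen successor. The finitely many relevant values of the
  measures are then tabulated. Both kinds of certificates are transported in this way.\<close>

lemma tables_exist:
  fixes S :: "'m set"
  assumes "finite S"
  shows "\<exists>M f g r s t. (\<forall>m\<in>S. f m < M \<and> g (f m) = m) \<and> (\<forall>k<M. g k \<in> S \<and> code_nth r k = e (g k)) \<and>
    (\<forall>C wl k m' x. k < M \<longrightarrow> m' \<in> S \<longrightarrow> measure_step N \<kappa> \<pi> C wl (g k) m' x \<longrightarrow>
      measure_step N (table_set s) (table_set t) C wl k (f m') x) \<and>
    (\<forall>k A. k < M \<longrightarrow> A \<subseteq> {..N} \<longrightarrow> table_set s k A 0 = \<kappa> (g k) A 0)"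
proof -
  obtain f where f: "bij_betw f S {0..<card S}" using ex_bij_betw_finite_nat[OF assms] by blast
  define g where "g = inv_into S f"
  have fg: "f m < card S \<and> g (f m) = m" if "m \<in> S" for m
    using f that by (auto simp: g_def bij_betw_def)
  have g: "g k \<in> S" if "k < card S" for k
    using f that unfolding g_def bij_betw_def by (metis atLeastLessThan_iff inv_into_into zero_le)
  obtain r where r: "\<And>k. k < card S \<Longrightarrow> code_nth r k = e (g k)"
    using table_exists[of "card S" "\<lambda>k. e (g k)"] by blast
  obtain s where s: "\<And>k A j. k < card S \<Longrightarrow> A \<subseteq> {..N} \<Longrightarrow> j \<le> N \<Longrightarrow> table_set s k A j = \<kappa> (g k) A j"
    using table_set_exists[of "card S" N "\<lambda>k. \<kappa> (g k)"] by blast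
  obtain t where t: "\<And>k A j. k < card S \<Longrightarrow> A \<subseteq> {..N} \<Longrightarrow> j \<le> N \<Longrightarrow> table_set t k A j = \<pi> (g k) A j"
    using table_set_exists[of "card S" N "\<lambda>k. \<pi> (g k)"] by blast
  have "measure_step N (table_set s) (table_set t) C wl k (f m') x"
    if "k < card S" "m' \<in> S" "measure_step N \<kappa> \<pi> C wl (g k) m' x" for C wl k m' x
    by (rule measure_step_transfer[OF _ _ that(3)]) (use s t fg that in auto)
  then show ?thesis using fg g r s
    by (intro exI[of _ "card S"] exI[of _ f] exI[of _ g] exI[of _ r] exI[of _ s] exI[of _ t]) simp
qed

lemma pos_cert_tables:
  assumes "finite S" and c: "pos_cert inp out w N S m0 e \<kappa> \<pi> C"
  shows "\<exists>M m0 r s t. pos_cert inp out w N {..<M} m0 (code_nth r) (table_set s) (table_set t) C"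
proof -
  obtain M f g r s t where f: "\<forall>m\<in>S. f m < M \<and> g (f m) = m"
    and g: "\<forall>k<M. g k \<in> S \<and> code_nth r k = e (g k)"
    and st: "\<forall>C wl k m' x. k < M \<longrightarrow> m' \<in> S \<longrightarrow> measure_step N \<kappa> \<pi> C wl (g k) m' x \<longrightarrow>
      measure_step N (table_set s) (table_set t) C wl k (f m') x"
    and s: "\<forall>k A. k < M \<longrightarrow> A \<subseteq> {..N} \<longrightarrow> table_set s k A 0 = \<kappa> (g k) A 0"
    using tables_exist[OF assms(1), where e = e and N = N and \<kappa> = \<kappa> and \<pi> = \<pi>]
    by (elim exE conjE) (rule that)
  have m0: "m0 \<in> S" and C: "0 < C" and i: "\<forall>A. A \<subseteq> {..N} \<longrightarrow> N \<notin> A \<longrightarrow> 0 < \<kappa> m0 A 0"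
    and mv: "\<forall>m\<in>S. \<exists>a\<subseteq>out. \<forall>i\<subseteq>inp. \<exists>m'\<in>S.
        int (e m') \<le> int (e m) + letter_energy inp out w (a \<union> i) \<and>
            measure_step N \<kappa> \<pi> C 0 m m' (a \<union> i)"
    using c unfolding pos_cert_def by simp_all
  have "pos_cert inp out w N {..<M} (f m0) (code_nth r) (table_set s) (table_set t) C"
    unfolding pos_cert_def
  proof (intro conjI ballI)
    show "f m0 \<in> {..<M}" "0 < C" using f m0 C by auto
    show "\<forall>A. A \<subseteq> {..N} \<longrightarrow> N \<notin> A \<longrightarrow> 0 < table_set s (f m0) A 0" using i s f m0 by simp
    fix k assume "k \<in> {..<M}"
    then have k: "k < M" by simp
    obtain a where a: "a \<subseteq> out" "\<forall>i\<subseteq>inp. \<exists>m'\<in>S.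
        int (e m') \<le> int (e (g k)) + letter_energy inp out w (a \<union> i) \<and>
            measure_step N \<kappa> \<pi> C 0 (g k) m' (a \<union> i)"
      using mv g k by meson
    show "\<exists>a\<subseteq>out. \<forall>i\<subseteq>inp. \<exists>m'\<in>{..<M}.
      int (code_nth r m') \<le> int (code_nth r k) + letter_energy inp out w (a \<union> i) \<and>
        measure_step N (table_set s) (table_set t) C 0 k m' (a \<union> i)"
    proof (intro exI[of _ a] conjI allI impI a(1))
      fix i assume "i \<subseteq> inp"
      then obtain m' where "m' \<in> S" "int (e m') \<le> int (e (g k)) + letter_energy inp out w (a \<union> i)"
        "measure_step N \<kappa> \<pi> C 0 (g k) m' (a \<union> i)" using a(2) by blast
      then show "\<exists>m'\<in>{..<M}.
        int (code_nth r m') \<le> int (code_nth r k) + letter_energy inp out w (a \<union> i) \<and>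
        measure_step N (table_set s) (table_set t) C 0 k m' (a \<union> i)"
        using k g f st by (intro bexI[of _ "f m'"]) auto
    qed
  qed
  then show ?thesis by blast
qed

lemma neg_cert_tables:
  assumes "finite S" and c: "neg_cert inp out w N S m0 \<kappa> \<pi> C"
  shows "\<exists>M m0 s t. neg_cert inp out w N {..<M} m0 (table_set s) (table_set t) C"
proof -
  obtain M f g r s t where f: "\<forall>m\<in>S. f m < M \<and> g (f m) = m"
    and g: "\<forall>k<M. g k \<in> S \<and> code_nth r k = (0::nat)"
    and st: "\<forall>C wl k m' x. k < M \<longrightarrow> m' \<in> S \<longrightarrow> measure_step N \<kappa> \<pi> C wl (g k) m' x \<longrightarrow>
      measure_step N (table_set s) (table_set t) C wl k (f m') x"
    and s: "\<forall>k A. k < M \<longrightarrow> A \<subseteq> {..N} \<longrightarrow> table_set s k A 0 = \<kappa> (g k) A 0"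
    using tables_exist[OF assms(1), where e = "\<lambda>_. 0" and N = N and \<kappa> = \<kappa> and \<pi> = \<pi>]
    by (elim exE conjE) (rule that)
  have m0: "m0 \<in> S" and C: "0 < C" and i: "\<forall>A. A \<subseteq> {..N} \<longrightarrow> N \<in> A \<longrightarrow> 0 < \<kappa> m0 A 0"
    and mv: "\<forall>m\<in>S. \<forall>a\<subseteq>out. \<exists>i\<subseteq>inp. \<exists>m'\<in>S.
        measure_step N \<kappa> \<pi> C (letter_energy inp out w (a \<union> i)) m m' (a \<union> i)"
    using c unfolding neg_cert_def by simp_all
  have "neg_cert inp out w N {..<M} (f m0) (table_set s) (table_set t) C"
    unfolding neg_cert_def
  proof (intro conjI ballI allI impI)
    show "f m0 \<in> {..<M}" "0 < C" using f m0 C by auto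
    show "0 < table_set s (f m0) A 0" if "A \<subseteq> {..N}" "N \<in> A" for A using i s f m0 that by simp
    fix k a assume "k \<in> {..<M}" and a: "a \<subseteq> out"
    then have k: "k < M" by simp
    obtain i m' where "i \<subseteq> inp" "m' \<in> S"
      "measure_step N \<kappa> \<pi> C (letter_energy inp out w (a \<union> i)) (g k) m' (a \<union> i)"
      using mv g k a by meson
    then show "\<exists>i\<subseteq>inp. \<exists>m'\<in>{..<M}.
      measure_step N (table_set s) (table_set t) C (letter_energy inp out w (a \<union> i)) k m' (a \<union> i)"
      using k f st by (intro exI[of _ i] conjI bexI[of _ "f m'"]) auto
  qed
  then show ?thesis by blast
qed

lemma cert_nat:
  assumes "finite inp" "finite out"
  shows "(\<exists>M m0 r s t C.
      pos_cert inp out w N {..<M} m0 (code_nth r) (table_set s) (table_set t) C) \<or>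
    (\<exists>M m0 s t C. neg_cert inp out w N {..<M} m0 (table_set s) (table_set t) C)"
proof -
  \<comment> \<open>The determinisation provides the automaton; the priority of steps without merges
    is the bound \<open>B\<close>.\<close>
  interpret pa: parity_automaton N "rc.Q N" "rc.q0 N" "rc.\<delta> N" "prioN N"
    "Suc (2 * Suc (card (range (class_of N))))"
  proof
    fix u
    have "rec_nat (rc.q0 N) (\<lambda>n q. rc.\<delta> N q (u n)) n = rc.st N u n" for n
      by (induction n) (simp_all add: rc.st_0 rc.st_Suc)
    then show "truth u 0 N \<longleftrightarrow>
        even_liminf (\<lambda>n. prioN N (rec_nat (rc.q0 N) (\<lambda>n q. rc.\<delta> N q (u n)) n) (u n))"
      using truth_parity by simp
  qed (rule rc.finite_Q rc.q0_in rc.\<delta>_in rc.prio_le | assumption)+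
  from pa.cert_exists[OF assms, of w] show ?thesis
  proof (elim disjE exE conjE)
    fix S :: "nat set" and m0 e \<kappa> \<pi> C
    assume "finite S" "pos_cert inp out w N S m0 e \<kappa> \<pi> C"
    from pos_cert_tables[OF this] show ?thesis by blast
  next
    fix S m0 \<kappa> \<pi> C
    assume "finite S" "neg_cert inp out w N S m0 \<kappa> \<pi> C"
    from neg_cert_tables[OF this] show ?thesis by blast
  qed
qed

section \<open>Specifications and certificates as codes\<close>

definition inputs_of :: "nat \<Rightarrow> nat set" where
  "inputs_of c = set_decode (code_nth c 0)"

text \<open>Inputs are removed so that the two sets are disjoint for every number \<open>c\<close>,
  whether or not it codes a specification: the search has to terminate for all
  \<open>c\<close>.\<close>

definition outputs_of :: "nat \<Rightarrow> nat set" where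
  "outputs_of c = set_decode (code_nth c 1) - set_decode (code_nth c 0)"

text \<open>Weights are listed in increasing order of the propositions, so the index of
  \<open>p\<close> is the number of smaller ones.\<close>

definition weight_code :: "nat \<Rightarrow> nat \<Rightarrow> nat" where
  "weight_code c p = code_nth (code_nth c 2)
     (\<Sum>q<p. of_bool (q \<in> set_decode (code_nth c 0) \<or> q \<in> set_decode (code_nth c 1)))"

definition weight_of :: "nat \<Rightarrow> nat literal \<Rightarrow> int" where
  "weight_of c l = (case l of Pos p \<Rightarrow> int_decode (fst (prod_decode (weight_code c p)))
     | Neg p \<Rightarrow> int_decode (snd (prod_decode (weight_code c p))))"

text \<open>Positive and negative part of a coded integer: an even code \<open>2 k\<close> stands
  for \<open>k\<close>, an odd code \<open>2 k + 1\<close> for \<open>- k - 1\<close>.\<close>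

definition posd :: "nat \<Rightarrow> nat" where "posd n = (if even n then n div 2 else 0)"
definition negd :: "nat \<Rightarrow> nat" where "negd n = (if even n then 0 else Suc (n div 2))"

lemma int_decode_posd_negd: "int_decode n = int (posd n) - int (negd n)"
  by (auto simp: int_decode_def sum_decode_def posd_def negd_def)

text \<open>Elements of a coded set are smaller than its code, so the sum of the two codes bounds
  all propositions.\<close>

definition wsum :: "(nat \<Rightarrow> nat) \<Rightarrow> nat \<Rightarrow> nat \<Rightarrow> nat \<Rightarrow> nat" where
  "wsum d c a i = (\<Sum>p<code_nth c 0 + code_nth c 1.
     if p \<in> set_decode (code_nth c 0) \<or> p \<in> set_decode (code_nth c 1)
     then if p \<in> set_decode a \<or> p \<in> set_decode i then d (fst (prod_decode (weight_code c p)))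
       else d (snd (prod_decode (weight_code c p)))
     else 0)"

lemma letter_weight_if:
  assumes "finite X"
  shows "letter_weight w X (x \<inter> X) = (\<Sum>p\<in>X. if p \<in> x then w (Pos p) else w (Neg p))"
proof -
  have "X \<inter> {p. p \<in> x} = x \<inter> X" "X \<inter> - {p. p \<in> x} = X - (x \<inter> X)" by auto
  then show ?thesis using assms by (simp add: letter_weight_def sum.If_cases)
qed

lemma letter_energy_code:
  "letter_energy (inputs_of c) (outputs_of c) (weight_of c) (set_decode a \<union> set_decode i) =
    int (wsum posd c a i) - int (wsum negd c a i)"
proof -
  let ?P = "set_decode (code_nth c 0) \<union> set_decode (code_nth c 1)"
  let ?x = "set_decode a \<union> set_decode i"
  let ?g = "\<lambda>p. if p \<in> ?x then weight_of c (Pos p) else weight_of c (Neg p)"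
  have P: "?P = outputs_of c \<union> inputs_of c" "outputs_of c \<inter> inputs_of c = {}"
    by (auto simp: inputs_of_def outputs_of_def)
  have fin: "finite (outputs_of c)" "finite (inputs_of c)"
    by (simp_all add: inputs_of_def outputs_of_def)
  have "letter_energy (inputs_of c) (outputs_of c) (weight_of c) ?x = (\<Sum>p\<in>?P. ?g p)"
    unfolding letter_energy_def letter_weight_if[OF fin(1)] letter_weight_if[OF fin(2)] P(1)
    by (rule sum.union_disjoint[OF fin P(2), symmetric])
  also have "\<dots> = (\<Sum>p<code_nth c 0 + code_nth c 1. if p \<in> ?P then ?g p else 0)"
  proof (rule sum.mono_neutral_cong_left)
    show "?P \<subseteq> {..<code_nth c 0 + code_nth c 1}" by (auto dest!: set_decode_less_self)
  qed auto
  also have "\<dots> = (\<Sum>p<code_nth c 0 + code_nth c 1.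
      int (if p \<in> ?P then if p \<in> ?x then posd (fst (prod_decode (weight_code c p)))
       else posd (snd (prod_decode (weight_code c p))) else 0) - int
           (if p \<in> ?P then if p \<in> ?x then negd (fst (prod_decode (weight_code c p)))
       else negd (snd (prod_decode (weight_code c p))) else 0))"
    by (rule sum.cong) (auto simp: weight_of_def int_decode_posd_negd)
  finally show ?thesis unfolding wsum_def by (simp only: sum_subtractf of_nat_sum Un_iff)
qed

text \<open>The number \<open>n\<close> codes the list of the number of states, the initial state, \<open>C\<close>, and tables of the
  energies, of \<open>\<kappa>\<close> and of \<open>\<pi>\<close>.\<close>

definition pos_check :: "nat \<Rightarrow> nat \<Rightarrow> bool" where
  "pos_check c n \<longleftrightarrow> code_nth n 1 < code_nth n 0 \<and> 0 < code_nth n 2 \<and>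
     (\<forall>A<2 ^ Suc (code_nth c 3). code_nth c 3 \<notin> set_decode A \<longrightarrow>
         0 < table (code_nth n 4) (code_nth n 1) A 0) \<and>
     (\<forall>m<code_nth n 0. \<exists>a<Suc (code_nth c 1).
        (\<forall>p<a. p \<in> set_decode a \<longrightarrow> p \<in> set_decode (code_nth c 1) \<and> p \<notin> set_decode (code_nth c 0)) \<and>
        (\<forall>i<Suc (code_nth c 0). (\<forall>p<i. p \<in> set_decode i \<longrightarrow> p \<in> set_decode (code_nth c 0)) \<longrightarrow>
          (\<exists>m'<code_nth n 0.
              code_nth (code_nth n 3) m' + wsum negd c a i \<le> code_nth
              (code_nth n 3) m + wsum posd c a i \<and>
             measure_step_code (code_nth c 3) (code_nth n 4) (code_nth n 5)
                 (code_nth n 2) 0 0 m m' a i)))"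

definition neg_check :: "nat \<Rightarrow> nat \<Rightarrow> bool" where
  "neg_check c n \<longleftrightarrow> code_nth n 1 < code_nth n 0 \<and> 0 < code_nth n 2 \<and>
     (\<forall>A<2 ^ Suc (code_nth c 3). code_nth c 3 \<in> set_decode A \<longrightarrow>
         0 < table (code_nth n 4) (code_nth n 1) A 0) \<and>
     (\<forall>m<code_nth n 0. \<forall>a<Suc (code_nth c 1).
        (\<forall>p<a. p \<in> set_decode a \<longrightarrow> p \<in> set_decode (code_nth c 1) \<and> p \<notin> set_decode (code_nth c 0)) \<longrightarrow>
        (\<exists>i<Suc (code_nth c 0). (\<forall>p<i. p \<in> set_decode i \<longrightarrow> p \<in> set_decode (code_nth c 0)) \<and>
          (\<exists>m'<code_nth n 0.
              measure_step_code (code_nth c 3) (code_nth n 4) (code_nth n 5) (code_nth n 2)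
             (wsum posd c a i) (wsum negd c a i) m m' a i)))"

text \<open>A subset has a code no larger than that of the set, so the choice of a letter is a
  bounded quantifier.\<close>

lemma ex_code:
  assumes "X \<subseteq> set_decode b"
  shows "(\<exists>a<Suc b. set_decode a \<subseteq> X \<and> P (set_decode a)) \<longleftrightarrow> (\<exists>a\<subseteq>X. P a)"
proof
  assume "\<exists>a\<subseteq>X. P a"
  then obtain a where a: "a \<subseteq> X" "P a" by blast
  have "finite a" using a(1) assms finite_set_decode finite_subset by metis
  then have d: "set_decode (set_encode a) = a" by (rule set_encode_inverse)
  then have "set_encode a \<le> b" using a(1) assms by (intro subset_decode_imp_le) simp
  then show "\<exists>a<Suc b. set_decode a \<subseteq> X \<and> P (set_decode a)"
    using a d by (intro exI[of _ "set_encode a"]) simp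
qed auto

lemma all_code:
  assumes "X \<subseteq> set_decode b"
  shows "(\<forall>a<Suc b. set_decode a \<subseteq> X \<longrightarrow> P (set_decode a)) \<longleftrightarrow> (\<forall>a\<subseteq>X. P a)"
  using ex_code[OF assms, of "\<lambda>a. \<not> P a"] by blast

lemma sub_code:
  "(\<forall>p<a. p \<in> set_decode a \<longrightarrow>
    p \<in> set_decode (code_nth c 1) \<and> p \<notin> set_decode (code_nth c 0)) \<longleftrightarrow> set_decode a \<subseteq> outputs_of c"
  "(\<forall>p<i. p \<in> set_decode i \<longrightarrow> p \<in> set_decode (code_nth c 0)) \<longleftrightarrow> set_decode i \<subseteq> inputs_of c"
  by (auto simp: outputs_of_def inputs_of_def dest: set_decode_less_self)

lemma code_subset: "inputs_of c \<subseteq> set_decode (code_nth c 0)"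
    "outputs_of c \<subseteq> set_decode (code_nth c 1)"
  by (auto simp: outputs_of_def inputs_of_def)

lemma all_vec: "(\<forall>A<2 ^ Suc N. P (set_decode A) A) \<longleftrightarrow> (\<forall>A. A \<subseteq> {..N} \<longrightarrow> P A (set_encode A))"
proof (intro iffI allI impI)
  fix A :: "nat set" assume *: "\<forall>A<2 ^ Suc N. P (set_decode A) A" and A: "A \<subseteq> {..N}"
  then have d: "set_decode (set_encode A) = A" using finite_subset
    by (intro set_encode_inverse) blast
  then have "set_encode A < 2 ^ Suc N" unfolding set_decode_subset_iff using A by simp
  then show "P A (set_encode A)" using * d by metis
next
  fix A :: nat assume *: "\<forall>A. A \<subseteq> {..N} \<longrightarrow> P A (set_encode A)" and A: "A < 2 ^ Suc N"
  then show "P (set_decode A) A" unfolding set_decode_subset_iff using set_decode_inverse by metis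
qed

lemma pos_check_iff:
  "pos_check c n \<longleftrightarrow>
    pos_cert (inputs_of c) (outputs_of c) (weight_of c) (code_nth c 3) {..<code_nth n 0}
    (code_nth n 1)
     (code_nth (code_nth n 3)) (table_set (code_nth n 4)) (table_set (code_nth n 5)) (code_nth n 2)"
proof -
  define ok where "ok m a i \<longleftrightarrow> (\<exists>m'\<in>{..<code_nth n 0}.
      int (code_nth (code_nth n 3) m') \<le> int (code_nth (code_nth n 3) m) + letter_energy
          (inputs_of c) (outputs_of c) (weight_of c) (a \<union> i) \<and>
      measure_step (code_nth c 3) (table_set (code_nth n 4)) (table_set (code_nth n 5))
          (code_nth n 2) 0 m m' (a \<union> i))" for m a i
  have ok: "(\<exists>m'<code_nth n 0.
    code_nth (code_nth n 3) m' + wsum negd c a i \<le> code_nth (code_nth n 3) m + wsum posd c a i \<and>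
      measure_step_code (code_nth c 3) (code_nth n 4) (code_nth n 5) (code_nth n 2) 0 0 m m' a i) \<longleftrightarrow>
          ok m (set_decode a) (set_decode i)" for m a i
    unfolding ok_def letter_energy_code measure_step_code_iff by (auto simp: Bex_def)
  have "pos_check c n \<longleftrightarrow> code_nth n 1 < code_nth n 0 \<and> 0 < code_nth n 2 \<and>
     (\<forall>A. A \<subseteq> {..code_nth c 3} \<longrightarrow> code_nth c 3 \<notin> A \<longrightarrow>
         0 < table_set (code_nth n 4) (code_nth n 1) A 0) \<and>
     (\<forall>m<code_nth n 0. \<exists>a\<subseteq>outputs_of c. \<forall>i\<subseteq>inputs_of c. ok m a i)"
    unfolding pos_check_def sub_code ok all_code[OF code_subset(1)]
      ex_code[OF code_subset(2), where P = "\<lambda>a. \<forall>i\<subseteq>inputs_of c. ok m a i" for m]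
      all_vec[of "code_nth c 3" "\<lambda>A A'. code_nth c 3 \<notin> A \<longrightarrow>
          0 < table (code_nth n 4) (code_nth n 1) A' 0"] ..
  then show ?thesis unfolding pos_cert_def ok_def by (simp only: lessThan_iff Ball_def)
qed

lemma neg_check_iff:
  "neg_check c n \<longleftrightarrow>
    neg_cert (inputs_of c) (outputs_of c) (weight_of c) (code_nth c 3) {..<code_nth n 0}
    (code_nth n 1)
     (table_set (code_nth n 4)) (table_set (code_nth n 5)) (code_nth n 2)"
proof -
  define ok where "ok m a i \<longleftrightarrow> (\<exists>m'\<in>{..<code_nth n 0}.
      measure_step (code_nth c 3) (table_set (code_nth n 4)) (table_set (code_nth n 5))
          (code_nth n 2)
        (letter_energy (inputs_of c) (outputs_of c) (weight_of c) (a \<union> i)) m m' (a \<union> i))" for m a i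
  have ok: "(\<exists>m'<code_nth n 0.
    measure_step_code (code_nth c 3) (code_nth n 4) (code_nth n 5) (code_nth n 2)
      (wsum posd c a i) (wsum negd c a i) m m' a i) \<longleftrightarrow> ok m (set_decode a) (set_decode i)" for m a i
    unfolding ok_def letter_energy_code measure_step_code_iff by (auto simp: Bex_def)
  have "neg_check c n \<longleftrightarrow> code_nth n 1 < code_nth n 0 \<and> 0 < code_nth n 2 \<and>
     (\<forall>A. A \<subseteq> {..code_nth c 3} \<longrightarrow> code_nth c 3 \<in> A \<longrightarrow>
         0 < table_set (code_nth n 4) (code_nth n 1) A 0) \<and>
     (\<forall>m<code_nth n 0. \<forall>a\<subseteq>outputs_of c. \<exists>i\<subseteq>inputs_of c. ok m a i)"
    unfolding neg_check_def sub_code ok ex_code[OF code_subset(1)]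
      all_code[OF code_subset(2), where P = "\<lambda>a. \<exists>i\<subseteq>inputs_of c. ok m a i" for m]
      all_vec[of "code_nth c 3" "\<lambda>A A'. code_nth c 3 \<in> A \<longrightarrow>
          0 < table (code_nth n 4) (code_nth n 1) A' 0"] ..
  then show ?thesis unfolding neg_cert_def ok_def by (simp only: lessThan_iff Ball_def)
qed

text \<open>It holds for every number \<open>c\<close>, as Kleene's minimisation demands of the
  search.\<close>

lemma code_cert_exists: "\<exists>n. pos_check c n \<or> neg_check c n"
proof -
  have fin: "finite (inputs_of c)" "finite (outputs_of c)"
    by (simp_all add: inputs_of_def outputs_of_def)
  from cert_nat[OF fin, of "weight_of c" "code_nth c 3"] show ?thesis
  proof (elim disjE exE)
    fix M m0 r s t C
    assume "pos_cert (inputs_of c) (outputs_of c) (weight_of c) (code_nth c 3) {..<M} m0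
        (code_nth r) (table_set s) (table_set t) C"
    then have "pos_check c (list_encode [M, m0, C, r, s, t])"
      unfolding pos_check_iff by (simp add: code_nth_list_encode del: list_encode.simps)
    then show ?thesis by blast
  next
    fix M m0 s t C
    assume "neg_cert (inputs_of c) (outputs_of c) (weight_of c) (code_nth c 3) {..<M} m0
        (table_set s) (table_set t) C"
    then have "neg_check c (list_encode [M, m0, C, 0, s, t])"
      unfolding neg_check_iff by (simp add: code_nth_list_encode del: list_encode.simps)
    then show ?thesis by blast
  qed
qed

lemma idx_sorted:
  assumes "finite P" "p \<in> P"
  shows "card {q \<in> P. q < p} < length (sorted_list_of_set P) \<and>
    sorted_list_of_set P ! card {q \<in> P. q < (p::nat)} = p"
proof -
  let ?xs = "sorted_list_of_set P"
  have set: "set ?xs = P" and d: "distinct ?xs" and s: "sorted_wrt (<) ?xs"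
    using assms by simp_all
  obtain k where k: "k < length ?xs" "?xs ! k = p" using assms set by (metis in_set_conv_nth)
  have "{q \<in> P. q < p} = (!) ?xs ` {..<k}"
  proof
    show "{q \<in> P. q < p} \<subseteq> (!) ?xs ` {..<k}"
    proof
      fix q assume "q \<in> {q \<in> P. q < p}"
      then obtain l where l: "l < length ?xs" "?xs ! l = q" "q < p"
        using set by (metis (no_types, lifting) in_set_conv_nth mem_Collect_eq)
      have "l < k"
      proof (rule ccontr)
        assume "\<not> l < k"
        then have "p \<le> q" using sorted_wrt_nth_less[OF s, of k l] k l by (cases "k = l") auto
        then show False using l by simp
      qed
      then show "q \<in> (!) ?xs ` {..<k}" using l by blast
    qed
    show "(!) ?xs ` {..<k} \<subseteq> {q \<in> P. q < p}"
      using sorted_wrt_nth_less[OF s] k set nth_mem[of _ ?xs] by fastforce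
  qed
  moreover have "inj_on ((!) ?xs) {..<k}" using d k by (auto simp: inj_on_def nth_eq_iff_index_eq)
  ultimately have "card {q \<in> P. q < p} = k" by (simp add: card_image)
  then show ?thesis using k by simp
qed

lemma encode_spec_decode:
  fixes w :: "nat literal \<Rightarrow> int" and \<phi> :: "nat ltl"
  assumes "finite inputs" "finite outputs" "inputs \<inter> outputs = {}"
  defines "c \<equiv> encode_spec inputs outputs w \<phi>"
  shows "inputs_of c = inputs" "outputs_of c = outputs" "dec_ltl (code_nth c 3) = \<phi>"
    "\<And>p. p \<in> inputs \<union> outputs \<Longrightarrow> weight_of c (Pos p) = w (Pos p) \<and> weight_of c (Neg p) = w (Neg p)"
proof -
  have l: "code_nth c 0 = set_encode inputs" "code_nth c 1 = set_encode outputs"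
    "code_nth c 2 = encode_weights (inputs \<union> outputs) w" "code_nth c 3 = encode_ltl \<phi>"
    unfolding c_def encode_spec_def by (simp_all add: code_nth_list_encode del: list_encode.simps)
  have d: "set_decode (code_nth c 0) = inputs" "set_decode (code_nth c 1) = outputs"
    unfolding l using assms set_encode_inverse by blast+
  show "inputs_of c = inputs" "outputs_of c = outputs" unfolding inputs_of_def outputs_of_def d
    using assms(3) by auto
  show "dec_ltl (code_nth c 3) = \<phi>" unfolding l by (rule dec_ltl_encode)
  fix p assume p: "p \<in> inputs \<union> outputs"
  let ?P = "inputs \<union> outputs"
  have idx: "(\<Sum>q<p. of_bool (q \<in> inputs \<or> q \<in> outputs)) = card {q \<in> ?P. q < p}"
  proof -
    have "{q \<in> ?P. q < p} = {..<p} \<inter> {q. q \<in> inputs \<or> q \<in> outputs}" by auto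
    then show ?thesis by (subst sum_of_bool_eq) simp_all
  qed
  have "weight_code c p = code_nth (encode_weights ?P w) (card {q \<in> ?P. q < p})"
    unfolding weight_code_def d l(3) idx ..
  also have "\<dots> = prod_encode (int_encode (w (Pos p)), int_encode (w (Neg p)))"
    unfolding encode_weights_def using idx_sorted[of ?P p] p assms(1,2)
    by (simp add: code_nth_list_encode)
  finally show "weight_of c (Pos p) = w (Pos p) \<and> weight_of c (Neg p) = w (Neg p)"
    by (simp add: weight_of_def)
qed

text \<open>A code records only the weights of literals over the given propositions, so the decoded
  weight function may differ from the original elsewhere.\<close>

lemma E_realizable_cong:
  assumes "\<And>p. p \<in> inputs \<union> outputs \<Longrightarrow> w (Pos p) = w' (Pos p) \<and> w (Neg p) = w' (Neg p)"
  shows "E_realizable inputs outputs w \<phi> \<longleftrightarrow> E_realizable inputs outputs w' \<phi>"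
proof -
  have "letter_weight w X (x \<inter> X) = letter_weight w' X (x \<inter> X)" if "X \<subseteq> inputs \<union> outputs" for X x
    unfolding letter_weight_def using assms that by (intro arg_cong2[where f = "(+)"] sum.cong) auto
  then have "energy_level inputs outputs w = energy_level inputs outputs w'"
    by (intro ext) (simp add: energy_level_def)
  then show ?thesis by (simp add: E_realizable_def)
qed

section \<open>Recursiveness of the certificate checks\<close>

lemma decp_all_le:
  assumes "recf n b" "decp (Suc n) (\<lambda>ys. P (hd ys) (tl ys))"
  shows "decp n (\<lambda>xs. \<forall>k\<le>b xs. P k xs)"
  using decp_all[OF recf_Suc[OF assms(1)] assms(2)] by (simp add: less_Suc_eq_le)

lemma decp_True: "decp n (\<lambda>_. True)"
  unfolding decp_def by (rule recf_const)

lemmas recf_rules = recf_arith decp_True decp_all_le decp_even recf_power2 decp_mem recf_prod_encode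
    recf_fst recf_snd recf_code_nth

lemma recf_tag: "recf n a \<Longrightarrow> recf n (\<lambda>xs. tag (a xs))"
  and recf_arg: "recf n a \<Longrightarrow> recf n (\<lambda>xs. arg (a xs))"
  and recf_lft: "recf n a \<Longrightarrow> recf n (\<lambda>xs. lft (a xs))"
  and recf_rgt: "recf n a \<Longrightarrow> recf n (\<lambda>xs. rgt (a xs))"
  unfolding tag_def arg_def lft_def rgt_def by (intro recf_fst recf_snd; assumption)+

lemma decp_fulfilled:
  "recf n a \<Longrightarrow> recf n b \<Longrightarrow> recf n d \<Longrightarrow> decp n (\<lambda>xs. a xs \<in> fulfilled (b xs) (set_decode (d xs)))"
  unfolding fulfilled_def mem_Collect_eq by (intro recf_rules recf_tag recf_rgt; assumption)

lemma recf_next_index: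
  "recf n a \<Longrightarrow> recf n b \<Longrightarrow> recf n d \<Longrightarrow> recf n (\<lambda>xs. next_index (a xs) (set_decode (b xs)) (d xs))"
  unfolding next_index_def by (intro recf_rules decp_fulfilled; assumption)

lemma decp_accepting:
  "recf n a \<Longrightarrow> recf n b \<Longrightarrow> recf n d \<Longrightarrow> decp n (\<lambda>xs. accepting (a xs) (set_decode (b xs)) (d xs))"
  unfolding accepting_def by (intro recf_rules decp_fulfilled; assumption)

lemma decp_local_cond:
  "recf n a \<Longrightarrow> recf n b \<Longrightarrow> recf n d \<Longrightarrow> recf n e \<Longrightarrow> recf n f \<Longrightarrow>
   decp n (\<lambda>xs. local_cond (a xs) (set_decode (b xs)) (set_decode (d xs) \<union> set_decode (e xs))
       (set_decode (f xs)))"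
  unfolding local_cond_def Un_iff
      by (intro recf_rules recf_tag recf_arg recf_lft recf_rgt; assumption)

text \<open>Weakening: a parameter stays recursive under one more bound variable.\<close>

lemma recf_tl:
  assumes "recf n F" shows "recf (Suc n) (\<lambda>ys. F (tl ys))"
proof -
  let ?as = "map (\<lambda>i xs. xs ! Suc i) [0..<n]"
  have "recf (Suc n) (\<lambda>xs. F (map (\<lambda>a. a xs) ?as))"
    by (rule recf_comp) (use assms in \<open>auto intro: recf_nth\<close>)
  then show ?thesis
  proof (rule recf_cong)
    fix zs :: "nat list" assume "length zs = Suc n"
    then have "map (\<lambda>a. a zs) ?as = tl zs" by (auto intro!: nth_equalityI simp: nth_tl)
    then show "F (map (\<lambda>a. a zs) ?as) = F (tl zs)" by simp
  qed
qed

lemma decp_tableau_step: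
  assumes "recf n a" "recf n b" "recf n d" "recf n e" "recf n f"
  shows "decp n (\<lambda>xs.
      tableau_step (a xs) (set_decode (b xs)) (set_decode (d xs) \<union> set_decode (e xs)) (set_decode
      (f xs)))"
  unfolding tableau_step_def
  by (intro decp_all_le decp_iff decp_mem decp_local_cond assms recf_tl[OF assms(2)] recf_tl[OF
      assms(3)]
      recf_tl[OF assms(4)] recf_tl[OF assms(5)] recf_vars(3)) simp_all

lemma recf_table: "recf n a \<Longrightarrow> recf n b \<Longrightarrow> recf n d \<Longrightarrow> recf n e \<Longrightarrow>
    recf n (\<lambda>xs. table (a xs) (b xs) (d xs) (e xs))"
  unfolding table_def by (intro recf_code_nth recf_prod_encode)

lemma recf_weight_code: "recf n a \<Longrightarrow> recf n b \<Longrightarrow> recf n (\<lambda>xs. weight_code (a xs) (b xs))"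
proof (erule (1) recf_comp2[where f = weight_code, rotated])
  show "recf 2 (\<lambda>xs. weight_code (xs ! 0) (xs ! 1))"
    unfolding weight_code_def by (intro recf_rules recf_vars) simp_all
qed

lemma recf_posd: "recf n a \<Longrightarrow> recf n (\<lambda>xs. posd (a xs))"
  and recf_negd: "recf n a \<Longrightarrow> recf n (\<lambda>xs. negd (a xs))"
  unfolding posd_def negd_def by (intro recf_rules recf_div; simp)+

lemma decp_pos_check: "recf n a \<Longrightarrow> recf n b \<Longrightarrow> decp n (\<lambda>xs. pos_check (a xs) (b xs))"
  unfolding decp_def
proof (erule (1) recf_comp2[where f = "\<lambda>c n. of_bool (pos_check c n)", rotated])
  have "decp 2 (\<lambda>xs. pos_check (xs ! 0) (xs ! 1))"
    unfolding pos_check_def wsum_def measure_step_code_def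
    by (intro recf_rules recf_table recf_next_index decp_accepting decp_tableau_step
        recf_weight_code recf_posd recf_negd
        recf_vars; simp)
  then show "recf 2 (\<lambda>xs. of_bool (pos_check (xs ! 0) (xs ! 1)))" by (simp add: decp_def)
qed

lemma decp_neg_check: "recf n a \<Longrightarrow> recf n b \<Longrightarrow> decp n (\<lambda>xs. neg_check (a xs) (b xs))"
  unfolding decp_def
proof (erule (1) recf_comp2[where f = "\<lambda>c n. of_bool (neg_check c n)", rotated])
  have "decp 2 (\<lambda>xs. neg_check (xs ! 0) (xs ! 1))"
    unfolding neg_check_def wsum_def measure_step_code_def
    by (intro recf_rules recf_table recf_next_index decp_accepting decp_tableau_step
        recf_weight_code recf_posd recf_negd
        recf_vars; simp)
  then show "recf 2 (\<lambda>xs. of_bool (neg_check (xs ! 0) (xs ! 1)))" by (simp add: decp_def)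
qed

section \<open>The two target games\<close>

definition win_game :: "nat safety_game" where
  "win_game = \<lparr>states1 = {0}, states2 = {}, init = 0, edges = {(0, 0)}, safe = {0}\<rparr>"

definition lose_game :: "nat safety_game" where
  "lose_game = \<lparr>states1 = {0}, states2 = {}, init = 0, edges = {(0, 0)}, safe = {}\<rparr>"

lemma is_safety_game_win_lose: "is_safety_game win_game" "is_safety_game lose_game"
  by (auto simp: is_safety_game_def states_def win_game_def lose_game_def)

lemma player1_wins_win_game: "player1_wins win_game"
proof -
  have "\<rho> n = 0" if "\<rho> \<in> plays win_game" for \<rho> n
    using that by (cases n) (auto simp: plays_def win_game_def)
  then have "winning1 win_game (\<lambda>_. 0)" by (simp add: winning1_def) (simp add: win_game_def)
  moreover have "(\<lambda>_. 0) \<in> strategies1 win_game" by (simp add: strategies1_def win_game_def)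
  ultimately show ?thesis by (auto simp: player1_wins_def)
qed

text \<open>The loop is the only edge, so the constant play is consistent with every strategy, and
  it leaves the empty safe set at once.\<close>

lemma not_player1_wins_lose_game: "\<not> player1_wins lose_game"
proof
  assume "player1_wins lose_game"
  then obtain \<tau> where s: "\<tau> \<in> strategies1 lose_game" and w: "winning1 lose_game \<tau>"
    by (auto simp: player1_wins_def)
  have "\<tau> (h @ [0]) = 0" if "h \<in> lists {0}" for h
    using s that by (auto simp: strategies1_def states_def lose_game_def)
  moreover have "map (\<lambda>_. 0 :: nat) [0..<n] \<in> lists {0}" for n by auto
  ultimately have "consistent1 lose_game \<tau> (\<lambda>_. 0)" by (simp add: consistent1_def)
  moreover have "(\<lambda>_. 0) \<in> plays lose_game" by (simp add: plays_def lose_game_def)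
  ultimately have "(0::nat) \<in> safe lose_game" using w by (auto simp: winning1_def)
  then show False by (simp add: lose_game_def)
qed

theorem theorem10:
  "\<exists>f. computable f \<and>
    (\<forall>(inputs :: nat set) outputs (w :: nat literal \<Rightarrow> int) (\<phi> :: nat ltl).
      finite inputs \<longrightarrow> finite outputs \<longrightarrow> inputs \<inter> outputs = {} \<longrightarrow>
      atoms \<phi> \<subseteq> inputs \<union> outputs \<longrightarrow>
      (\<exists>G :: nat safety_game.
         f (encode_spec inputs outputs w \<phi>) = encode_game G \<and>
         is_safety_game G \<and>
         (player1_wins G \<longleftrightarrow> E_realizable inputs outputs w \<phi>)))"
proof -
  define cert where "cert c = (LEAST n. pos_check c n \<or> neg_check c n)" for c
  have cert: "pos_check c (cert c) \<or> neg_check c (cert c)" for c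
    unfolding cert_def using code_cert_exists by (rule LeastI_ex)
  \<comment> \<open>Both kinds of certificates are sound, so the kind of the least one already gives
    the answer.\<close>
  define f where "f c = (if pos_check c
    (cert c) then encode_game win_game else encode_game lose_game)" for c
  have "recf 1 (\<lambda>xs. cert (xs ! 0))" unfolding cert_def
  proof (rule recf_Least)
    show "decp (Suc 1) (\<lambda>ys. pos_check (tl ys ! 0) (hd ys) \<or> neg_check (tl ys ! 0) (hd ys))"
      by (intro decp_disj decp_pos_check decp_neg_check recf_vars) simp_all
  qed (rule code_cert_exists)
  then have "decp 1 (\<lambda>xs. pos_check (xs ! 0) (cert (xs ! 0)))"
    by (intro decp_pos_check recf_nth) simp_all
  then have "recf 1 (\<lambda>xs. f (xs ! 0))" unfolding f_def by (intro recf_if recf_const)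
  then have "computable f" unfolding recf_def computable_def
    by (metis length_Cons list.size(3) nth_Cons_0 One_nat_def)
  moreover have "\<exists>G. f (encode_spec inputs outputs w \<phi>) = encode_game G \<and> is_safety_game G \<and>
      (player1_wins G \<longleftrightarrow> E_realizable inputs outputs w \<phi>)"
    if fin: "finite inputs" "finite outputs" "inputs \<inter> outputs = {}" for inputs outputs w \<phi>
  proof -
    define c where "c = encode_spec inputs outputs w \<phi>"
    note d = encode_spec_decode[OF fin, where w = w and \<phi> = \<phi>, folded c_def]
    have E: "E_realizable inputs outputs (weight_of c) \<phi> \<longleftrightarrow> E_realizable inputs outputs w \<phi>"
      by (rule E_realizable_cong) (rule d(4))
    show ?thesis
    proof (cases "pos_check c (cert c)")
      case True
      have "E_realizable inputs outputs w \<phi>"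
        using pos_cert_sound[OF True[unfolded pos_check_iff]] unfolding d E by blast
      then show ?thesis using True is_safety_game_win_lose player1_wins_win_game
        by (intro exI[of _ win_game]) (simp add: f_def c_def)
    next
      case False
      then have neg: "neg_check c (cert c)" using cert by blast
      have "\<not> E_realizable inputs outputs w \<phi>"
        using neg_cert_sound[OF neg[unfolded neg_check_iff]] unfolding d E by blast
      then show ?thesis using False is_safety_game_win_lose not_player1_wins_lose_game
        by (intro exI[of _ lose_game]) (simp add: f_def c_def)
    qed
  qed
  ultimately show ?thesis by blast
qed

end
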